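(* Let $f(t)\in\mathbb{Z}[t,t^{-1}]$ be a Laurent polynomial, with derivative $f'(t)$. Then the following are equivalent. (i) There exists a long virtual knot $K$ with $G_{00}(K;t)=f(t)$. (ii) There exists a long virtual knot $K'$ with $G_{00}(K';t)=f(t)$ and $sg_1(K')\le 1$. (iii) $f(1)=f'(1)=0$. The same equivalence holds with $G_{00}$ replaced by $G_{11}$.
   Context: Long virtual knots. A long virtual knot diagram is an oriented immersed line in $\mathbb{R}^2$ that coincides with the $x$-axis outside a $2$-disk (oriented from $-\infty$ to $\infty$), each of whose double points is either a real crossing (with over/under information) or a virtual crossing. A long virtual knot is an equivalence class of such diagrams under the generalized (real, virtual and mixed) Reidemeister moves performed inside a $2$-disk. Let $\Sigma_g$ be a connected oriented closed surface of genus $g$. A surface realization $(\Sigma_g,D)$ of a diagram $D$ is an oriented closed-curve diagram with a basepoint on $\Sigma_g$, having only real crossings, such that traversing it from the basepoint one meets the same real crossings, in the same order and with the same over/under information and signs, as when traversing $D$ from $-\infty$ to $\infty$. A surface realization of $K$ is a surface realization of some diagram of $K$. The $1$-supporting genus is $sg_1(K)=\min\{g\mid(\Sigma_g,D)\text{ is a surface realization of }K\}$. Polynomials. Let $c_1,\dots,c_n$ be the real crossings of a diagram $D$ of $K$, with signs $\varepsilon_i\in\{\pm1\}$. Call $c_i$ of type $0$ if, traversing $D$ from $-\infty$, one passes $c_i$ first over and then under; otherwise of type $1$. Put $I_a(D)=\{i\mid c_i\text{ is of type }a\}$ and $\omega_a(D)=\sum_{i\in I_a(D)}\varepsilon_i$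 for $a\in\{0,1\}$. On a surface realization $(\Sigma_g,D)$, orientation-respecting smoothing at $c_i$ yields two cycles; $\alpha_i$ is the one not containing the basepoint and $\beta_i$ the one containing it. A dot denotes the intersection number of cycles on $\Sigma_g$ (with a fixed standard sign convention). The following are invariants of $K$, for $a,b\in\{0,1\}$: $W_a(K;t)=\sum_{i\in I_a(D)}\varepsilon_i(t^{\alpha_i\cdot\beta_i}-1)$; $G_{ab}(K;t)=\sum_{i\in I_a(D),\,j\in I_b(D)}\varepsilon_i\varepsilon_j(t^{\alpha_i\cdot\beta_j}-1)-\omega_b(D)\,W_a(K;t)$. *)

theory Defs
  imports Complex_Main "HOL-Library.Poly_Mapping" "HOL-Library.Extended_Nat"
    "HOL-Combinatorics.Orbits"
begin

section \<open>Laurent polynomials\<close>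

text \<open>
  The ring of Laurent polynomials with integer coefficients is the group ring of the integers:
  \<open>lookup f k\<close> is the coefficient of \<open>t\<close> to the power \<open>k\<close>, and multiplication is convolution.
\<close>

type_synonym laurent = "int \<Rightarrow>\<^sub>0 int"

definition t_pow :: "int \<Rightarrow> laurent" where
  "t_pow k = Poly_Mapping.single k 1"

definition laurent_eval :: "laurent \<Rightarrow> 'a :: field \<Rightarrow> 'a" where
  "laurent_eval f x = (\<Sum>k \<in> Poly_Mapping.keys f. of_int (Poly_Mapping.lookup f k) * x powi k)"

definition laurent_deriv :: "laurent \<Rightarrow> laurent" where
  "laurent_deriv f = (\<Sum>k \<in> Poly_Mapping.keys f. Poly_Mapping.single (k - 1) (k * Poly_Mapping.lookup f k))"


section \<open>Closed oriented surfaces and cycles on them\<close>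

text \<open>
  A connected closed oriented surface is given by a cellular decomposition, encoded as a
  combinatorial map: a dart is an oriented edge, seen as the germ of that edge at its initial
  vertex; \<open>flip\<close> reverses a dart; \<open>rot\<close> sends a dart to the next dart counterclockwise around its
  initial vertex.  Vertices are the orbits of \<open>rot\<close>, edges those of \<open>flip\<close>, and faces those of
  \<open>rot \<circ> flip\<close>, since \<open>rot (flip d)\<close> follows \<open>d\<close> on the boundary of the face to the right of \<open>d\<close>.
\<close>

record surface =
  darts :: "nat set"
  rot :: "nat \<Rightarrow> nat"
  flip :: "nat \<Rightarrow> nat"

definition closed_surface :: "surface \<Rightarrow> bool" where
  "closed_surface S \<longleftrightarrow>
     finite (darts S) \<and> darts S \<noteq> {} \<and>
     rot S permutes darts S \<and> flip S permutes darts S \<and>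
     (\<forall>d \<in> darts S. flip S d \<noteq> d \<and> flip S (flip S d) = d) \<and>
     (\<forall>d \<in> darts S. \<forall>e \<in> darts S. (\<lambda>x y. y = rot S x \<or> y = flip S x)\<^sup>*\<^sup>* d e)"

definition vertex :: "surface \<Rightarrow> nat \<Rightarrow> nat set" where
  "vertex S d = orbit (rot S) d"

definition num_orbits :: "(nat \<Rightarrow> nat) \<Rightarrow> nat set \<Rightarrow> nat" where
  "num_orbits f A = card (orbit f ` A)"

definition euler_characteristic :: "surface \<Rightarrow> int" where
  "euler_characteristic S =
     int (num_orbits (rot S) (darts S)) - int (num_orbits (flip S) (darts S))
       + int (num_orbits (rot S \<circ> flip S) (darts S))"

definition has_genus :: "surface \<Rightarrow> nat \<Rightarrow> bool" where
  "has_genus S g \<longleftrightarrow> closed_surface S \<and> euler_characteristic S = 2 - 2 * int g"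

text \<open>
  A closed curve in the 1-skeleton is a cyclic list of darts.  Its \<open>k\<close>-th passage is its visit to the
  vertex between \<open>ds ! k\<close> and the cyclically next dart \<open>out_dart ds k\<close>; \<open>in_dart S ds k\<close> is the germ,
  at that vertex, of the edge along which the curve arrives.
\<close>

definition out_dart :: "nat list \<Rightarrow> nat \<Rightarrow> nat" where
  "out_dart ds k = ds ! (Suc k mod length ds)"

definition in_dart :: "surface \<Rightarrow> nat list \<Rightarrow> nat \<Rightarrow> nat" where
  "in_dart S ds k = flip S (ds ! k)"

text \<open>The darts met when turning counterclockwise from \<open>q\<close> to \<open>p\<close>, both excluded.\<close>

definition darts_between :: "surface \<Rightarrow> nat \<Rightarrow> nat \<Rightarrow> nat set" where
  "darts_between S q p =
     {(rot S ^^ n) q | n. 0 < n \<and> (\<forall>m. 0 < m \<and> m \<le> n \<longrightarrow> (rot S ^^ m) q \<noteq> p \<and> (rot S ^^ m) q \<noteq> q)}"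

text \<open>
  The intersection number of the cycles carried by two closed curves \<open>xs\<close>, \<open>ys\<close> in the 1-skeleton:
  push \<open>xs\<close> off itself to its left.  At a passage entering by the germ \<open>p\<close> and leaving by the
  germ \<open>q\<close>, the pushed curve crosses exactly the darts lying strictly between \<open>q\<close> and \<open>p\<close>.  An
  intersection counts \<open>+1\<close> if (direction of \<open>xs\<close>, direction of \<open>ys\<close>) is a positive frame, that is, if
  \<open>ys\<close> leaves to the left of \<open>xs\<close>.
\<close>

definition intersection_number :: "surface \<Rightarrow> nat list \<Rightarrow> nat list \<Rightarrow> int" where
  "intersection_number S xs ys =
     (\<Sum>k < length xs. \<Sum>e \<in> darts_between S (out_dart xs k) (in_dart S xs k).
        int (count_list ys e) - int (count_list ys (flip S e)))"


section \<open>Curves with crossings on a surface\<close>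

text \<open>
  A crossing consists of a name and its crossing information.  In \<open>Real a pos\<close>, the flag \<open>a\<close> says that
  the crossing is passed first over and then under, and \<open>pos\<close> that its sign is \<open>+1\<close>.  In \<open>Virtual l\<close>,
  the flag \<open>l\<close> gives the value of \<open>orientation\<close> below.
\<close>

datatype kind = Real bool bool | Virtual bool

type_synonym crossing = "nat \<times> kind"

fun is_real :: "crossing \<Rightarrow> bool" where
  "is_real (n, Real a pos) = True"
| "is_real (n, Virtual l) = False"

fun crossing_type :: "crossing \<Rightarrow> nat" where
  "crossing_type (n, Real a pos) = (if a then 0 else 1)"
| "crossing_type (n, Virtual l) = undefined"

fun crossing_sign :: "crossing \<Rightarrow> int" where
  "crossing_sign (n, Real a pos) = (if pos then 1 else -1)"
| "crossing_sign (n, Virtual l) = undefined"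

text \<open>
  \<open>orientation c\<close> is \<open>+1\<close> iff (direction of first passage, direction of second passage) is a positive
  frame.  As the sign of a real crossing is \<open>+1\<close> iff (direction of the over strand, direction of the
  under strand) is a positive frame, the orientation is the sign for type \<open>0\<close> and its negative for
  type \<open>1\<close>.
\<close>

fun orientation :: "crossing \<Rightarrow> int" where
  "orientation (n, Real a pos) = (if a = pos then 1 else -1)"
| "orientation (n, Virtual l) = (if l then 1 else -1)"

text \<open>
  The sequence of crossings met by a curve, starting from its basepoint, or from minus infinity.
\<close>

definition gauss_word :: "crossing list \<Rightarrow> bool" where
  "gauss_word w \<longleftrightarrow> (\<forall>c \<in> set w. count_list w c = 2)"

text \<open>
  Closed curves in the 1-skeleton without repeated edges.  The basepoint is the midpoint of the first
  edge \<open>ds ! 0\<close>, so the passages occur in the order \<open>0, 1, \<dots>, length ds - 1\<close>.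
\<close>

definition closed_curve :: "surface \<Rightarrow> nat list \<Rightarrow> bool" where
  "closed_curve S ds \<longleftrightarrow>
     ds \<noteq> [] \<and> set ds \<subseteq> darts S \<and> distinct ds \<and> (\<forall>d \<in> set ds. flip S d \<notin> set ds) \<and>
     (\<forall>k < length ds. vertex S (in_dart S ds k) = vertex S (out_dart ds k))"

definition crossing_passages :: "surface \<Rightarrow> nat list \<Rightarrow> nat list" where
  "crossing_passages S ds =
     filter (\<lambda>k. \<exists>l < length ds. l \<noteq> k \<and> vertex S (out_dart ds l) = vertex S (out_dart ds k))
       [0..<length ds]"

text \<open>
  The passages \<open>k\<close> and \<open>l\<close> go through a common 4-valent vertex and are transversal there, their
  directions forming a positive frame if \<open>s = 1\<close> and a negative one otherwise.
\<close>

definition transversal :: "surface \<Rightarrow> nat list \<Rightarrow> nat \<Rightarrow> nat \<Rightarrow> int \<Rightarrow> bool" where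
  "transversal S ds k l s \<longleftrightarrow>
     (let i = in_dart S ds k; q = out_dart ds k; i' = in_dart S ds l; q' = out_dart ds l
      in if s = 1 then rot S q = q' \<and> rot S q' = i \<and> rot S i = i' \<and> rot S i' = q
         else rot S q = i' \<and> rot S i' = i \<and> rot S i = q' \<and> rot S q' = q)"

text \<open>
  \<open>curve_diagram S ds w\<close>: the curve \<open>ds\<close> on \<open>S\<close> together with the crossing information in \<open>w\<close> is a
  closed-curve diagram, which meets the crossings \<open>w\<close> in this order when traversed from the
  basepoint.  Every generic closed curve on a closed surface arises in this way: it is a subcomplex
  of a cellular decomposition whose vertices at double points are 4-valent.  Neither the other
  vertices and edges nor the complement of the curve are constrained, so the curve need not fill
  the surface.
\<close>

definition curve_diagram :: "surface \<Rightarrow> nat list \<Rightarrow> crossing list \<Rightarrow> bool" where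
  "curve_diagram S ds w \<longleftrightarrow>
     closed_surface S \<and> closed_curve S ds \<and> gauss_word w \<and>
     (let ps = crossing_passages S ds in
        length ps = length w \<and>
        (\<forall>i j. i < j \<and> j < length w \<longrightarrow>
           (w ! i = w ! j \<longleftrightarrow> vertex S (out_dart ds (ps ! i)) = vertex S (out_dart ds (ps ! j))) \<and>
           (w ! i = w ! j \<longrightarrow> transversal S ds (ps ! i) (ps ! j) (orientation (w ! i)))))"


section \<open>Long virtual knots\<close>

text \<open>
  A long diagram in the plane is, by adding the point at infinity, a closed-curve diagram on the
  sphere with basepoint infinity.  Up to isotopy of the plane it is determined by the sequence of
  its (real and virtual) crossings from minus to plus infinity together with the crossing
  information, so long virtual knot diagrams up to planar isotopy are encoded by the words that can
  be drawn on the sphere.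
\<close>

definition long_diagram :: "crossing list \<Rightarrow> bool" where
  "long_diagram w \<longleftrightarrow> (\<exists>S ds. has_genus S 0 \<and> curve_diagram S ds w)"

text \<open>Two crossings can be created by a second (real or virtual) Reidemeister move.\<close>

fun bigon_kinds :: "kind \<Rightarrow> kind \<Rightarrow> bool" where
  "bigon_kinds (Real a pos) (Real a' pos') \<longleftrightarrow> a = a' \<and> pos \<noteq> pos'"
| "bigon_kinds (Virtual l) (Virtual l') \<longleftrightarrow> l \<noteq> l'"
| "bigon_kinds _ _ \<longleftrightarrow> False"

text \<open>
  In a third Reidemeister move three strands, numbered in the order in which they are traversed, meet
  pairwise; the arguments are the kinds of the crossings 12, 13 and 23.  Either all crossings are
  real and one strand lies above and another one below the remaining two, or all are virtual, or
  (mixed move) a virtual strand passes a real crossing.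
\<close>

fun triangle_kinds :: "kind \<Rightarrow> kind \<Rightarrow> kind \<Rightarrow> bool" where
  "triangle_kinds (Real a pos) (Real b pos') (Real c pos'') \<longleftrightarrow> \<not> (a = c \<and> b \<noteq> a)"
| "triangle_kinds (Virtual l) (Virtual l') k \<longleftrightarrow> True"
| "triangle_kinds (Virtual l) k (Virtual l') \<longleftrightarrow> True"
| "triangle_kinds k (Virtual l) (Virtual l') \<longleftrightarrow> True"
| "triangle_kinds _ _ _ \<longleftrightarrow> False"

definition two_passages :: "int \<Rightarrow> crossing \<Rightarrow> crossing \<Rightarrow> crossing list" where
  "two_passages s x y = (if s = 1 then [x, y] else [y, x])"

text \<open>
  The three strands around a triangle.  For straight strands with directions \<open>v1\<close>, \<open>v2\<close>, \<open>v3\<close>, the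
  orders in which the strands pass their two crossings are determined by the signs \<open>oij\<close> of
  \<open>det (vi, vj)\<close> and by the side \<open>s\<close> on which strand 3 passes the crossing 12.  The third
  Reidemeister move changes \<open>s\<close>.
\<close>

definition triangle_word ::
  "int \<Rightarrow> crossing \<Rightarrow> crossing \<Rightarrow> crossing \<Rightarrow>
     crossing list \<Rightarrow> crossing list \<Rightarrow> crossing list \<Rightarrow> crossing list \<Rightarrow> crossing list" where
  "triangle_word s x12 x13 x23 u0 u1 u2 u3 =
     (let o12 = orientation x12; o13 = orientation x13; o23 = orientation x23 in
        u0 @ two_passages (s * o13) x12 x13 @
        u1 @ two_passages (s * o23) x12 x23 @
        u2 @ two_passages (s * o12 * o13 * o23) x13 x23 @ u3)"

text \<open>
  The moves, for crossings that may be real, virtual or mixed.  The monogon, bigon or triangle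
  involved is automatically a face of the diagram.  In \<open>reid2\<close>, the requirement in \<open>move_step\<close> that
  the longer word be planar says that the two strands bound a common face before the move.
\<close>

inductive reidemeister :: "crossing list \<Rightarrow> crossing list \<Rightarrow> bool" where
  rename: "inj_on \<rho> (set w) \<Longrightarrow> (\<And>c. c \<in> set w \<Longrightarrow> snd (\<rho> c) = snd c) \<Longrightarrow>
     reidemeister w (map \<rho> w)"
| reid1: "reidemeister (u @ v) (u @ [c, c] @ v)"
| reid2: "bigon_kinds (snd c) (snd d) \<Longrightarrow> p = [c, d] \<or> p = [d, c] \<Longrightarrow>
     reidemeister (u @ v @ w) (u @ [c, d] @ v @ p @ w)"
| reid3: "triangle_kinds (snd x12) (snd x13) (snd x23) \<Longrightarrow>
     reidemeister (triangle_word 1 x12 x13 x23 u0 u1 u2 u3)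
                  (triangle_word (-1) x12 x13 x23 u0 u1 u2 u3)"

definition move_step :: "crossing list \<Rightarrow> crossing list \<Rightarrow> bool" where
  "move_step D D' \<longleftrightarrow> long_diagram D \<and> long_diagram D' \<and> reidemeister D D'"

definition diagram_equiv :: "(crossing list \<times> crossing list) set" where
  "diagram_equiv = {(D, D'). long_diagram D \<and> long_diagram D' \<and> equivclp move_step D D'}"

text \<open>A long virtual knot is an equivalence class of diagrams.\<close>

definition long_virtual_knots :: "crossing list set set" where
  "long_virtual_knots = Collect long_diagram // diagram_equiv"


section \<open>Surface realizations and the supporting genus\<close>

definition surface_realization :: "surface \<Rightarrow> nat list \<Rightarrow> crossing list \<Rightarrow> crossing list \<Rightarrow> bool" where
  "surface_realization S ds w D \<longleftrightarrow> curve_diagram S ds w \<and> w = filter is_real D"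

definition knot_realization ::
  "surface \<Rightarrow> nat list \<Rightarrow> crossing list \<Rightarrow> crossing list set \<Rightarrow> bool" where
  "knot_realization S ds w K \<longleftrightarrow> (\<exists>D \<in> K. surface_realization S ds w D)"

definition sg1 :: "crossing list set \<Rightarrow> enat" where
  "sg1 K = Inf {enat g | g. \<exists>S ds w. has_genus S g \<and> knot_realization S ds w K}"


section \<open>The polynomials\<close>

text \<open>
  The two passages of the curve through the crossing \<open>c\<close>, as passage indices of \<open>ds\<close>.
\<close>

definition passages_of :: "surface \<Rightarrow> nat list \<Rightarrow> crossing list \<Rightarrow> crossing \<Rightarrow> nat list" where
  "passages_of S ds w c =
     map (\<lambda>i. crossing_passages S ds ! i) (filter (\<lambda>i. w ! i = c) [0..<length w])"

text \<open>
  Smoothing at a crossing with passages \<open>k < l\<close>: the first loop runs through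
  \<open>ds ! Suc k, \<dots>, ds ! l\<close> and avoids the basepoint on \<open>ds ! 0\<close>; the second one is the rest.
\<close>

definition alpha_cycle :: "surface \<Rightarrow> nat list \<Rightarrow> crossing list \<Rightarrow> crossing \<Rightarrow> nat list" where
  "alpha_cycle S ds w c =
     (let k = passages_of S ds w c ! 0; l = passages_of S ds w c ! 1
      in drop (Suc k) (take (Suc l) ds))"

definition beta_cycle :: "surface \<Rightarrow> nat list \<Rightarrow> crossing list \<Rightarrow> crossing \<Rightarrow> nat list" where
  "beta_cycle S ds w c =
     (let k = passages_of S ds w c ! 0; l = passages_of S ds w c ! 1
      in drop (Suc l) ds @ take (Suc k) ds)"

definition crossings_of_type :: "nat \<Rightarrow> crossing list \<Rightarrow> crossing set" where
  "crossings_of_type a w = {c \<in> set w. is_real c \<and> crossing_type c = a}"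

definition writhe :: "nat \<Rightarrow> crossing list \<Rightarrow> int" where
  "writhe a w = (\<Sum>c \<in> crossings_of_type a w. crossing_sign c)"

definition W_real :: "nat \<Rightarrow> surface \<Rightarrow> nat list \<Rightarrow> crossing list \<Rightarrow> laurent" where
  "W_real a S ds w =
     (\<Sum>c \<in> crossings_of_type a w. of_int (crossing_sign c) *
        (t_pow (intersection_number S (alpha_cycle S ds w c) (beta_cycle S ds w c)) - 1))"

definition G_real :: "nat \<Rightarrow> nat \<Rightarrow> surface \<Rightarrow> nat list \<Rightarrow> crossing list \<Rightarrow> laurent" where
  "G_real a b S ds w =
     (\<Sum>c \<in> crossings_of_type a w. \<Sum>d \<in> crossings_of_type b w.
        of_int (crossing_sign c * crossing_sign d) *
          (t_pow (intersection_number S (alpha_cycle S ds w c) (beta_cycle S ds w d)) - 1))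
     - of_int (writhe b w) * W_real a S ds w"

text \<open>
  The polynomial of a long virtual knot is the common value on all its surface realizations.
\<close>

definition G_poly :: "nat \<Rightarrow> nat \<Rightarrow> crossing list set \<Rightarrow> laurent" where
  "G_poly a b K = (THE f. \<forall>S ds w. knot_realization S ds w K \<longrightarrow> G_real a b S ds w = f)"

end

theory Submission
  imports Defs
begin

text \<open>
  On every realization the intersection numbers of the cycles are determined by the Gauss word,
  and the pairing is unchanged by the Reidemeister moves. Antisymmetry of the intersection form
  makes the first-order terms of the polynomial at \<open>t = 1\<close> cancel, whence
  \<open>f(1) = f'(1) = 0\<close>. Conversely, such an \<open>f\<close> is \<open>(t - 1) \<Sum>\<^sub>l \<epsilon>\<^sub>l (t\<^sup>a - 1)\<close> with exponents
  \<open>a\<close> depending on \<open>l\<close>; a curve winding around a torus realizes it, and the Gauss word of that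
  curve becomes a planar word after virtual crossings are inserted.
\<close>

text \<open>\<open>G_poly\<close> is a definite description over all realizations of all diagrams of
  a knot, so it says something only once every \<open>G_real\<close> is expressed by data on which
  the moves act, and once each knot is known to have a realization at all. Averaging over the
  possible pushes gives an expression in the Gauss word alone, in which invariance under the moves
  and antisymmetry become sign computations. For the converse, the over/under information of a
  double point can be chosen freely. All double points of the torus curve except a few selected ones
  are given the other type; they leave the intersection numbers alone and vanish from the sum. One
  additional selected crossing, whose loop is the whole curve plus a meridian, produces the factor t
  - 1.\<close>

section \<open>Gauss words and a combinatorial intersection pairing\<close>

definition first_pos :: "'a list \<Rightarrow> 'a \<Rightarrow> nat" where
  "first_pos w c = Min {i. i < length w \<and> w ! i = c}"

definition second_pos :: "'a list \<Rightarrow> 'a \<Rightarrow> nat" where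
  "second_pos w c = Max {i. i < length w \<and> w ! i = c}"

lemma gauss_word_positions:
  assumes "gauss_word w" "c \<in> set w"
  shows "{i. i < length w \<and> w ! i = c} = {first_pos w c, second_pos w c}"
    and "first_pos w c < second_pos w c"
proof -
  have "card {i. i < length w \<and> w ! i = c} = count_list w c"
    by (simp add: count_list_eq_length_filter length_filter_conv_card eq_commute)
  also have "\<dots> = 2" using assms by (simp add: gauss_word_def)
  finally obtain i j where ij: "{i. i < length w \<and> w ! i = c} = {i, j}" "i \<noteq> j"
    by (auto simp: card_2_iff)
  have "{i. i < length w \<and> w ! i = c} = {first_pos w c, second_pos w c} \<and> first_pos w c < second_pos w c"
    unfolding first_pos_def second_pos_def ij(1) using ij(2) by (cases "i < j") auto
  then show "{i. i < length w \<and> w ! i = c} = {first_pos w c, second_pos w c}"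
    and "first_pos w c < second_pos w c" by auto
qed

lemma first_pos_props:
  assumes "gauss_word w" "c \<in> set w"
  shows "first_pos w c < length w" "w ! first_pos w c = c"
    "second_pos w c < length w" "w ! second_pos w c = c"
    "i < length w \<Longrightarrow> w ! i = c \<Longrightarrow> i = first_pos w c \<or> i = second_pos w c"
  using gauss_word_positions(1)[OF assms] by blast+

lemma orientation_cases: "orientation e = 1 \<or> orientation e = -1"
  by (cases e rule: orientation.cases) auto

lemma orientation_square [simp]: "orientation e * orientation e = 1"
  using orientation_cases[of e] by auto

text \<open>If \<open>f c < s c\<close>, this is the number (0, 1 or 2) of edges of the loop
  \<alpha>_c among the two edges adjacent to the passage \<open>p\<close>, the one before it and the
  one after it. Positions enter only through signs of differences, so only their order
  matters.\<close>

definition winding :: "('c \<Rightarrow> int) \<Rightarrow> ('c \<Rightarrow> int) \<Rightarrow> 'c \<Rightarrow> int \<Rightarrow> int" where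
  "winding f s c p = sgn (p - f c) - sgn (p - s c)"

text \<open>Four times \<alpha>_c \<cdot> \<beta>_d. At each crossing the edge counts of the two
  strands are multiplied; \<open>2 - winding\<close> counts edges of \<beta>_d. Counting the edges
  on both sides of a passage averages the ways of pushing the cycles apart, and the factor 4 avoids
  fractions. The positions are parameters so that the crossings of a shorter word may keep their
  places in a longer one.\<close>

definition pairing :: "crossing set \<Rightarrow> (crossing \<Rightarrow> int) \<Rightarrow> (crossing \<Rightarrow> int) \<Rightarrow> crossing \<Rightarrow> crossing \<Rightarrow> int" where
  "pairing C f s c d =
     (\<Sum>e\<in>C. orientation e *
        (winding f s c (f e) * (2 - winding f s d (s e)) - winding f s c (s e) * (2 - winding f s d (f e))))"

definition word_pairing :: "crossing list \<Rightarrow> crossing \<Rightarrow> crossing \<Rightarrow> int" where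
  "word_pairing w = pairing (set w) (\<lambda>e. int (first_pos w e)) (\<lambda>e. int (second_pos w e))"

text \<open>For equal types the writhe term merges with the double sum: it replaces the 1 subtracted
  from each power by t^(\<alpha>_c \<cdot> \<beta>_c). Division by 4 undoes the scaling of
  \<open>pairing\<close>; it is exact on Gauss words, since these come from curves on
  surfaces.\<close>

definition G_sum :: "crossing set \<Rightarrow> (crossing \<Rightarrow> crossing \<Rightarrow> int) \<Rightarrow> laurent" where
  "G_sum T J = (\<Sum>c\<in>T. \<Sum>d\<in>T. of_int (crossing_sign c * crossing_sign d) *
      (t_pow (J c d div 4) - t_pow (J c c div 4)))"

definition G_word :: "nat \<Rightarrow> crossing list \<Rightarrow> laurent" where
  "G_word a w = G_sum (crossings_of_type a w) (word_pairing w)"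

lemma G_sum_cong:
  assumes "\<And>c d. c \<in> T \<Longrightarrow> d \<in> T \<Longrightarrow> J c d = J' c d"
  shows "G_sum T J = G_sum T J'"
  unfolding G_sum_def by (intro sum.cong) (auto simp: assms)

text \<open>The algebra of the first Reidemeister move: the loop of the new crossing is
  null-homologous, so all entries in its row and in its column coincide with the diagonal entries
  subtracted from them.\<close>

lemma G_sum_insert_trivial:
  assumes "finite T" "x \<notin> T" "\<And>d. d \<in> insert x T \<Longrightarrow> J x d = J x x"
    "\<And>c. c \<in> T \<Longrightarrow> J c x = J c c"
  shows "G_sum (insert x T) J = G_sum T J"
proof -
  define h where "h c d = of_int (crossing_sign c * crossing_sign d) * (t_pow (J c d div 4) - t_pow (J c c div 4))" for c d
  have "h x d = 0" if "d \<in> insert x T" for d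
    unfolding h_def assms(3)[OF that] by simp
  moreover have "h c x = 0" if "c \<in> T" for c
    unfolding h_def assms(4)[OF that] by simp
  ultimately have "(\<Sum>c\<in>insert x T. \<Sum>d\<in>insert x T. h c d) = (\<Sum>c\<in>T. \<Sum>d\<in>T. h c d)"
    using assms(1,2) by simp
  then show ?thesis by (simp add: G_sum_def h_def)
qed

text \<open>The algebra of the second Reidemeister move: opposite signs and homologous loops make
  rows and columns cancel in pairs. The subtracted diagonal terms agree as well, because
  \<open>J x x = J y x = J y y\<close>.\<close>

lemma G_sum_insert_cancel:
  assumes "finite T" "x \<notin> T" "y \<notin> T" "x \<noteq> y" "crossing_sign x = - crossing_sign y"
    "\<And>d. d \<in> insert x (insert y T) \<Longrightarrow> J x d = J y d"
    "\<And>c. c \<in> insert x (insert y T) \<Longrightarrow> J c x = J c y"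
  shows "G_sum (insert x (insert y T)) J = G_sum T J"
proof -
  define h where "h c d = of_int (crossing_sign c * crossing_sign d) * (t_pow (J c d div 4) - t_pow (J c c div 4))" for c d
  have 1: "h x d = - h y d" if "d \<in> insert x (insert y T)" for d
    using assms(5) assms(6)[OF that] assms(6)[of x] assms(7)[of y]
    by (simp add: h_def)
  have 2: "h c x = - h c y" if "c \<in> insert x (insert y T)" for c
    using assms(5) assms(7)[OF that] by (simp add: h_def)
  have "G_sum (insert x (insert y T)) J = (\<Sum>c\<in>insert x (insert y T). \<Sum>d\<in>insert x (insert y T). h c d)"
    by (simp add: G_sum_def h_def)
  also have "\<dots> = (\<Sum>c\<in>insert x (insert y T). \<Sum>d\<in>T. h c d)"
    by (rule sum.cong[OF refl]) (use assms(1-4) in \<open>simp add: 2\<close>)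
  also have "\<dots> = (\<Sum>c\<in>T. \<Sum>d\<in>T. h c d)"
    using assms(1-4) 1 by (simp add: sum_negf)
  finally show ?thesis by (simp add: G_sum_def h_def)
qed

section \<open>The pairing near a monogon, a bigon and a triangle\<close>

lemma winding_adjacent:
  assumes "p \<noteq> f c" "p \<noteq> s c" "q \<noteq> f c" "q \<noteq> s c" "\<bar>p - q\<bar> = 1"
  shows "winding f s c p = winding f s c q"
  using assms unfolding winding_def sgn_if by auto

text \<open>No other loop begins or ends between the two adjacent passages of \<open>x\<close>, so
  every winding is the same at both and the summand of \<open>x\<close> vanishes. The third claim is
  \<alpha>_c \<cdot> \<alpha>_c = 0 in disguise: as \<alpha>_x is trivial, \<beta>_x is the whole
  curve, from which \<beta>_c differs by \<alpha>_c.\<close>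

lemma pairing_monogon:
  assumes "finite C" "x \<notin> C" "s x = f x + 1"
    "\<And>e. e \<in> C \<Longrightarrow> f e \<notin> {f x, s x} \<and> s e \<notin> {f x, s x}"
  shows "c \<in> C \<Longrightarrow> d \<in> C \<Longrightarrow> pairing (insert x C) f s c d = pairing C f s c d"
    and "d \<in> insert x C \<Longrightarrow> pairing (insert x C) f s x d = 0"
    and "c \<in> C \<Longrightarrow> pairing (insert x C) f s c x = pairing (insert x C) f s c c"
proof -
  have eq: "winding f s e (f x) = winding f s e (s x)" if "e \<in> C" for e
    using assms(3) assms(4)[OF that] by (intro winding_adjacent) auto
  have self: "winding f s x (f x) = 1" "winding f s x (s x) = 1"
    using assms(3) by (auto simp: winding_def)
  have zero: "winding f s x (f e) = 0" "winding f s x (s e) = 0" if "e \<in> C" for e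
    using assms(3) assms(4)[OF that] by (auto simp: winding_def sgn_if)
  show "pairing (insert x C) f s c d = pairing C f s c d" if "c \<in> C" "d \<in> C"
    using assms(1,2) eq that by (simp add: pairing_def)
  show "pairing (insert x C) f s x d = 0" if "d \<in> insert x C"
    using that assms(1,2) by (elim insertE) (simp_all add: pairing_def eq self zero)
  show "pairing (insert x C) f s c x = pairing (insert x C) f s c c" if "c \<in> C"
  proof -
    have "pairing (insert x C) f s c c - pairing (insert x C) f s c x =
        (\<Sum>e\<in>C. - orientation e * (winding f s c (f e) * winding f s c (s e) - winding f s c (s e) * winding f s c (f e)))"
      using assms(1,2) eq[OF that] self zero
      by (simp add: pairing_def sum_subtractf[symmetric] algebra_simps)
    then show ?thesis by (simp add: mult.commute)
  qed
qed

text \<open>The loops of \<open>x\<close> and \<open>y\<close> differ only along the sides of the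
  bigon: their windings agree at all other crossings, and the differences at the four passages of
  the bigon cancel because the orientations are opposite. For loops of other crossings the summands
  of \<open>x\<close> and \<open>y\<close> cancel directly.\<close>

lemma pairing_bigon:
  assumes "finite C" "x \<notin> C" "y \<notin> C" "x \<noteq> y" "orientation x = - orientation y"
    "\<bar>f x - f y\<bar> = 1" "\<bar>s x - s y\<bar> = 1" "f x < s x" "f x < s y" "f y < s x" "f y < s y"
    "\<And>e. e \<in> C \<Longrightarrow> f e \<notin> {f x, s x, f y, s y} \<and> s e \<notin> {f x, s x, f y, s y}"
  shows "c \<in> C \<Longrightarrow> d \<in> C \<Longrightarrow> pairing (insert x (insert y C)) f s c d = pairing C f s c d"
    and "d \<in> insert x (insert y C) \<Longrightarrow>
      pairing (insert x (insert y C)) f s x d = pairing (insert x (insert y C)) f s y d"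
    and "c \<in> insert x (insert y C) \<Longrightarrow>
      pairing (insert x (insert y C)) f s c x = pairing (insert x (insert y C)) f s c y"
proof -
  have eq: "winding f s e (f x) = winding f s e (f y)" "winding f s e (s x) = winding f s e (s y)" if "e \<in> C" for e
    by (rule winding_adjacent; use assms(6,7) assms(12)[OF that] in simp)+
  have other: "winding f s x (f e) = winding f s y (f e)" "winding f s x (s e) = winding f s y (s e)" if "e \<in> C" for e
  proof -
    have *: "sgn (p - a) = sgn (p - b)" if "\<bar>a - b\<bar> = 1" "p \<noteq> a" "p \<noteq> b" for p a b :: int
      using that by (auto simp: sgn_if)
    show "winding f s x (f e) = winding f s y (f e)" "winding f s x (s e) = winding f s y (s e)"
      unfolding winding_def
      by (rule arg_cong2[of _ _ _ _ "(-)"]; rule *; use assms(6,7) assms(12)[OF that] in simp)+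
  qed
  \<comment> \<open>The order of the two crossings on each side of the bigon. Both are arbitrary
    signs, so parallel and antiparallel strands are treated at once.\<close>
  define u v where "u = f y - f x" and "v = s y - s x"
  have uv: "u = 1 \<or> u = -1" "v = 1 \<or> v = -1" using assms(6,7) by (auto simp: u_def v_def)
  have self: "winding f s x (f x) = 1" "winding f s x (s x) = 1" "winding f s y (f y) = 1" "winding f s y (s y) = 1"
    "winding f s x (f y) = 1 + u" "winding f s y (f x) = 1 - u"
    "winding f s x (s y) = 1 - v" "winding f s y (s x) = 1 + v"
  proof -
    have sg: "sgn (f x - s x) = -1" "sgn (f x - s y) = -1" "sgn (f y - s x) = -1" "sgn (f y - s y) = -1"
        "sgn (s x - f x) = 1" "sgn (s x - f y) = 1" "sgn (s y - f x) = 1" "sgn (s y - f y) = 1"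
      using assms(8-11) by simp_all
    have y: "f y = f x + u" "s y = s x + v" by (simp_all add: u_def v_def)
    have [simp]: "sgn u = u" "sgn v = v" using uv by auto
    show "winding f s x (f x) = 1" "winding f s x (s x) = 1" "winding f s y (f y) = 1" "winding f s y (s y) = 1"
      by (simp_all add: winding_def sg)
    have "sgn (f y - f x) = u" "sgn (s y - s x) = v" "sgn (f x - f y) = -u" "sgn (s x - s y) = -v"
      by (simp_all add: y)
    then show "winding f s x (f y) = 1 + u" "winding f s y (f x) = 1 - u"
      "winding f s x (s y) = 1 - v" "winding f s y (s x) = 1 + v"
      by (simp_all add: winding_def sg)
  qed
  show "pairing (insert x (insert y C)) f s c d = pairing C f s c d" if "c \<in> C" "d \<in> C"
    using assms(1-5) eq that by (simp add: pairing_def)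
  have split: "pairing (insert x (insert y C)) f s c d =
      orientation x * (winding f s c (f x) * (2 - winding f s d (s x)) - winding f s c (s x) * (2 - winding f s d (f x))) +
      orientation y * (winding f s c (f y) * (2 - winding f s d (s y)) - winding f s c (s y) * (2 - winding f s d (f y))) +
      pairing C f s c d" for c d
    using assms(1-4) by (simp add: pairing_def)
  have C_eq: "pairing C f s x d = pairing C f s y d" "pairing C f s d x = pairing C f s d y" for d
    unfolding pairing_def by (rule sum.cong[OF refl], simp add: other)+
  have ox: "orientation x = - orientation y" by fact
  show "pairing (insert x (insert y C)) f s x d = pairing (insert x (insert y C)) f s y d" if mem: "d \<in> insert x (insert y C)"
  proof -
    consider "d = x" | "d = y" | "d \<in> C" using mem by blast
    then show ?thesis
    proof cases
      case 1
      show ?thesis unfolding 1 split C_eq self ox using uv by (auto simp: algebra_simps)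
    next
      case 2
      show ?thesis unfolding 2 split C_eq self ox using uv by (auto simp: algebra_simps)
    next
      case 3
      show ?thesis unfolding split C_eq self eq[OF 3] ox using uv by (auto simp: algebra_simps)
    qed
  qed
  show "pairing (insert x (insert y C)) f s c x = pairing (insert x (insert y C)) f s c y" if mem: "c \<in> insert x (insert y C)"
  proof -
    consider "c = x" | "c = y" | "c \<in> C" using mem by blast
    then show ?thesis
    proof cases
      case 1
      show ?thesis unfolding 1 split C_eq self ox using uv by (auto simp: algebra_simps)
    next
      case 2
      show ?thesis unfolding 2 split C_eq self ox using uv by (auto simp: algebra_simps)
    next
      case 3
      show ?thesis using uv by (elim disjE) (simp_all add: split C_eq self eq[OF 3] ox algebra_simps)
    qed
  qed
qed

lemma pairing_cong:
  assumes "\<And>c e. c \<in> C \<Longrightarrow> e \<in> C \<Longrightarrow> winding f s c (f e) = winding f' s' c (f' e)"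
    "\<And>c e. c \<in> C \<Longrightarrow> e \<in> C \<Longrightarrow> winding f s c (s e) = winding f' s' c (s' e)"
    "c \<in> C" "d \<in> C"
  shows "pairing C f s c d = pairing C f' s' c d"
  unfolding pairing_def by (rule sum.cong[OF refl]) (simp only: assms)

text \<open>The blocks at \<open>p1\<close>, \<open>p2\<close>, \<open>p3\<close> are the strands of
  the triangle, with \<open>x\<close>, \<open>y\<close>, \<open>z\<close> the crossings 12, 13, 23;
  the move reverses the order inside each block. Loops of other crossings do not distinguish
  adjacent positions in a block, and nothing changes outside the blocks. Only the windings of
  \<open>x\<close>, \<open>y\<close>, \<open>z\<close> at each other's passages vary, and the
  relation between the three orders imposed by the orientations makes the variations cancel.\<close>

lemma pairing_triangle:
  fixes p1 p2 p3 :: int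
  assumes C: "finite C" "x \<notin> C" "y \<notin> C" "z \<notin> C" "x \<noteq> y" "x \<noteq> z" "y \<noteq> z"
    and p: "p1 + 1 < p2" "p2 + 1 < p3"
    and f: "{f x, f y} = {p1, p1 + 1}" "{s x, f z} = {p2, p2 + 1}" "{s y, s z} = {p3, p3 + 1}"
    and f': "{f' x, f' y} = {p1, p1 + 1}" "{s' x, f' z} = {p2, p2 + 1}" "{s' y, s' z} = {p3, p3 + 1}"
    and o: "sgn (f y - f x) = orientation y" "sgn (f z - s x) = orientation z"
      "sgn (s z - s y) = orientation x * orientation y * orientation z"
    and o': "sgn (f' y - f' x) = - orientation y" "sgn (f' z - s' x) = - orientation z"
      "sgn (s' z - s' y) = - (orientation x * orientation y * orientation z)"
    and same: "\<And>e. e \<in> C \<Longrightarrow> f' e = f e" "\<And>e. e \<in> C \<Longrightarrow> s' e = s e"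
    and avoid: "\<And>e. e \<in> C \<Longrightarrow> f e \<notin> {p1, p1 + 1, p2, p2 + 1, p3, p3 + 1}"
      "\<And>e. e \<in> C \<Longrightarrow> s e \<notin> {p1, p1 + 1, p2, p2 + 1, p3, p3 + 1}"
    and cd: "c \<in> insert x (insert y (insert z C))" "d \<in> insert x (insert y (insert z C))"
  shows "pairing (insert x (insert y (insert z C))) f s c d = pairing (insert x (insert y (insert z C))) f' s' c d"
proof -
  have adj: "sgn (q - a) = sgn (q - b)"
    if "q \<noteq> p" "q \<noteq> p + 1" "{a, a'} = {p, p + 1}" "{b, b'} = {p, p + 1}" for q a a' b b' p :: int
    using that by (auto simp: doubleton_eq_iff sgn_if)
  have f2: "{f y, f x} = {p1, p1 + 1}" "{f z, s x} = {p2, p2 + 1}" "{s z, s y} = {p3, p3 + 1}"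
    and f2': "{f' y, f' x} = {p1, p1 + 1}" "{f' z, s' x} = {p2, p2 + 1}" "{s' z, s' y} = {p3, p3 + 1}"
    using f f' by (simp_all add: insert_commute)
  note adjs = adj[OF _ _ f(1) f'(1)] adj[OF _ _ f2(1) f2'(1)] adj[OF _ _ f(2) f'(2)]
    adj[OF _ _ f2(2) f2'(2)] adj[OF _ _ f(3) f'(3)] adj[OF _ _ f2(3) f2'(3)]
  have outer: "winding f s b q = winding f' s' b q"
    if "q \<notin> {p1, p1 + 1, p2, p2 + 1, p3, p3 + 1}" "b \<in> insert x (insert y (insert z C))" for b q
  proof -
    have q: "q \<noteq> p1" "q \<noteq> p1 + 1" "q \<noteq> p2" "q \<noteq> p2 + 1" "q \<noteq> p3" "q \<noteq> p3 + 1" using that(1) by auto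
    show ?thesis using that(2) unfolding winding_def
      by (elim insertE) (simp_all only: adjs q not_False_eq_True same)
  qed
  have rest: "pairing C f s c d = pairing C f' s' c d"
    unfolding pairing_def
    by (rule sum.cong[OF refl]) (use cd same avoid in \<open>simp add: outer\<close>)
  have split: "pairing (insert x (insert y (insert z C))) f s c d =
      orientation x * (winding f s c (f x) * (2 - winding f s d (s x)) - winding f s c (s x) * (2 - winding f s d (f x))) +
      orientation y * (winding f s c (f y) * (2 - winding f s d (s y)) - winding f s c (s y) * (2 - winding f s d (f y))) +
      orientation z * (winding f s c (f z) * (2 - winding f s d (s z)) - winding f s c (s z) * (2 - winding f s d (f z))) +
      pairing C f s c d" for f s
    using C by (simp add: pairing_def)
  \<comment> \<open>The windings of the three crossings at their own six passages, with \<sigma> = 1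
    before the move and \<sigma> = -1 after it. They depend only on the orders inside the blocks,
    which the orientations determine.\<close>
  define wind where "wind = (\<lambda>\<sigma>::int. \<lambda>f s.
      winding f s x (f x) = 1 \<and> winding f s x (f y) = 1 + \<sigma> * orientation y \<and> winding f s x (s x) = 1 \<and>
      winding f s x (f z) = 1 - \<sigma> * orientation z \<and> winding f s x (s y) = 0 \<and> winding f s x (s z) = 0 \<and>
      winding f s y (f x) = 1 - \<sigma> * orientation y \<and> winding f s y (f y) = 1 \<and> winding f s y (s x) = 2 \<and>
      winding f s y (f z) = 2 \<and> winding f s y (s y) = 1 \<and>
      winding f s y (s z) = 1 - \<sigma> * (orientation x * orientation y * orientation z) \<and>
      winding f s z (f x) = 0 \<and> winding f s z (f y) = 0 \<and> winding f s z (s x) = 1 - \<sigma> * orientation z \<and>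
      winding f s z (f z) = 1 \<and> winding f s z (s y) = 1 + \<sigma> * (orientation x * orientation y * orientation z) \<and>
      winding f s z (s z) = 1)"
  have windI: "wind \<sigma> f s"
    if "{f x, f y} = {p1, p1 + 1}" "{s x, f z} = {p2, p2 + 1}" "{s y, s z} = {p3, p3 + 1}"
      and o: "sgn (f y - f x) = \<sigma> * orientation y" "sgn (f z - s x) = \<sigma> * orientation z"
      "sgn (s z - s y) = \<sigma> * (orientation x * orientation y * orientation z)" for \<sigma> f s
  proof -
    have lt: "a < b" if "a \<in> {f x, f y} \<and> b \<in> {s x, f z} \<or> a \<in> {s x, f z} \<and> b \<in> {s y, s z} \<or>
        a \<in> {f x, f y} \<and> b \<in> {s y, s z}" for a b
      using that p unfolding \<open>{f x, f y} = {p1, p1 + 1}\<close> \<open>{s x, f z} = {p2, p2 + 1}\<close> \<open>{s y, s z} = {p3, p3 + 1}\<close>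
      by auto
    have neg: "sgn (a - b) = - sgn (b - a)" for a b :: int by (simp add: sgn_if)
    have o2: "sgn (f x - f y) = - (\<sigma> * orientation y)" "sgn (s x - f z) = - (\<sigma> * orientation z)"
      "sgn (s y - s z) = - (\<sigma> * (orientation x * orientation y * orientation z))"
      unfolding neg[of "f x"] neg[of "s x"] neg[of "s y"] o by simp_all
    have pos: "sgn (b - a) = 1" "sgn (a - b) = -1" if "a < b" for a b :: int using that by auto
    show ?thesis unfolding wind_def winding_def
      by (simp add: o o2 pos lt)
  qed
  have w: "wind 1 f s" "wind (-1) f' s'"
    using o o' f f' by (auto intro!: windI)
  have winds: "winding f' s' b (f' y) = winding f s b (f x)" "winding f' s' b (f' x) = winding f s b (f x)"
      "winding f s b (f y) = winding f s b (f x)"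
      "winding f' s' b (s' x) = winding f s b (s x)" "winding f' s' b (f' z) = winding f s b (s x)"
      "winding f s b (f z) = winding f s b (s x)"
      "winding f' s' b (s' y) = winding f s b (s y)" "winding f' s' b (s' z) = winding f s b (s y)"
      "winding f s b (s z) = winding f s b (s y)"
    if b: "b \<in> C" for b
  proof -
    have sg: "sgn (a - q) = sgn (a' - q)"
      if "q \<notin> {p1, p1 + 1, p2, p2 + 1, p3, p3 + 1}"
        "a \<in> {p1, p1 + 1} \<and> a' \<in> {p1, p1 + 1} \<or> a \<in> {p2, p2 + 1} \<and> a' \<in> {p2, p2 + 1} \<or>
         a \<in> {p3, p3 + 1} \<and> a' \<in> {p3, p3 + 1}" for a a' q :: int
      using that by (auto simp: sgn_if)
    have mem: "f x \<in> {p1, p1 + 1}" "f y \<in> {p1, p1 + 1}" "f' x \<in> {p1, p1 + 1}" "f' y \<in> {p1, p1 + 1}"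
      "s x \<in> {p2, p2 + 1}" "f z \<in> {p2, p2 + 1}" "s' x \<in> {p2, p2 + 1}" "f' z \<in> {p2, p2 + 1}"
      "s y \<in> {p3, p3 + 1}" "s z \<in> {p3, p3 + 1}" "s' y \<in> {p3, p3 + 1}" "s' z \<in> {p3, p3 + 1}"
      using f f' by blast+
    show "winding f' s' b (f' y) = winding f s b (f x)" "winding f' s' b (f' x) = winding f s b (f x)"
      "winding f s b (f y) = winding f s b (f x)"
      "winding f' s' b (s' x) = winding f s b (s x)" "winding f' s' b (f' z) = winding f s b (s x)"
      "winding f s b (f z) = winding f s b (s x)"
      "winding f' s' b (s' y) = winding f s b (s y)" "winding f' s' b (s' z) = winding f s b (s y)"
      "winding f s b (s z) = winding f s b (s y)"
      unfolding winding_def same[OF b]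
      by (rule arg_cong2[of _ _ _ _ "(-)"]; rule sg[OF avoid(1)[OF b]] sg[OF avoid(2)[OF b]]; use mem in blast)+
  qed
  have signs: "orientation x = 1 \<or> orientation x = -1" "orientation y = 1 \<or> orientation y = -1"
    "orientation z = 1 \<or> orientation z = -1"
    by (rule orientation_cases)+
  note wf = w(1)[unfolded wind_def mult_1_left] and wf' = w(2)[unfolded wind_def mult_minus1]
  note signs' = disjE[OF signs(1)] disjE[OF signs(2)] disjE[OF signs(3)]
  \<comment> \<open>With these values each of the sixteen cases is an identity in the three
    orientations, checked for all choices of signs. If neither \<open>c\<close> nor \<open>d\<close>
    belongs to the triangle, the two sides agree literally.\<close>
  consider "c = x" | "c = y" | "c = z" | "c \<in> C" using cd(1) by blast
  then show ?thesis
  proof cases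
    case c: 1
    consider "d = x" | "d = y" | "d = z" | "d \<in> C" using cd(2) by blast
    then show ?thesis
    proof cases
      case d: 1
      show ?thesis unfolding split rest
        by (simp only: c d wf wf')
          (rule signs'(1); rule signs'(2); rule signs'(3); simp add: algebra_simps)
    next
      case d: 2
      show ?thesis unfolding split rest
        by (simp only: c d wf wf')
          (rule signs'(1); rule signs'(2); rule signs'(3); simp add: algebra_simps)
    next
      case d: 3
      show ?thesis unfolding split rest
        by (simp only: c d wf wf')
          (rule signs'(1); rule signs'(2); rule signs'(3); simp add: algebra_simps)
    next
      case d: 4
      show ?thesis unfolding split rest
        by (simp only: c winds[OF d] wf wf')
          (rule signs'(1); rule signs'(2); rule signs'(3); simp add: algebra_simps)
    qed
  next
    case c: 2
    consider "d = x" | "d = y" | "d = z" | "d \<in> C" using cd(2) by blast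
    then show ?thesis
    proof cases
      case d: 1
      show ?thesis unfolding split rest
        by (simp only: c d wf wf')
          (rule signs'(1); rule signs'(2); rule signs'(3); simp add: algebra_simps)
    next
      case d: 2
      show ?thesis unfolding split rest
        by (simp only: c d wf wf')
          (rule signs'(1); rule signs'(2); rule signs'(3); simp add: algebra_simps)
    next
      case d: 3
      show ?thesis unfolding split rest
        by (simp only: c d wf wf')
          (rule signs'(1); rule signs'(2); rule signs'(3); simp add: algebra_simps)
    next
      case d: 4
      show ?thesis unfolding split rest
        by (simp only: c winds[OF d] wf wf')
          (rule signs'(1); rule signs'(2); rule signs'(3); simp add: algebra_simps)
    qed
  next
    case c: 3
    consider "d = x" | "d = y" | "d = z" | "d \<in> C" using cd(2) by blast
    then show ?thesis
    proof cases
      case d: 1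
      show ?thesis unfolding split rest
        by (simp only: c d wf wf')
          (rule signs'(1); rule signs'(2); rule signs'(3); simp add: algebra_simps)
    next
      case d: 2
      show ?thesis unfolding split rest
        by (simp only: c d wf wf')
          (rule signs'(1); rule signs'(2); rule signs'(3); simp add: algebra_simps)
    next
      case d: 3
      show ?thesis unfolding split rest
        by (simp only: c d wf wf')
          (rule signs'(1); rule signs'(2); rule signs'(3); simp add: algebra_simps)
    next
      case d: 4
      show ?thesis unfolding split rest
        by (simp only: c winds[OF d] wf wf')
          (rule signs'(1); rule signs'(2); rule signs'(3); simp add: algebra_simps)
    qed
  next
    case c: 4
    consider "d = x" | "d = y" | "d = z" | "d \<in> C" using cd(2) by blast
    then show ?thesis
    proof cases
      case d: 1
      show ?thesis unfolding split rest
        by (simp only: winds[OF c] d wf wf')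
          (rule signs'(1); rule signs'(2); rule signs'(3); simp add: algebra_simps)
    next
      case d: 2
      show ?thesis unfolding split rest
        by (simp only: winds[OF c] d wf wf')
          (rule signs'(1); rule signs'(2); rule signs'(3); simp add: algebra_simps)
    next
      case d: 3
      show ?thesis unfolding split rest
        by (simp only: winds[OF c] d wf wf')
          (rule signs'(1); rule signs'(2); rule signs'(3); simp add: algebra_simps)
    next
      case d: 4
      show ?thesis unfolding split rest
        by (simp only: winds[OF c] winds[OF d] wf wf')
    qed
  qed
qed

section \<open>Invariance of the polynomial of a Gauss word under the moves\<close>

lemma gauss_word_pos_eqI:
  assumes "gauss_word w" "i < j" "j < length w" "w ! i = c" "w ! j = c"
  shows "first_pos w c = i" "second_pos w c = j"
proof -
  have c: "c \<in> set w" using nth_mem[OF assms(3)] assms(5) by simp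
  have "i < length w" using assms(2,3) by simp
  then have "i \<in> {first_pos w c, second_pos w c}" "j \<in> {first_pos w c, second_pos w c}"
    unfolding gauss_word_positions(1)[OF assms(1) c, symmetric] using assms(3-5) by simp_all
  then show "first_pos w c = i" "second_pos w c = j"
    using gauss_word_positions(2)[OF assms(1) c] assms(2) by auto
qed

lemma count_list_filter: "count_list (filter P w) c = (if P c then count_list w c else 0)"
  by (induction w) auto

lemma gauss_word_filter: "gauss_word w \<Longrightarrow> gauss_word (filter P w)"
  by (auto simp: gauss_word_def count_list_filter)

text \<open>Inserting letters preserves the order of the old ones, and \<open>winding\<close> sees
  nothing but this order. So the pairing of the short word can be computed with positions in the
  long word, summing over the old crossings only, which is the form in which the monogon and bigon
  lemmas compare the two words.\<close>

lemma word_pairing_embed: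
  assumes w: "gauss_word w" "gauss_word w'" and \<iota>: "strict_mono \<iota>"
    and nth: "\<And>i. i < length w \<Longrightarrow> \<iota> i < length w' \<and> w' ! \<iota> i = w ! i"
    and "c \<in> set w" "d \<in> set w"
  shows "word_pairing w c d =
    pairing (set w) (\<lambda>e. int (first_pos w' e)) (\<lambda>e. int (second_pos w' e)) c d"
proof -
  have pos: "first_pos w' e = \<iota> (first_pos w e)" "second_pos w' e = \<iota> (second_pos w e)" if "e \<in> set w" for e
    using gauss_word_positions(2)[OF w(1) that] first_pos_props[OF w(1) that] nth \<iota>
    by (metis gauss_word_pos_eqI(1)[OF w(2)] strict_monoD, metis gauss_word_pos_eqI(2)[OF w(2)] strict_monoD)
  have sgn: "sgn (int (\<iota> a) - int (\<iota> b)) = sgn (int a - int b)" for a b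
    using strict_mono_less[OF \<iota>, of a b] strict_mono_less[OF \<iota>, of b a] by (auto simp: sgn_if)
  show ?thesis unfolding word_pairing_def
    by (rule pairing_cong) (simp_all add: winding_def pos sgn assms(5,6))
qed

lemma count_list_zero_iff: "count_list w c = 0 \<longleftrightarrow> c \<notin> set w"
  by (induction w) auto

lemma G_word_monogon:
  assumes gw: "gauss_word (u @ v)" "gauss_word (u @ [c, c] @ v)" and c: "is_real c"
  shows "G_word a (u @ [c, c] @ v) = G_word a (u @ v)"
proof -
  define w1 w2 where w: "w1 = u @ v" "w2 = u @ [c, c] @ v"
  note g = gw[folded w]
  have "count_list w2 c = 2" using g(2) by (auto simp: gauss_word_def w(2))
  then have c_new: "c \<notin> set w1" by (simp add: count_list_append count_list_zero_iff w)
  have set': "set w2 = insert c (set w1)" by (auto simp: w)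
  let ?f = "\<lambda>e. int (first_pos w2 e)" and ?s = "\<lambda>e. int (second_pos w2 e)"
  define \<iota> where "\<iota> i = (if i < length u then i else i + 2)" for i
  have emb: "word_pairing w1 c d = pairing (set w1) ?f ?s c d" if "c \<in> set w1" "d \<in> set w1" for c d
    using g by (rule word_pairing_embed[of _ _ \<iota>])
      (use that in \<open>auto simp: \<iota>_def strict_mono_def nth_append w\<close>)
  have fc: "first_pos w2 c = length u" "second_pos w2 c = Suc (length u)"
    by (rule gauss_word_pos_eqI[OF g(2), of "length u" "Suc (length u)"]; simp add: nth_append w)+
  have avoid: "?f e \<notin> {?f c, ?s c} \<and> ?s e \<notin> {?f c, ?s c}" if "e \<in> set w1" for e
  proof -
    have e: "e \<in> set w2" "e \<noteq> c" using that c_new set' by auto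
    have "w2 ! first_pos w2 c = c" "w2 ! second_pos w2 c = c"
      using first_pos_props[OF g(2), of c] set' by auto
    then show ?thesis using first_pos_props[OF g(2) e(1)] e(2) by (metis insert_iff empty_iff of_nat_eq_iff)
  qed
  note mono = pairing_monogon[of "set w1" c ?s ?f, OF _ c_new _ avoid]
  have old: "pairing (insert c (set w1)) ?f ?s d e = word_pairing w1 d e" if "d \<in> set w1" "e \<in> set w1" for d e
    using mono(1)[OF _ _ _ that] emb[OF that] by (simp add: fc)
  have T: "crossings_of_type a w1 \<subseteq> set w1" by (auto simp: crossings_of_type_def)
  have "G_word a w2 = G_sum (crossings_of_type a w1) (word_pairing w2)"
  proof (cases "crossing_type c = a")
    case True
    have eq: "crossings_of_type a w2 = insert c (crossings_of_type a w1)"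
      using True c unfolding crossings_of_type_def set' by auto
    have zero: "pairing (insert c (set w1)) (\<lambda>e. int (first_pos w2 e)) (\<lambda>e. int (second_pos w2 e)) c d = 0"
      if "d \<in> insert c (set w1)" for d
      by (rule mono(2)) (use that in \<open>auto simp: fc\<close>)
    have diag: "pairing (insert c (set w1)) (\<lambda>e. int (first_pos w2 e)) (\<lambda>e. int (second_pos w2 e)) d c =
        pairing (insert c (set w1)) (\<lambda>e. int (first_pos w2 e)) (\<lambda>e. int (second_pos w2 e)) d d"
      if "d \<in> set w1" for d
      by (rule mono(3)) (use that in \<open>auto simp: fc\<close>)
    show ?thesis unfolding G_word_def eq word_pairing_def set'
    proof (rule G_sum_insert_trivial)
      show "finite (crossings_of_type a w1)" "c \<notin> crossings_of_type a w1"
        using T c_new by (auto intro: finite_subset)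
    next
      fix d assume "d \<in> insert c (crossings_of_type a w1)"
      then have "d \<in> insert c (set w1)" using T by blast
      then show "pairing (insert c (set w1)) (\<lambda>e. int (first_pos w2 e)) (\<lambda>e. int (second_pos w2 e)) c d =
          pairing (insert c (set w1)) (\<lambda>e. int (first_pos w2 e)) (\<lambda>e. int (second_pos w2 e)) c c"
        using zero[of d] zero[of c] by simp
    qed (use T diag in blast)
  next
    case False
    then have "crossings_of_type a w2 = crossings_of_type a w1"
      unfolding crossings_of_type_def set' by auto
    then show ?thesis by (simp add: G_word_def)
  qed
  also have "\<dots> = G_word a w1"
    unfolding G_word_def using T by (intro G_sum_cong) (auto simp: word_pairing_def[of w2] set' old subset_eq)
  finally show ?thesis by (simp only: w)
qed

lemma bigon_kinds_real:
  assumes "bigon_kinds (snd c) (snd d)"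
  shows "is_real c \<longleftrightarrow> is_real d"
    and "is_real c \<Longrightarrow> crossing_type c = crossing_type d"
    and "is_real c \<Longrightarrow> crossing_sign c = - crossing_sign d"
    and "is_real c \<Longrightarrow> orientation c = - orientation d"
    and "c \<noteq> d"
  using assms by (cases c; cases d; cases "snd c"; cases "snd d"; force)+

lemma G_word_bigon:
  assumes gw: "gauss_word (u @ v @ w)" "gauss_word (u @ [c, d] @ v @ p @ w)" and c: "is_real c"
    and kinds: "bigon_kinds (snd c) (snd d)" and p: "p = [c, d] \<or> p = [d, c]"
  shows "G_word a (u @ [c, d] @ v @ p @ w) = G_word a (u @ v @ w)"
proof -
  define w1 w2 where w: "w1 = u @ v @ w" "w2 = u @ [c, d] @ v @ p @ w"
  note g = gw[folded w]
  note real = bigon_kinds_real[OF kinds]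
  have "count_list w2 c = 2" "count_list w2 d = 2" using g(2) by (auto simp: gauss_word_def w(2))
  then have new: "c \<notin> set w1" "d \<notin> set w1" 
    using p real(5) by (auto simp add: count_list_append count_list_zero_iff w)
  have set': "set w2 = insert c (insert d (set w1))" using p by (auto simp: w)
  let ?f = "\<lambda>e. int (first_pos w2 e)" and ?s = "\<lambda>e. int (second_pos w2 e)"
  define \<iota> where "\<iota> i = (if i < length u then i else if i < length u + length v then i + 2 else i + 4)" for i
  have emb: "word_pairing w1 x y = pairing (set w1) ?f ?s x y" if "x \<in> set w1" "y \<in> set w1" for x y
    using g by (rule word_pairing_embed[of _ _ \<iota>])
      (use that p in \<open>auto simp: \<iota>_def strict_mono_def nth_append w\<close>)
  define n where "n = length u + 2 + length v"
  \<comment> \<open>The offset of the second passage of \<open>c\<close> inside \<open>p\<close>: 0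
    if both strands meet the two crossings in the same order, 1 if they meet them in opposite
    orders.\<close>
  define m where "m = (if p = [c, d] then 0 else 1::nat)"
  have fc: "first_pos w2 c = length u" "second_pos w2 c = n + m"
    by (rule gauss_word_pos_eqI[OF g(2), of "length u" "n + m"];
        use p real(5) in \<open>auto simp: nth_append w n_def m_def\<close>)+
  have fd: "first_pos w2 d = Suc (length u)" "second_pos w2 d = n + (1 - m)"
    by (rule gauss_word_pos_eqI[OF g(2), of "Suc (length u)" "n + (1 - m)"];
        use p real(5) in \<open>auto simp: nth_append w n_def m_def\<close>)+
  have avoid: "?f e \<notin> {?f c, ?s c, ?f d, ?s d} \<and> ?s e \<notin> {?f c, ?s c, ?f d, ?s d}" if "e \<in> set w1" for e
  proof -
    have e: "e \<in> set w2" "e \<noteq> c" "e \<noteq> d" using that new set' by auto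
    have "w2 ! first_pos w2 c = c" "w2 ! second_pos w2 c = c" "w2 ! first_pos w2 d = d" "w2 ! second_pos w2 d = d"
      using first_pos_props[OF g(2), of c] first_pos_props[OF g(2), of d] set' by auto
    then show ?thesis using first_pos_props[OF g(2) e(1)] e(2,3) by (metis insert_iff empty_iff of_nat_eq_iff)
  qed
  have "orientation c = - orientation d" "\<bar>?f c - ?f d\<bar> = 1" "\<bar>?s c - ?s d\<bar> = 1" "?f c < ?s c" "?f c < ?s d"
    "?f d < ?s c" "?f d < ?s d"
    using real(4) c unfolding fc fd by (auto simp: m_def n_def)
  note big = pairing_bigon[of "set w1" c d ?f ?s, OF _ new real(5) this avoid]
  have old: "pairing (insert c (insert d (set w1))) ?f ?s x e = word_pairing w1 x e" if "x \<in> set w1" "e \<in> set w1" for x e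
    using big(1)[OF _ _ that] emb[OF that] by simp
  have T: "crossings_of_type a w1 \<subseteq> set w1" by (auto simp: crossings_of_type_def)
  have "G_word a w2 = G_sum (crossings_of_type a w1) (word_pairing w2)"
  proof (cases "crossing_type c = a")
    case True
    have eq: "crossings_of_type a w2 = insert c (insert d (crossings_of_type a w1))"
      using True c real(1,2) unfolding crossings_of_type_def set' by auto
    show ?thesis unfolding G_word_def eq word_pairing_def set'
      by (rule G_sum_insert_cancel) (use T new real c big(2,3) in \<open>auto intro!: finite_subset[OF T]\<close>)
  next
    case False
    then have "crossings_of_type a w2 = crossings_of_type a w1"
      unfolding crossings_of_type_def set' using real(1,2) c by auto
    then show ?thesis by (simp add: G_word_def)
  qed
  also have "\<dots> = G_word a w1"
    unfolding G_word_def using T by (intro G_sum_cong) (auto simp: word_pairing_def[of w2] set' old subset_eq)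
  finally show ?thesis by (simp only: w)
qed

lemma length_two_passages [simp]: "length (two_passages s x y) = 2"
  by (simp add: two_passages_def)

lemma count_list_two_passages [simp]: "count_list (two_passages s x y) e = count_list [x, y] e"
  by (simp add: two_passages_def)

lemma set_two_passages [simp]: "set (two_passages s x y) = {x, y}"
  by (auto simp add: two_passages_def)

lemma two_passages_nth:
  "two_passages s x y ! of_bool (s \<noteq> 1) = x" "two_passages s x y ! of_bool (s = 1) = y"
  by (simp_all add: two_passages_def)

lemma triangle_word_distinct:
  assumes "gauss_word (triangle_word \<sigma> x y z u0 u1 u2 u3)"
  shows "x \<noteq> y" "x \<noteq> z" "y \<noteq> z" "{x, y, z} \<inter> (set u0 \<union> set u1 \<union> set u2 \<union> set u3) = {}"
proof -
  let ?w = "triangle_word \<sigma> x y z u0 u1 u2 u3"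
  have c: "count_list ?w e = count_list u0 e + count_list [x, y] e + count_list u1 e + count_list [x, z] e
      + count_list u2 e + count_list [y, z] e + count_list u3 e" for e
    by (simp add: triangle_word_def Let_def count_list_append)
  have "x \<in> set ?w" "y \<in> set ?w" "z \<in> set ?w" by (auto simp: triangle_word_def Let_def)
  then have two: "count_list ?w x = 2" "count_list ?w y = 2" "count_list ?w z = 2"
    using assms by (auto simp: gauss_word_def)
  show ne: "x \<noteq> y" "x \<noteq> z" "y \<noteq> z" using two unfolding c by (auto split: if_splits)
  show "{x, y, z} \<inter> (set u0 \<union> set u1 \<union> set u2 \<union> set u3) = {}"
    using two ne unfolding c by (auto simp flip: count_list_zero_iff)
qed

lemma triangle_word_pos:
  assumes g: "gauss_word (triangle_word \<sigma> x y z u0 u1 u2 u3)"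
    and p: "p1 = length u0" "p2 = p1 + 2 + length u1" "p3 = p2 + 2 + length u2"
  shows "first_pos (triangle_word \<sigma> x y z u0 u1 u2 u3) x = p1 + of_bool (\<sigma> * orientation y \<noteq> 1)"
    "second_pos (triangle_word \<sigma> x y z u0 u1 u2 u3) x = p2 + of_bool (\<sigma> * orientation z \<noteq> 1)"
    "first_pos (triangle_word \<sigma> x y z u0 u1 u2 u3) y = p1 + of_bool (\<sigma> * orientation y = 1)"
    "second_pos (triangle_word \<sigma> x y z u0 u1 u2 u3) y =
       p3 + of_bool (\<sigma> * orientation x * orientation y * orientation z \<noteq> 1)"
    "first_pos (triangle_word \<sigma> x y z u0 u1 u2 u3) z = p2 + of_bool (\<sigma> * orientation z = 1)"
    "second_pos (triangle_word \<sigma> x y z u0 u1 u2 u3) z =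
       p3 + of_bool (\<sigma> * orientation x * orientation y * orientation z = 1)"
proof -
  let ?w = "triangle_word \<sigma> x y z u0 u1 u2 u3"
  have b: "(of_bool P :: nat) < 2" for P by simp
  have n: "?w ! (p1 + of_bool P) = two_passages (\<sigma> * orientation y) x y ! of_bool P"
    "?w ! (p2 + of_bool P) = two_passages (\<sigma> * orientation z) x z ! of_bool P"
    "?w ! (p3 + of_bool P) = two_passages (\<sigma> * orientation x * orientation y * orientation z) y z ! of_bool P" for P
    using b[of P] by (simp_all add: triangle_word_def Let_def nth_append p)
  have l: "p3 + of_bool P < length ?w" "p2 + of_bool P < length ?w" for P
    by (simp_all add: triangle_word_def Let_def p)
  have o: "p1 + of_bool P < p2 + of_bool Q" "p1 + of_bool P < p3 + of_bool Q" "p2 + of_bool P < p3 + of_bool Q" for P Q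
    using b[of P] by (simp_all add: p)
  show "first_pos ?w x = p1 + of_bool (\<sigma> * orientation y \<noteq> 1)"
    "second_pos ?w x = p2 + of_bool (\<sigma> * orientation z \<noteq> 1)"
    by (rule gauss_word_pos_eqI[OF g o(1)[of "\<sigma> * orientation y \<noteq> 1" "\<sigma> * orientation z \<noteq> 1"]], simp_all only: n two_passages_nth l)+
  show "first_pos ?w y = p1 + of_bool (\<sigma> * orientation y = 1)"
    "second_pos ?w y = p3 + of_bool (\<sigma> * orientation x * orientation y * orientation z \<noteq> 1)"
    by (rule gauss_word_pos_eqI[OF g o(2)[of "\<sigma> * orientation y = 1" "\<sigma> * orientation x * orientation y * orientation z \<noteq> 1"]], simp_all only: n two_passages_nth l)+
  show "first_pos ?w z = p2 + of_bool (\<sigma> * orientation z = 1)"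
    "second_pos ?w z = p3 + of_bool (\<sigma> * orientation x * orientation y * orientation z = 1)"
    by (rule gauss_word_pos_eqI[OF g o(3)[of "\<sigma> * orientation z = 1" "\<sigma> * orientation x * orientation y * orientation z = 1"]], simp_all only: n two_passages_nth l)+
qed

lemma nth_append_replace:
  assumes "length A = length B" "i < length u \<or> length u + length A \<le> i"
  shows "(u @ A @ v) ! i = (u @ B @ v) ! i"
  using assms by (auto simp: nth_append)

lemma triangle_word_nth:
  assumes p: "p1 = length u0" "p2 = p1 + 2 + length u1" "p3 = p2 + 2 + length u2"
    and i: "i \<notin> {p1, p1 + 1, p2, p2 + 1, p3, p3 + 1}"
  shows "triangle_word \<sigma> x y z u0 u1 u2 u3 ! i = triangle_word \<tau> x y z u0 u1 u2 u3 ! i"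
proof -
  have i: "i < p1 \<or> p1 + 2 \<le> i" "i < p2 \<or> p2 + 2 \<le> i" "i < p3 \<or> p3 + 2 \<le> i" using i by auto
  define A B D where "A s = two_passages (s * orientation y) x y" and "B s = two_passages (s * orientation z) x z"
    and "D s = two_passages (s * orientation x * orientation y * orientation z) y z" for s
  note AB = A_def B_def D_def
  have w: "triangle_word s x y z u0 u1 u2 u3 = u0 @ A s @ u1 @ B s @ u2 @ D s @ u3" for s
    by (simp add: triangle_word_def Let_def AB)
  have "(u0 @ A \<sigma> @ u1 @ B \<sigma> @ u2 @ D \<sigma> @ u3) ! i = (u0 @ A \<tau> @ u1 @ B \<sigma> @ u2 @ D \<sigma> @ u3) ! i"
    by (rule nth_append_replace) (use i(1) p in \<open>simp_all add: AB\<close>)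
  also have "\<dots> = ((u0 @ A \<tau> @ u1) @ B \<sigma> @ u2 @ D \<sigma> @ u3) ! i" by simp
  also have "\<dots> = ((u0 @ A \<tau> @ u1) @ B \<tau> @ u2 @ D \<sigma> @ u3) ! i"
    by (rule nth_append_replace) (use i(2) p in \<open>auto simp add: AB add.assoc\<close>)
  also have "\<dots> = ((u0 @ A \<tau> @ u1 @ B \<tau> @ u2) @ D \<sigma> @ u3) ! i" by simp
  also have "\<dots> = ((u0 @ A \<tau> @ u1 @ B \<tau> @ u2) @ D \<tau> @ u3) ! i"
    by (rule nth_append_replace) (use i(3) p in \<open>auto simp add: AB add.assoc\<close>)
  finally show ?thesis by (simp add: w)
qed

text \<open>The crossings, with their types and signs, are the same in both words, so it is enough
  that the pairing does not change. The orders required by \<open>pairing_triangle\<close> are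
  exactly those which \<open>triangle_word\<close> derives from the orientations.\<close>

lemma G_word_triangle:
  assumes g: "gauss_word (triangle_word 1 x y z u0 u1 u2 u3)" "gauss_word (triangle_word (-1) x y z u0 u1 u2 u3)"
  shows "G_word a (triangle_word (-1) x y z u0 u1 u2 u3) = G_word a (triangle_word 1 x y z u0 u1 u2 u3)"
proof -
  let ?w = "triangle_word 1 x y z u0 u1 u2 u3" and ?w' = "triangle_word (-1) x y z u0 u1 u2 u3"
  define p1 p2 p3 where p: "p1 = length u0" "p2 = p1 + 2 + length u1" "p3 = p2 + 2 + length u2"
  note pos = triangle_word_pos[OF g(1) p] and pos' = triangle_word_pos[OF g(2) p]
  define C where "C = set u0 \<union> set u1 \<union> set u2 \<union> set u3"
  have sets: "set ?w = insert x (insert y (insert z C))" "set ?w' = insert x (insert y (insert z C))"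
    by (auto simp: triangle_word_def Let_def C_def)
  have dist: "x \<noteq> y" "x \<noteq> z" "y \<noteq> z" and new: "x \<notin> C" "y \<notin> C" "z \<notin> C" and fin: "finite C"
    using triangle_word_distinct[OF g(1)] by (auto simp: C_def)
  have len: "length ?w' = length ?w" by (simp add: triangle_word_def Let_def)
  let ?P = "{p1, p1 + 1, p2, p2 + 1, p3, p3 + 1}"
  have xyz: "?w ! i \<in> {x, y, z}" if "i \<in> ?P" for i
  proof -
    have n: "?w ! (p1 + q) = two_passages (orientation y) x y ! q"
      "?w ! (p2 + q) = two_passages (orientation z) x z ! q"
      "?w ! (p3 + q) = two_passages (orientation x * orientation y * orientation z) y z ! q" if "q < 2" for q
      using that by (simp_all add: triangle_word_def Let_def nth_append p)
    have "two_passages s b c ! q \<in> {b, c}" if "q < 2" for s b c q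
      using nth_mem[of q "two_passages s b c"] that by simp
    note mem = this
    have m: "?w ! (p1 + q) \<in> {x, y, z}" "?w ! (p2 + q) \<in> {x, y, z}" "?w ! (p3 + q) \<in> {x, y, z}" if "q < 2" for q
      unfolding n[OF that] using mem[OF that] by blast+
    from that consider "i = p1 + 0" | "i = p1 + 1" | "i = p2 + 0" | "i = p2 + 1" | "i = p3 + 0" | "i = p3 + 1" by force
    moreover have "(0::nat) < 2" "(1::nat) < 2" by simp_all
    ultimately show ?thesis by cases (simp_all only: m)
  qed
  have out: "first_pos ?w e \<notin> ?P" "second_pos ?w e \<notin> ?P" 
    "first_pos ?w' e = first_pos ?w e" "second_pos ?w' e = second_pos ?w e" if e: "e \<in> C" for e
  proof -
    have ew: "e \<in> set ?w" using e by (simp add: sets)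
    note q = first_pos_props[OF g(1) ew] gauss_word_positions(2)[OF g(1) ew]
    show *: "first_pos ?w e \<notin> ?P" "second_pos ?w e \<notin> ?P" 
      using xyz q e new by (metis insertE singletonD)+
    show "first_pos ?w' e = first_pos ?w e" "second_pos ?w' e = second_pos ?w e" 
      using gauss_word_pos_eqI[OF g(2), of "first_pos ?w e" "second_pos ?w e" e] q len
        triangle_word_nth[OF p *(1)] triangle_word_nth[OF p *(2)] by metis+
  qed
  have P': "{int p1, int p1 + 1, int p2, int p2 + 1, int p3, int p3 + 1} = int ` ?P" by (simp add: add.commute)
  have J: "word_pairing ?w' c d = word_pairing ?w c d" if "c \<in> set ?w" "d \<in> set ?w" for c d
    unfolding word_pairing_def sets
  proof (rule pairing_triangle[symmetric, OF fin new dist, of "int p1" "int p2" "int p3"])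
    show "c \<in> insert x (insert y (insert z C))" "d \<in> insert x (insert y (insert z C))"
      using that sets by auto
    show "int (first_pos ?w' e) = int (first_pos ?w e)" "int (second_pos ?w' e) = int (second_pos ?w e)"
      "int (first_pos ?w e) \<notin> {int p1, int p1 + 1, int p2, int p2 + 1, int p3, int p3 + 1}"
      "int (second_pos ?w e) \<notin> {int p1, int p1 + 1, int p2, int p2 + 1, int p3, int p3 + 1}" if "e \<in> C" for e
      using out[OF that] unfolding P' by (simp_all only: inj_image_mem_iff[OF inj_of_nat] not_False_eq_True)
  \<comment> \<open>What remains are the positions of \<open>x\<close>, \<open>y\<close>,
    \<open>z\<close> in both words, a finite check over the three orientations.\<close>
  qed (use orientation_cases[of x] orientation_cases[of y] orientation_cases[of z] in
      \<open>auto simp: pos pos' p\<close>)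
  have T: "crossings_of_type a ?w' = crossings_of_type a ?w" "crossings_of_type a ?w \<subseteq> set ?w"
    by (auto simp: crossings_of_type_def sets)
  show ?thesis unfolding G_word_def T(1)
    by (rule G_sum_cong; rule J; use T(2) in blast)
qed

lemma G_word_rename:
  assumes g: "gauss_word w" "gauss_word (map \<rho> w)" and inj: "inj_on \<rho> (set w)"
    and kind: "\<And>c. c \<in> set w \<Longrightarrow> snd (\<rho> c) = snd c"
  shows "G_word a (map \<rho> w) = G_word a w"
proof -
  have kinds: "is_real (\<rho> c) = is_real c" "is_real c \<Longrightarrow> crossing_type (\<rho> c) = crossing_type c"
    "is_real c \<Longrightarrow> crossing_sign (\<rho> c) = crossing_sign c" "orientation (\<rho> c) = orientation c" if "c \<in> set w" for c
    using kind[OF that] by (cases c; cases "\<rho> c"; cases "snd c"; simp)+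
  have pos: "first_pos (map \<rho> w) (\<rho> c) = first_pos w c" "second_pos (map \<rho> w) (\<rho> c) = second_pos w c"
    if "c \<in> set w" for c
    using gauss_word_pos_eqI[OF g(2), of "first_pos w c" "second_pos w c" "\<rho> c"]
      first_pos_props[OF g(1) that] gauss_word_positions(2)[OF g(1) that] by auto
  have J: "word_pairing (map \<rho> w) (\<rho> c) (\<rho> d) = word_pairing w c d" if "c \<in> set w" "d \<in> set w" for c d
    unfolding word_pairing_def pairing_def
    by (simp add: sum.reindex[OF inj] winding_def pos kinds that)
  have T: "crossings_of_type a (map \<rho> w) = \<rho> ` crossings_of_type a w"
    using kinds unfolding crossings_of_type_def by force
  have sub: "crossings_of_type a w \<subseteq> set w" "\<And>c. c \<in> crossings_of_type a w \<Longrightarrow> is_real c \<and> c \<in> set w"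
    by (auto simp: crossings_of_type_def)
  show ?thesis unfolding G_word_def G_sum_def T
    by (simp add: sum.reindex[OF inj_on_subset[OF inj sub(1)]] sub J kinds)
qed

lemma filter_two_passages:
  assumes "\<not> P x \<or> \<not> P y"
  shows "filter P (two_passages s x y) = filter P [x, y]"
  using assms by (auto simp: two_passages_def)

lemma triangle_kinds_cases:
  assumes "triangle_kinds (snd x) (snd y) (snd z)"
  shows "is_real x \<and> is_real y \<and> is_real z \<or>
    \<not> is_real x \<and> \<not> is_real y \<or> \<not> is_real x \<and> \<not> is_real z \<or> \<not> is_real y \<and> \<not> is_real z"
  using assms by (cases x; cases y; cases z; cases "snd x"; cases "snd y"; cases "snd z"; simp)

text \<open>Erasing virtual letters turns each move into a move between real crossings or into the
  identity. A triangle that is not entirely real has at most one real crossing, so no strand retains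
  two letters and reversing the blocks has no effect.\<close>

lemma G_word_reidemeister:
  assumes "reidemeister D D'" "gauss_word D" "gauss_word D'"
  shows "G_word a (filter is_real D') = G_word a (filter is_real D)"
  using assms
proof cases
  case (rename \<rho>)
  have "is_real (\<rho> c) = is_real c" if "c \<in> set D" for c
    using rename(3)[OF that] by (cases c; cases "\<rho> c"; cases "snd c"; simp)
  then have eq: "filter is_real D' = map \<rho> (filter is_real D)"
    unfolding rename(1) by (simp add: filter_map comp_def cong: filter_cong)
  show ?thesis unfolding eq
    by (rule G_word_rename)
      (use rename assms in \<open>auto simp flip: eq intro: gauss_word_filter inj_on_subset\<close>)
next
  case (reid1 u v c)
  then show ?thesis
    using G_word_monogon[of "filter is_real u" "filter is_real v" c]
      gauss_word_filter[OF assms(2), of is_real] gauss_word_filter[OF assms(3), of is_real]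
    by (cases "is_real c") auto
next
  case (reid2 c d p u v w)
  show ?thesis
  proof (cases "is_real c")
    case True
    then have d: "is_real d" using bigon_kinds_real(1)[OF reid2(3)] by simp
    then have p: "filter is_real p = p" using reid2(4) True by auto
    show ?thesis
      using G_word_bigon[of "filter is_real u" "filter is_real v" "filter is_real w" c d p, OF _ _ True reid2(3,4)]
        gauss_word_filter[OF assms(2), of is_real] gauss_word_filter[OF assms(3), of is_real] True d p
      by (simp add: reid2(1,2))
  next
    case False
    then have "\<not> is_real d" using bigon_kinds_real(1)[OF reid2(3)] by simp
    then show ?thesis using False reid2(1,2,4) by auto
  qed
next
  case (reid3 x y z u0 u1 u2 u3)
  let ?t = "\<lambda>s. triangle_word s x y z (filter is_real u0) (filter is_real u1) (filter is_real u2) (filter is_real u3)"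
  show ?thesis
  proof (cases "is_real x \<and> is_real y \<and> is_real z")
    case True
    then have eq: "filter is_real D = ?t 1" "filter is_real D' = ?t (-1)"
      unfolding reid3(1,2) by (auto simp: triangle_word_def Let_def two_passages_def)
    show ?thesis using gauss_word_filter[OF assms(2), of is_real] gauss_word_filter[OF assms(3), of is_real]
      unfolding eq by (rule G_word_triangle)
  next
    case False
    then have "\<not> is_real x \<or> \<not> is_real y" "\<not> is_real x \<or> \<not> is_real z" "\<not> is_real y \<or> \<not> is_real z"
      using triangle_kinds_cases[OF reid3(3)] by auto
    then show ?thesis unfolding reid3(1,2)
      by (simp add: triangle_word_def Let_def filter_two_passages del: filter.simps)
  qed
qed

lemma long_diagram_gauss_word: "long_diagram w \<Longrightarrow> gauss_word w"
  by (auto simp: long_diagram_def curve_diagram_def)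

lemma G_word_equiv:
  assumes "equivclp move_step D D'"
  shows "G_word a (filter is_real D) = G_word a (filter is_real D')"
  using assms
proof (induction rule: equivclp_induct)
  case (step y z)
  then show ?case
    using G_word_reidemeister long_diagram_gauss_word unfolding move_step_def by metis
qed simp

section \<open>Intersection numbers on a realization are determined by the Gauss word\<close>

definition partner :: "crossing list \<Rightarrow> nat \<Rightarrow> nat" where
  "partner w i = (if i = first_pos w (w ! i) then second_pos w (w ! i) else first_pos w (w ! i))"

text \<open>This is \<open>+1\<close> iff the partner strand leaves to the left of the strand
  through \<open>i\<close>, irrespective of which of the two is traversed first.\<close>

definition frame_sign :: "crossing list \<Rightarrow> nat \<Rightarrow> int" where
  "frame_sign w i = (if i = first_pos w (w ! i) then orientation (w ! i) else - orientation (w ! i))"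

lemma sum_positions:
  assumes "gauss_word w"
  shows "(\<Sum>i<length w. g i) = (\<Sum>e\<in>set w. g (first_pos w e) + g (second_pos w e))"
proof -
  have "(\<Sum>i<length w. g i) = (\<Sum>e\<in>set w. \<Sum>i\<in>{i\<in>{..<length w}. w ! i = e}. g i)"
    by (rule sum.group[symmetric]) (auto)
  also have "\<dots> = (\<Sum>e\<in>set w. g (first_pos w e) + g (second_pos w e))"
  proof (rule sum.cong[OF refl])
    fix e assume e: "e \<in> set w"
    have "{i\<in>{..<length w}. w ! i = e} = {first_pos w e, second_pos w e}"
      using gauss_word_positions(1)[OF assms e] by auto
    then show "(\<Sum>i\<in>{i\<in>{..<length w}. w ! i = e}. g i) = g (first_pos w e) + g (second_pos w e)"
      using gauss_word_positions(2)[OF assms e] by simp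
  qed
  finally show ?thesis .
qed

lemma partner_simps:
  assumes "gauss_word w" "e \<in> set w"
  shows "partner w (first_pos w e) = second_pos w e" "partner w (second_pos w e) = first_pos w e"
    "frame_sign w (first_pos w e) = orientation e" "frame_sign w (second_pos w e) = - orientation e"
  using first_pos_props[OF assms] gauss_word_positions(2)[OF assms]
  by (auto simp: partner_def frame_sign_def)

text \<open>The edge leaving a passage is the edge entering the next one. This reduces the
  discrepancy between the left push and the symmetric average to terms at the two ends of a
  loop.\<close>

lemma telescope_open_interval:
  fixes f g :: "nat \<Rightarrow> int"
  assumes "k < l" "\<And>i. k \<le> i \<Longrightarrow> i < l \<Longrightarrow> g i = f (Suc i)"
  shows "(\<Sum>i\<in>{k<..<l}. f i - g i) = g k - f l"
  using assms
proof (induction l)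
  case (Suc l)
  show ?case
  proof (cases "k = l")
    case True
    then have "{k<..<Suc l} = {}" by auto
    then show ?thesis using Suc(3)[of k] True by simp
  next
    case False
    then have kl: "k < l" using Suc(2) by simp
    have "{k<..<Suc l} = insert l {k<..<l}" using kl by auto
    then have "(\<Sum>i\<in>{k<..<Suc l}. f i - g i) = f l - g l + (\<Sum>i\<in>{k<..<l}. f i - g i)" by simp
    also have "(\<Sum>i\<in>{k<..<l}. f i - g i) = g k - f l" using Suc(1)[OF kl] Suc(3) by auto
    finally show ?thesis using Suc(3)[of l] kl by simp
  qed
qed simp

text \<open>
  Pushing the first cycle off itself to its left and pushing it to its right give the same number of
  intersections with a cycle \<open>Y\<close>, because \<open>Yin\<close> and \<open>Yout\<close> satisfy Kirchhoff's rule; the right-hand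
  side is the symmetric average of both, up to a factor 4.
\<close>

lemma left_push_symmetric:
  fixes Yin Yout :: "nat \<Rightarrow> int"
  assumes g: "gauss_word w" and c: "c \<in> set w"
    and step: "\<And>i. Suc i < length w \<Longrightarrow> Yout i = Yin (Suc i)"
    and kirchhoff: "\<And>e. e \<in> set w \<Longrightarrow>
      Yin (first_pos w e) + Yin (second_pos w e) = Yout (first_pos w e) + Yout (second_pos w e)"
  shows "4 * ((\<Sum>i\<in>{first_pos w c<..<second_pos w c}.
        if frame_sign w i = 1 then Yout (partner w i) else - Yin (partner w i)) +
      (if orientation c = 1 then Yout (second_pos w c) - Yin (first_pos w c) else 0)) =
    (\<Sum>e\<in>set w. orientation e *
      (winding (\<lambda>e. int (first_pos w e)) (\<lambda>e. int (second_pos w e)) c (int (first_pos w e)) *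
         (Yin (second_pos w e) + Yout (second_pos w e)) -
       winding (\<lambda>e. int (first_pos w e)) (\<lambda>e. int (second_pos w e)) c (int (second_pos w e)) *
         (Yin (first_pos w e) + Yout (first_pos w e))))"
proof -
  define k l where "k = first_pos w c" and "l = second_pos w c"
  have kl: "k < l" "l < length w"
    using gauss_word_positions(2)[OF g c] first_pos_props[OF g c] by (simp_all add: k_def l_def)
  define N where "N i = Yin i + Yout i" for i
  define wd where "wd i = winding (\<lambda>e. int (first_pos w e)) (\<lambda>e. int (second_pos w e)) c (int i)" for i
  \<comment> \<open>By Kirchhoff's rule the single edge of the partner strand met by the left push
    may be replaced by the average of its two edges. The error \<open>Yin i - Yout i\<close>
    involves only the strand of \<open>i\<close> itself and therefore telescopes along the
    loop.\<close>
  have summand: "4 * (if frame_sign w i = 1 then Yout (partner w i) else - Yin (partner w i)) =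
      2 * (frame_sign w i * N (partner w i)) + 2 * (Yin i - Yout i)" if "i < length w" for i
  proof -
    have e: "w ! i \<in> set w" using that by simp
    have "i = first_pos w (w ! i) \<or> i = second_pos w (w ! i)"
      using first_pos_props(5)[OF g e that] by simp
    then have "Yin i + Yin (partner w i) = Yout i + Yout (partner w i)"
      using kirchhoff[OF e] partner_simps(1,2)[OF g e] by (auto simp: partner_def)
    moreover have "frame_sign w i = 1 \<or> frame_sign w i = -1"
      using orientation_cases[of "w ! i"] by (auto simp: frame_sign_def)
    ultimately show ?thesis by (auto simp: N_def)
  qed
  have "4 * (\<Sum>i\<in>{k<..<l}. if frame_sign w i = 1 then Yout (partner w i) else - Yin (partner w i)) =
      (\<Sum>i\<in>{k<..<l}. 2 * (frame_sign w i * N (partner w i)) + 2 * (Yin i - Yout i))"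
    unfolding sum_distrib_left using kl by (intro sum.cong refl summand) auto
  also have "\<dots> = (\<Sum>i\<in>{k<..<l}. 2 * (frame_sign w i * N (partner w i))) + 2 * (Yout k - Yin l)"
    unfolding sum.distrib sum_distrib_left[symmetric]
    using kl step by (subst telescope_open_interval) auto
  finally have A: "4 * (\<Sum>i\<in>{k<..<l}. if frame_sign w i = 1 then Yout (partner w i) else - Yin (partner w i)) =
    (\<Sum>i\<in>{k<..<l}. 2 * (frame_sign w i * N (partner w i))) + 2 * (Yout k - Yin l)" .
  have fs: "frame_sign w k = orientation c" "frame_sign w l = - orientation c" "partner w k = l" "partner w l = k"
    using partner_simps[OF g c] by (simp_all add: k_def l_def)
  \<comment> \<open>The corner of the loop together with the telescoped boundary terms yields the
    summands of the passages \<open>k\<close> and \<open>l\<close>, where only one of the two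
    adjacent edges is on the loop and the winding is 1 instead of 2.\<close>
  have B: "4 * (if orientation c = 1 then Yout l - Yin k else 0) + 2 * (Yout k - Yin l) =
      frame_sign w k * N (partner w k) + frame_sign w l * N (partner w l)"
    using kirchhoff[OF c] orientation_cases[of c] unfolding fs N_def k_def[symmetric] l_def[symmetric] by auto
  have wd: "wd i = (if i = k \<or> i = l then 1 else if k < i \<and> i < l then 2 else 0)" for i
    using kl by (auto simp: wd_def winding_def k_def[symmetric] l_def[symmetric] sgn_if)
  have "(\<Sum>i<length w. frame_sign w i * wd i * N (partner w i)) =
      (\<Sum>i\<in>insert k (insert l {k<..<l}). frame_sign w i * wd i * N (partner w i))"
    by (rule sum.mono_neutral_right) (use kl in \<open>auto simp: wd\<close>)
  also have "\<dots> = frame_sign w k * N (partner w k) + frame_sign w l * N (partner w l) +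
      (\<Sum>i\<in>{k<..<l}. 2 * (frame_sign w i * N (partner w i)))"
    using kl by (simp add: wd mult.assoc mult.left_commute)
  also have "\<dots> = 4 * ((\<Sum>i\<in>{k<..<l}. if frame_sign w i = 1 then Yout (partner w i) else - Yin (partner w i)) +
      (if orientation c = 1 then Yout l - Yin k else 0))"
    using A B by (simp only: distrib_left)
  finally have "4 * ((\<Sum>i\<in>{k<..<l}. if frame_sign w i = 1 then Yout (partner w i) else - Yin (partner w i)) +
      (if orientation c = 1 then Yout l - Yin k else 0)) = (\<Sum>i<length w. frame_sign w i * wd i * N (partner w i))"
    by simp
  also have "\<dots> = (\<Sum>e\<in>set w. orientation e * (wd (first_pos w e) * N (second_pos w e) - wd (second_pos w e) * N (first_pos w e)))"
    unfolding sum_positions[OF g]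
    by (rule sum.cong[OF refl]) (simp add: partner_simps[OF g] algebra_simps)
  finally show ?thesis unfolding k_def l_def wd_def N_def .
qed

text \<open>Turning from \<open>q\<close>, the scan stops as soon as \<open>p\<close> or
  \<open>q\<close> is met. If this happens at \<open>p\<close> after \<open>j\<close> steps, the
  \<open>j - 1\<close> darts before it are counted; at a four-valent vertex \<open>j\<close> is 1, 2
  or 3.\<close>

lemma darts_between_eq:
  assumes "p = (rot S ^^ j) q" "0 < j" "\<And>i. 0 < i \<Longrightarrow> i < j \<Longrightarrow> (rot S ^^ i) q \<noteq> p \<and> (rot S ^^ i) q \<noteq> q"
  shows "darts_between S q p = (\<lambda>i. (rot S ^^ i) q) ` {0<..<j}"
proof -
  have "(0 < n \<and> (\<forall>m. 0 < m \<and> m \<le> n \<longrightarrow> (rot S ^^ m) q \<noteq> p \<and> (rot S ^^ m) q \<noteq> q)) \<longleftrightarrow> n \<in> {0<..<j}" for n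
  proof
    assume n: "0 < n \<and> (\<forall>m. 0 < m \<and> m \<le> n \<longrightarrow> (rot S ^^ m) q \<noteq> p \<and> (rot S ^^ m) q \<noteq> q)"
    have "\<not> j \<le> n" using n assms(1,2) by blast
    then show "n \<in> {0<..<j}" using n by simp
  next
    assume "n \<in> {0<..<j}"
    then show "0 < n \<and> (\<forall>m. 0 < m \<and> m \<le> n \<longrightarrow> (rot S ^^ m) q \<noteq> p \<and> (rot S ^^ m) q \<noteq> q)"
      using assms(3) le_less_trans by (simp only: greaterThanLessThan_iff) blast
  qed
  then show ?thesis unfolding darts_between_def by blast
qed

lemma darts_between_1: "rot S q = p \<Longrightarrow> darts_between S q p = {}"
  using darts_between_eq[where p=p and S=S and j=1 and q=q] by auto

lemma darts_between_2:
  assumes "rot S q = a" "rot S a = p" "a \<noteq> p" "a \<noteq> q"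
  shows "darts_between S q p = {a}"
proof -
  have i: "i = 1" if "0 < i" "i < 2" for i :: nat using that by simp
  have "darts_between S q p = (\<lambda>i. (rot S ^^ i) q) ` {0<..<2}"
    by (rule darts_between_eq) (use assms in \<open>auto simp: numeral_2_eq_2 dest!: i[unfolded numeral_2_eq_2]\<close>)
  also have "{0<..<2::nat} = {1}" by auto
  finally show ?thesis using assms(1) by simp
qed

lemma darts_between_3:
  assumes "rot S q = a" "rot S a = b" "rot S b = p" "a \<noteq> p" "a \<noteq> q" "b \<noteq> p" "b \<noteq> q"
  shows "darts_between S q p = {a, b}"
proof -
  have i: "i = 1 \<or> i = 2" if "0 < i" "i < 3" for i :: nat using that by auto
  have "darts_between S q p = (\<lambda>i. (rot S ^^ i) q) ` {0<..<3}"
    by (rule darts_between_eq) (use assms in \<open>auto simp: numeral_3_eq_3 numeral_2_eq_2 dest!: i[unfolded numeral_3_eq_3]\<close>)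
  also have "{0<..<3::nat} = {1, 2}" by auto
  finally show ?thesis using assms(1,2) by (simp add: numeral_2_eq_2)
qed

lemma count_list_distinct: "distinct ys \<Longrightarrow> count_list ys e = of_bool (e \<in> set ys)"
  by (induction ys) auto

text \<open>The net flow of \<open>ys\<close> along the dart \<open>e\<close>, which is the summand
  of \<open>intersection_number\<close>.\<close>

definition flux :: "surface \<Rightarrow> nat list \<Rightarrow> nat \<Rightarrow> int" where
  "flux S ys e = int (count_list ys e) - int (count_list ys (flip S e))"

locale diagram =
  fixes S :: surface and ds :: "nat list" and w :: "crossing list"
  assumes diagram: "curve_diagram S ds w"
begin

abbreviation "ps \<equiv> crossing_passages S ds"
abbreviation "out_germ k \<equiv> out_dart ds k"
abbreviation "in_germ k \<equiv> in_dart S ds k"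

lemma surface: "closed_surface S" and curve: "closed_curve S ds" and gauss: "gauss_word w"
  and length_ps: "length ps = length w"
  using diagram by (auto simp: curve_diagram_def Let_def)

lemma rot_permutes: "rot S permutes darts S" and finite_darts: "finite (darts S)"
  and flip_flip: "d \<in> darts S \<Longrightarrow> flip S (flip S d) = d"
  using surface by (auto simp: closed_surface_def)

lemma ds_props: "0 < length ds" "distinct ds" "k < length ds \<Longrightarrow> ds ! k \<in> darts S"
  "k < length ds \<Longrightarrow> flip S (ds ! k) \<notin> set ds" "k < length ds \<Longrightarrow> vertex S (in_germ k) = vertex S (out_germ k)"
  using curve by (auto simp: closed_curve_def)

lemma ps_props: "sorted ps" "distinct ps" "i < length w \<Longrightarrow> ps ! i < length ds"
  "i < j \<Longrightarrow> j < length w \<Longrightarrow> ps ! i < ps ! j"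
proof -
  show s: "sorted ps" "distinct ps" unfolding crossing_passages_def by (simp_all add: sorted_wrt_filter)
  show "ps ! i < length ds" if "i < length w" 
    using nth_mem[of i ps] that length_ps by (auto simp: crossing_passages_def)
  show "ps ! i < ps ! j" if "i < j" "j < length w"
    using s that length_ps by (metis less_trans nth_eq_iff_index_eq order_less_imp_not_eq sorted_nth_mono less_imp_le order_le_less)
qed

lemma crossing_at:
  assumes "i < j" "j < length w"
  shows "w ! i = w ! j \<longleftrightarrow> vertex S (out_germ (ps ! i)) = vertex S (out_germ (ps ! j))"
    and "w ! i = w ! j \<Longrightarrow> transversal S ds (ps ! i) (ps ! j) (orientation (w ! i))"
  using diagram assms unfolding curve_diagram_def Let_def by blast+

lemma out_germ_nth: "k < length ds \<Longrightarrow> out_germ k \<in> set ds"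
  using ds_props(1) by (auto simp: out_dart_def)

lemma out_germ_darts: "k < length ds \<Longrightarrow> out_germ k \<in> darts S"
  using curve out_germ_nth by (auto simp: closed_curve_def)

lemma flip_in_germ: "k < length ds \<Longrightarrow> flip S (in_germ k) = ds ! k"
  by (simp add: in_dart_def flip_flip ds_props(3))

lemma in_germ_not_ds: "k < length ds \<Longrightarrow> in_germ k \<notin> set ds"
  using ds_props(4) by (simp add: in_dart_def)

lemma out_germ_inj: "k < length ds \<Longrightarrow> l < length ds \<Longrightarrow> out_germ k = out_germ l \<longleftrightarrow> k = l"
proof -
  assume kl: "k < length ds" "l < length ds"
  have "Suc k mod length ds = Suc l mod length ds \<longleftrightarrow> k = l"
    using kl by (auto simp: mod_Suc split: if_splits)
  then show ?thesis using kl ds_props(1,2) by (simp add: out_dart_def nth_eq_iff_index_eq)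
qed

lemma in_germ_inj: "k < length ds \<Longrightarrow> l < length ds \<Longrightarrow> in_germ k = in_germ l \<longleftrightarrow> k = l"
  using flip_in_germ ds_props(2) by (metis nth_eq_iff_index_eq)

lemma ds_out_germ: "d \<in> set ds \<Longrightarrow> \<exists>k < length ds. d = out_germ k"
proof -
  assume "d \<in> set ds"
  then obtain j where j: "j < length ds" "d = ds ! j" by (auto simp: in_set_conv_nth)
  show ?thesis
  proof (cases j)
    case 0
    then show ?thesis using j by (intro exI[of _ "length ds - 1"]) (auto simp: out_dart_def)
  next
    case (Suc m)
    then show ?thesis using j by (intro exI[of _ m]) (auto simp: out_dart_def)
  qed
qed

lemma vertex_eqI: "e \<in> vertex S d \<Longrightarrow> vertex S e = vertex S d"
  unfolding vertex_def using cyclic_on_orbit[OF rot_permutes finite_darts] orbit_cyclic_eq3 by metis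

lemma flux_ds:
  assumes "distinct ys" "set ys \<subseteq> set ds" "k < length ds"
  shows "flux S ys (ds ! k) = of_bool (ds ! k \<in> set ys)" "flux S ys (in_germ k) = - of_bool (ds ! k \<in> set ys)"
  using assms ds_props(4)[OF assms(3)] flip_in_germ[OF assms(3)] in_germ_not_ds[OF assms(3)]
  by (auto simp: flux_def count_list_distinct)

lemma flux_out_germ:
  assumes "distinct ys" "set ys \<subseteq> set ds" "k < length ds"
  shows "flux S ys (out_germ k) = of_bool (out_germ k \<in> set ys)"
  using flux_ds(1)[OF assms(1,2), of "Suc k mod length ds"] ds_props(1) by (simp add: out_dart_def)

text \<open>The vertex is visited only once, so the remaining darts belong to edges which the curve
  does not use in either direction. Such edges may exist because the curve need not fill the
  surface.\<close>

lemma flux_noncrossing: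
  assumes k: "k < length ds" "k \<notin> set ps" and ys: "set ys \<subseteq> set ds"
    and e: "e \<in> darts_between S (out_germ k) (in_germ k)"
  shows "flux S ys e = 0"
proof -
  have ev: "e \<in> vertex S (out_germ k)" "e \<noteq> in_germ k" "e \<noteq> out_germ k"
    using e by (auto simp: darts_between_def vertex_def orbit_altdef)
  have only: "l = k" if "l < length ds" "vertex S (out_germ l) = vertex S (out_germ k)" for l
    using k that by (auto simp: crossing_passages_def)
  have "e \<notin> set ds"
    using ds_out_germ[of e] ev only vertex_eqI[OF ev(1)] by metis
  moreover have "flip S e \<notin> set ds"
  proof
    assume "flip S e \<in> set ds"
    then obtain j where j: "j < length ds" "flip S e = ds ! j" by (auto simp: in_set_conv_nth)
    have "e \<in> darts S" using ev(1) permutes_orbit_subset[OF rot_permutes out_germ_darts[OF k(1)]]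
      by (auto simp: vertex_def)
    then have "e = in_germ j" using j flip_flip by (metis in_dart_def)
    then have "vertex S (out_germ j) = vertex S (out_germ k)"
      using vertex_eqI[OF ev(1)] ds_props(5)[OF j(1)] by simp
    then show False using only[OF j(1)] ev(2) \<open>e = in_germ j\<close> by simp
  qed
  ultimately have "count_list ys e = 0" "count_list ys (flip S e) = 0"
    using ys unfolding count_list_zero_iff by blast+
  then show ?thesis by (simp add: flux_def)
qed

lemma positions:
  assumes "c \<in> set w"
  shows "first_pos w c < second_pos w c" "second_pos w c < length w" "first_pos w c < length w"
    "w ! first_pos w c = c" "w ! second_pos w c = c"
    "ps ! first_pos w c < length ds" "ps ! second_pos w c < length ds"
    "ps ! first_pos w c < ps ! second_pos w c"
  using first_pos_props[OF gauss assms] gauss_word_positions(2)[OF gauss assms] ps_props(3,4) by auto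

lemma rotations:
  assumes c: "c \<in> set w" and k: "k = ps ! first_pos w c" and l: "l = ps ! second_pos w c"
  shows "orientation c = 1 \<Longrightarrow> rot S (out_germ k) = out_germ l \<and> rot S (out_germ l) = in_germ k \<and>
      rot S (in_germ k) = in_germ l \<and> rot S (in_germ l) = out_germ k"
    and "orientation c = -1 \<Longrightarrow> rot S (out_germ k) = in_germ l \<and> rot S (in_germ l) = in_germ k \<and>
      rot S (in_germ k) = out_germ l \<and> rot S (out_germ l) = out_germ k"
  using crossing_at(2)[of "first_pos w c" "second_pos w c"] positions[OF c]
  by (auto simp: transversal_def Let_def k l)

text \<open>The orientation fixes the cyclic order of the four germs. The third equation describes
  the corner created by the smoothing: \<alpha> arrives along the second strand and leaves along the
  first.\<close>

lemma between:
  assumes c: "c \<in> set w" and k: "k = ps ! first_pos w c" and l: "l = ps ! second_pos w c"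
  shows "darts_between S (out_germ k) (in_germ k) = {if orientation c = 1 then out_germ l else in_germ l}"
    and "darts_between S (out_germ l) (in_germ l) = {if orientation c = 1 then in_germ k else out_germ k}"
    and "darts_between S (out_germ k) (in_germ l) = (if orientation c = 1 then {out_germ l, in_germ k} else {})"
proof -
  have kl: "k < length ds" "l < length ds" "k \<noteq> l" using positions[OF c] by (auto simp: k l)
  have ne: "out_germ k \<noteq> out_germ l" "in_germ k \<noteq> in_germ l" "out_germ a \<noteq> in_germ b" "in_germ b \<noteq> out_germ a"
    if "a \<in> {k, l}" "b \<in> {k, l}" for a b
    using kl out_germ_inj in_germ_inj out_germ_nth in_germ_not_ds that by (auto, metis+)
  note ne' = ne[of k k, simplified] ne[of k l, simplified] ne[of l k, simplified] ne[of l l, simplified]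
  note r = rotations[OF c k l]
  consider (pos) "orientation c = 1" | (neg) "orientation c = -1" using orientation_cases by blast
  then have "darts_between S (out_germ k) (in_germ k) = {if orientation c = 1 then out_germ l else in_germ l} \<and>
    darts_between S (out_germ l) (in_germ l) = {if orientation c = 1 then in_germ k else out_germ k} \<and>
    darts_between S (out_germ k) (in_germ l) = (if orientation c = 1 then {out_germ l, in_germ k} else {})"
  proof cases
    case pos
    note r = r(1)[OF pos]
    show ?thesis
      using darts_between_2[of S "out_germ k" "out_germ l" "in_germ k"] darts_between_2[of S "out_germ l" "in_germ k" "in_germ l"]
        darts_between_3[of S "out_germ k" "out_germ l" "in_germ k" "in_germ l"] r ne' pos by simp
  next
    case neg
    note r = r(2)[OF neg]
    show ?thesis
      using darts_between_2[of S "out_germ k" "in_germ l" "in_germ k"] darts_between_2[of S "out_germ l" "out_germ k" "in_germ l"]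
        darts_between_1[of S "out_germ k" "in_germ l"] r ne' neg by simp
  qed
  then show "darts_between S (out_germ k) (in_germ k) = {if orientation c = 1 then out_germ l else in_germ l}"
    and "darts_between S (out_germ l) (in_germ l) = {if orientation c = 1 then in_germ k else out_germ k}"
    and "darts_between S (out_germ k) (in_germ l) = (if orientation c = 1 then {out_germ l, in_germ k} else {})"
    by blast+
qed

definition push :: "nat \<Rightarrow> nat list \<Rightarrow> int" where
  "push k ys = (\<Sum>e\<in>darts_between S (out_germ k) (in_germ k). flux S ys e)"

lemma push_noncrossing:
  assumes "k < length ds" "k \<notin> set ps" "set ys \<subseteq> set ds"
  shows "push k ys = 0"
  unfolding push_def by (rule sum.neutral) (use flux_noncrossing[OF assms] in blast)

lemma push_crossing:
  assumes i: "i < length w" and ys: "distinct ys" "set ys \<subseteq> set ds"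
  shows "push (ps ! i) ys = (if frame_sign w i = 1 then of_bool (out_germ (ps ! partner w i) \<in> set ys)
    else - of_bool (ds ! (ps ! partner w i) \<in> set ys))"
proof -
  have c: "w ! i \<in> set w" using i by simp
  note b = between(1,2)[OF c refl refl] and o = orientation_cases[of "w ! i"]
  note fl = flux_out_germ[OF ys] flux_ds(2)[OF ys] and p = positions[OF c]
  have "i = first_pos w (w ! i) \<or> i = second_pos w (w ! i)" using first_pos_props(5)[OF gauss c i] by simp
  then show ?thesis
  proof
    assume e: "i = first_pos w (w ! i)"
    have s: "frame_sign w i = orientation (w ! i)" "partner w i = second_pos w (w ! i)"
      using e by (simp_all add: frame_sign_def partner_def)
    show ?thesis unfolding s push_def using o p b(1) by (auto simp: fl simp flip: e)
  next
    assume e: "i = second_pos w (w ! i)"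
    then have s: "frame_sign w i = - orientation (w ! i)" "partner w i = first_pos w (w ! i)"
      using p(1) by (auto simp: frame_sign_def partner_def)
    show ?thesis unfolding s push_def using o p b(2) by (auto simp: fl simp flip: e)
  qed
qed

lemma passages_of_eq:
  assumes c: "c \<in> set w"
  shows "passages_of S ds w c = [ps ! first_pos w c, ps ! second_pos w c]"
proof -
  let ?k = "first_pos w c" and ?l = "second_pos w c"
  have "filter (\<lambda>i. w ! i = c) [0..<length w] = [?k, ?l]"
  proof (rule sorted_distinct_set_unique)
    show "set (filter (\<lambda>i. w ! i = c) [0..<length w]) = set [?k, ?l]"
      using gauss_word_positions(1)[OF gauss c] by auto
  qed (use positions(1)[OF c] in \<open>simp_all add: sorted_wrt_filter\<close>)
  then show ?thesis by (simp add: passages_of_def)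
qed

text \<open>The loop follows the curve through all passages strictly between the two at
  \<open>c\<close> and then closes up with one corner. Passages away from crossings contribute
  nothing, so only positions in the Gauss word remain.\<close>

lemma push_alpha_cycle:
  assumes c: "c \<in> set w" and ys: "distinct ys" "set ys \<subseteq> set ds"
  shows "intersection_number S (alpha_cycle S ds w c) ys =
    (\<Sum>i\<in>{first_pos w c<..<second_pos w c}. push (ps ! i) ys) +
    (if orientation c = 1 then of_bool (out_germ (ps ! second_pos w c) \<in> set ys) - of_bool (ds ! (ps ! first_pos w c) \<in> set ys)
     else 0)"
proof -
  define k l where kl: "k = ps ! first_pos w c" "l = ps ! second_pos w c"
  note p = positions[OF c, folded kl]
  define xs where "xs = drop (Suc k) (take (Suc l) ds)"
  have len: "length xs = l - k" using p by (simp add: xs_def)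
  have nth: "xs ! m = ds ! (Suc k + m)" if "m < l - k" for m
    using that p by (simp add: xs_def)
  have germs: "out_dart xs m = out_germ (Suc k + m)" "in_dart S xs m = in_germ (Suc k + m)" if "m < l - Suc k" for m
    using that p by (simp_all add: out_dart_def in_dart_def len nth)
  have last: "out_dart xs (l - Suc k) = out_germ k" "in_dart S xs (l - Suc k) = in_germ l"
    using p Suc_diff_Suc[of k l] by (simp_all add: out_dart_def in_dart_def len nth)
  let ?h = "\<lambda>m. \<Sum>e\<in>darts_between S (out_dart xs m) (in_dart S xs m). flux S ys e"
  have "alpha_cycle S ds w c = xs"
    by (simp add: alpha_cycle_def passages_of_eq[OF c] kl xs_def)
  then have "intersection_number S (alpha_cycle S ds w c) ys = (\<Sum>m<Suc (l - Suc k). ?h m)"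
    using p by (simp add: intersection_number_def flux_def len Suc_diff_Suc)
  also have "\<dots> = (\<Sum>m<l - Suc k. push (Suc k + m) ys) + ?h (l - Suc k)"
    by (simp add: germs push_def)
  also have "(\<Sum>m<l - Suc k. push (Suc k + m) ys) = (\<Sum>j\<in>{k<..<l}. push j ys)"
    by (rule sum.reindex_bij_witness[of _ "\<lambda>j. j - Suc k" "\<lambda>m. Suc k + m"]) auto
  also have "\<dots> = (\<Sum>j\<in>(!) ps ` {first_pos w c<..<second_pos w c}. push j ys)"
  proof (rule sum.mono_neutral_right)
    show "(!) ps ` {first_pos w c<..<second_pos w c} \<subseteq> {k<..<l}"
      using ps_props(4) p by (auto simp: kl)
    show "\<forall>j\<in>{k<..<l} - (!) ps ` {first_pos w c<..<second_pos w c}. push j ys = 0"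
    proof
      fix j assume j: "j \<in> {k<..<l} - (!) ps ` {first_pos w c<..<second_pos w c}"
      have "j \<notin> set ps"
      proof
        assume "j \<in> set ps"
        then obtain i where i: "i < length w" "j = ps ! i" by (auto simp: in_set_conv_nth length_ps)
        have "i \<notin> {first_pos w c<..<second_pos w c}" using i j by auto
        then have "ps ! i \<le> k \<or> l \<le> ps ! i"
          using ps_props(4)[of i "first_pos w c"] ps_props(4)[of "second_pos w c" i] i p
          by (cases "i = first_pos w c"; cases "i = second_pos w c") (auto simp: kl)
        then show False using i j by auto
      qed
      then show "push j ys = 0" using push_noncrossing[of j] j p ys(2) by auto
    qed
  qed simp
  also have "\<dots> = (\<Sum>i\<in>{first_pos w c<..<second_pos w c}. push (ps ! i) ys)"
  proof (rule sum.reindex[unfolded comp_def])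
    show "inj_on ((!) ps) {first_pos w c<..<second_pos w c}"
      using ps_props(2) p by (auto simp: inj_on_def nth_eq_iff_index_eq length_ps)
  qed
  also have "?h (l - Suc k) = (if orientation c = 1 then of_bool (out_germ l \<in> set ys) - of_bool (ds ! k \<in> set ys) else 0)"
  proof -
    have "out_germ l \<noteq> in_germ k" using in_germ_not_ds[of k] out_germ_nth[of l] p by metis
    then show ?thesis
      unfolding last between(3)[OF c kl] using flux_out_germ[OF ys, of l] flux_ds(2)[OF ys, of k] p by simp
  qed
  finally show ?thesis by (simp only: kl)
qed

text \<open>Which edges at a crossing lie on \<beta>_d can be read off from positions. These
  indicators satisfy the two conditions of \<open>left_push_symmetric\<close>, and their sum at a
  passage is \<open>2 - winding\<close>. Hence the surface and the curve on it enter only through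
  the word, even though each single left push depends on which side is chosen.\<close>

lemma intersection_number_word:
  assumes c: "c \<in> set w" and d: "d \<in> set w"
  shows "4 * intersection_number S (alpha_cycle S ds w c) (beta_cycle S ds w d) = word_pairing w c d"
proof -
  define k l where kl: "k = first_pos w d" "l = second_pos w d"
  note p = positions[OF d, folded kl]
  define ys where "ys = drop (Suc (ps ! l)) ds @ take (Suc (ps ! k)) ds"
  have beta: "beta_cycle S ds w d = ys" by (simp add: beta_cycle_def passages_of_eq[OF d] kl ys_def)
  have mem: "ds ! j \<in> set ys \<longleftrightarrow> j \<le> ps ! k \<or> ps ! l < j" if "j < length ds" for j
  proof -
    have "ds ! j \<in> set (take (Suc (ps ! k)) ds) \<longleftrightarrow> j \<le> ps ! k"
      using that ds_props(2) p by (auto simp: in_set_conv_nth nth_eq_iff_index_eq less_Suc_eq_le)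
    moreover have "ds ! j \<in> set (drop (Suc (ps ! l)) ds) \<longleftrightarrow> ps ! l < j"
    proof
      assume "ps ! l < j"
      then have "drop (Suc (ps ! l)) ds ! (j - Suc (ps ! l)) = ds ! j" using that by simp
      then show "ds ! j \<in> set (drop (Suc (ps ! l)) ds)"
        using that \<open>ps ! l < j\<close> by (metis Suc_leI diff_less_mono length_drop nth_mem)
    qed (use that ds_props(2) in \<open>auto simp: in_set_conv_nth nth_eq_iff_index_eq\<close>)
    ultimately show ?thesis by (auto simp: ys_def)
  qed
  have ys: "distinct ys" "set ys \<subseteq> set ds"
    using ds_props(2) p set_take_disj_set_drop_if_distinct[of ds "Suc (ps ! k)" "Suc (ps ! l)"]
    by (auto simp: ys_def dest: in_set_takeD in_set_dropD)
  have less: "ps ! i < ps ! j \<longleftrightarrow> i < j" if "i < length w" "j < length w" for i j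
    using ps_props(4)[of i j] ps_props(4)[of j i] that by (cases i j rule: linorder_cases) auto
  \<comment> \<open>Whether the edges entering and leaving the \<open>i\<close>-th passage lie on
    \<beta>_d. The first passage through \<open>d\<close> is entered on \<beta>_d and left on
    \<alpha>_d, the second one conversely; this explains the different strict inequalities.\<close>
  define Yin Yout :: "nat \<Rightarrow> int" where "Yin i = of_bool (\<not> (k < i \<and> i \<le> l))" and "Yout i = of_bool (\<not> (k \<le> i \<and> i < l))" for i
  have Yin: "of_bool (ds ! (ps ! i) \<in> set ys) = Yin i" if "i < length w" for i
    using mem[OF ps_props(3)[OF that]] less[of k i] less[of l i] that p by (auto simp: Yin_def not_less[symmetric])
  have Yout: "of_bool (out_germ (ps ! i) \<in> set ys) = Yout i" if i: "i < length w" for i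
  proof (cases "Suc (ps ! i) < length ds")
    case True
    then show ?thesis
      using mem[OF True] less[of k i] less[of i k] less[of l i] less[of i l] i p
      by (auto simp: Yout_def out_dart_def Suc_le_eq less_Suc_eq_le)
  next
    \<comment> \<open>After the last passage the curve wraps around to \<open>ds ! 0\<close>, the
      edge with the basepoint, which lies on \<beta>_d.\<close>
    case False
    then have e: "Suc (ps ! i) = length ds" using ps_props(3)[OF i] by simp
    then have "\<not> ps ! i < ps ! l" using p by simp
    then have "l \<le> i" using less[of i l] i p by simp
    then show ?thesis using mem[of 0] ds_props(1) e by (simp add: Yout_def out_dart_def)
  qed
  have "4 * intersection_number S (alpha_cycle S ds w c) ys =
    4 * ((\<Sum>i\<in>{first_pos w c<..<second_pos w c}.
        if frame_sign w i = 1 then Yout (partner w i) else - Yin (partner w i)) +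
      (if orientation c = 1 then Yout (second_pos w c) - Yin (first_pos w c) else 0))"
  proof -
    have "partner w i < length w" if "i < length w" for i
      using positions[of "w ! i"] that by (simp add: partner_def)
    then have "push (ps ! i) ys = (if frame_sign w i = 1 then Yout (partner w i) else - Yin (partner w i))"
      if "i < length w" for i
      using push_crossing[OF that ys] Yin Yout that by simp
    then show ?thesis
      unfolding push_alpha_cycle[OF c ys] using positions[OF c] Yin Yout by simp
  qed
  also have "\<dots> = (\<Sum>e\<in>set w. orientation e *
      (winding (\<lambda>e. int (first_pos w e)) (\<lambda>e. int (second_pos w e)) c (int (first_pos w e)) *
         (Yin (second_pos w e) + Yout (second_pos w e)) -
       winding (\<lambda>e. int (first_pos w e)) (\<lambda>e. int (second_pos w e)) c (int (second_pos w e)) *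
         (Yin (first_pos w e) + Yout (first_pos w e))))"
  proof (rule left_push_symmetric[OF gauss c])
    show "Yout i = Yin (Suc i)" for i by (simp add: Yin_def Yout_def Suc_le_eq less_Suc_eq_le)
    fix e assume e: "e \<in> set w"
    \<comment> \<open>At \<open>d\<close> the cycle \<beta>_d enters along one strand and leaves
      along the other; at every other passage through a crossing it either goes straight or is
      absent.\<close>
    show "Yin (first_pos w e) + Yin (second_pos w e) = Yout (first_pos w e) + Yout (second_pos w e)"
    proof (cases "e = d")
      case False
      then have "first_pos w e \<notin> {k, l}" "second_pos w e \<notin> {k, l}"
        using positions(4,5)[OF e] p by auto
      then show ?thesis by (auto simp: Yin_def Yout_def)
    qed (use p in \<open>simp add: Yin_def Yout_def kl\<close>)
  qed
  finally have eq: "4 * intersection_number S (alpha_cycle S ds w c) ys = \<dots>" .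
  have "Yin i + Yout i = 2 - winding (\<lambda>e. int (first_pos w e)) (\<lambda>e. int (second_pos w e)) d (int i)" for i
    using p(1) by (auto simp: Yin_def Yout_def winding_def kl[symmetric] sgn_if)
  then show ?thesis using eq by (simp add: word_pairing_def pairing_def beta)
qed

lemma G_real_word: "G_real a a S ds w = G_word a w"
proof -
  let ?T = "crossings_of_type a w"
  let ?e = "\<lambda>c d. intersection_number S (alpha_cycle S ds w c) (beta_cycle S ds w d)"
  have e: "word_pairing w c d div 4 = ?e c d" if "c \<in> ?T" "d \<in> ?T" for c d
    using intersection_number_word[of c d] that by (auto simp: crossings_of_type_def simp flip: intersection_number_word)
  have "of_int (writhe a w) * W_real a S ds w =
      (\<Sum>c\<in>?T. \<Sum>d\<in>?T. of_int (crossing_sign c * crossing_sign d) * (t_pow (?e c c) - 1))"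
    unfolding writhe_def W_real_def of_int_sum sum_product by (subst sum.swap) (simp add: algebra_simps)
  then have "G_real a a S ds w = (\<Sum>c\<in>?T. \<Sum>d\<in>?T. of_int (crossing_sign c * crossing_sign d) *
      (t_pow (?e c d) - t_pow (?e c c)))"
    unfolding G_real_def by (simp add: sum_subtractf[symmetric] algebra_simps)
  also have "\<dots> = G_word a w"
    unfolding G_word_def G_sum_def by (intro sum.cong refl) (simp add: e)
  finally show ?thesis .
qed

end

section \<open>Laurent polynomials with a double zero at 1\<close>

text \<open>The linear functional sending t^k to \<open>g k\<close>. The choices
  \<open>g k = 1\<close> and \<open>g k = k\<close> give f(1) and f'(1) as additive functionals with
  integer values.\<close>

definition laurent_pairing :: "(int \<Rightarrow> int) \<Rightarrow> laurent \<Rightarrow> int" where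
  "laurent_pairing g f = (\<Sum>k\<in>Poly_Mapping.keys f. Poly_Mapping.lookup f k * g k)"

lemma laurent_pairing_superset:
  assumes "finite A" "Poly_Mapping.keys f \<subseteq> A"
  shows "laurent_pairing g f = (\<Sum>k\<in>A. Poly_Mapping.lookup f k * g k)"
  unfolding laurent_pairing_def
  by (rule sum.mono_neutral_left[OF assms]) (auto simp: in_keys_iff)

lemma laurent_pairing_add: "laurent_pairing g (f + h) = laurent_pairing g f + laurent_pairing g h"
proof -
  let ?A = "Poly_Mapping.keys f \<union> Poly_Mapping.keys h"
  have "Poly_Mapping.keys (f + h) \<subseteq> ?A" by (rule Poly_Mapping.keys_add)
  then show ?thesis
    by (simp add: laurent_pairing_superset[of ?A] lookup_add distrib_right sum.distrib)
qed

lemma laurent_pairing_0 [simp]: "laurent_pairing g 0 = 0"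
  by (simp add: laurent_pairing_def)

lemma laurent_pairing_single [simp]: "laurent_pairing g (Poly_Mapping.single k n) = n * g k"
  by (simp add: laurent_pairing_def)

lemma laurent_pairing_uminus: "laurent_pairing g (- f) = - laurent_pairing g f"
  using laurent_pairing_add[of g f "- f"] by simp

lemma laurent_pairing_diff: "laurent_pairing g (f - h) = laurent_pairing g f - laurent_pairing g h"
  using laurent_pairing_add[of g f "- h"] by (simp add: laurent_pairing_uminus)

lemma laurent_pairing_sum: "laurent_pairing g (\<Sum>i\<in>A. f i) = (\<Sum>i\<in>A. laurent_pairing g (f i))"
  by (induction A rule: infinite_finite_induct) (simp_all add: laurent_pairing_add)

lemma laurent_pairing_of_int: "laurent_pairing g (of_int n * f) = n * laurent_pairing g f"
proof (induction n rule: int_induct[where k = 0])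
  case (step1 i)
  then show ?case by (simp add: distrib_right laurent_pairing_add)
next
  case (step2 i)
  then show ?case by (simp add: left_diff_distrib laurent_pairing_diff)
qed simp

lemma laurent_eval_1: "laurent_eval f (1 :: rat) = of_int (laurent_pairing (\<lambda>_. 1) f)"
  by (simp add: laurent_eval_def laurent_pairing_def)

lemma laurent_eval_deriv_1: "laurent_eval (laurent_deriv f) (1 :: rat) = of_int (laurent_pairing (\<lambda>k. k) f)"
  unfolding laurent_eval_1 laurent_deriv_def laurent_pairing_sum laurent_pairing_single
  by (simp add: laurent_pairing_def mult.commute)

lemma laurent_sum_monomials: "(\<Sum>k\<in>Poly_Mapping.keys f. of_int (Poly_Mapping.lookup f k) * t_pow k) = f"
proof -
  have m: "of_int n * t_pow k = Poly_Mapping.single k n" for n k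
  proof (induction n rule: int_induct[where k = 0])
    case (step1 i)
    then show ?case by (simp add: distrib_right t_pow_def single_add)
  next
    case (step2 i)
    then show ?case by (simp add: left_diff_distrib t_pow_def single_diff)
  qed simp
  show ?thesis unfolding m
    by (rule poly_mapping_eqI) (auto simp: lookup_sum lookup_single when_def in_keys_iff)
qed

lemma t_pow_add: "t_pow (k + l) = t_pow k * t_pow l"
  by (simp add: t_pow_def mult_single)

lemma t_pow_0 [simp]: "t_pow 0 = 1"
  by (simp add: t_pow_def)

definition signed_sum :: "(int \<times> int) list \<Rightarrow> laurent" where
  "signed_sum ps = (\<Sum>(\<epsilon>, k)\<leftarrow>ps. of_int \<epsilon> * (t_pow k - 1))"

text \<open>Coefficients are restricted to \<pm>1, with repetitions allowed, because each pair of
  the list is going to be one crossing of a curve, its first entry prescribing the sign.\<close>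

definition double_root_laurents :: "laurent set" where
  "double_root_laurents =
     {f. \<exists>ps. (\<forall>p\<in>set ps. fst p = 1 \<or> fst p = -1) \<and> f = (t_pow 1 - 1) * signed_sum ps}"

lemma double_root_laurents_closed:
  shows "0 \<in> double_root_laurents"
    and "f \<in> double_root_laurents \<Longrightarrow> h \<in> double_root_laurents \<Longrightarrow> f + h \<in> double_root_laurents"
    and "f \<in> double_root_laurents \<Longrightarrow> - f \<in> double_root_laurents"
proof -
  show "0 \<in> double_root_laurents"
    unfolding double_root_laurents_def by (auto intro!: exI[of _ "[]"] simp: signed_sum_def)
  show "f + h \<in> double_root_laurents" if f: "f \<in> double_root_laurents" and h: "h \<in> double_root_laurents"
  proof -
    obtain ps qs where "\<forall>p\<in>set ps. fst p = 1 \<or> fst p = -1" "f = (t_pow 1 - 1) * signed_sum ps"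
      "\<forall>p\<in>set qs. fst p = 1 \<or> fst p = -1" "h = (t_pow 1 - 1) * signed_sum qs"
      using f h unfolding double_root_laurents_def by blast
    then show ?thesis unfolding double_root_laurents_def
      by (intro CollectI exI[of _ "ps @ qs"]) (auto simp: signed_sum_def distrib_left)
  qed
  show "- f \<in> double_root_laurents" if f: "f \<in> double_root_laurents"
  proof -
    obtain ps where ps: "\<forall>p\<in>set ps. fst p = 1 \<or> fst p = -1" "f = (t_pow 1 - 1) * signed_sum ps"
      using f unfolding double_root_laurents_def by blast
    have "signed_sum (map (\<lambda>(\<epsilon>, k). (- \<epsilon>, k)) ps) = - signed_sum ps"
      by (induction ps) (auto simp: signed_sum_def)
    then show ?thesis unfolding double_root_laurents_def ps(2)
      by (intro CollectI exI[of _ "map (\<lambda>(\<epsilon>, k). (- \<epsilon>, k)) ps"]) (use ps(1) in auto)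
  qed
qed

lemma double_root_laurents_of_int:
  assumes "f \<in> double_root_laurents"
  shows "of_int n * f \<in> double_root_laurents"
proof (induction n rule: int_induct[where k = 0])
  case (step2 i)
  then show ?case
    using double_root_laurents_closed(2)[OF step2(2) double_root_laurents_closed(3)[OF assms]]
    by (simp add: left_diff_distrib)
qed (use assms in \<open>simp_all add: distrib_right double_root_laurents_closed\<close>)

lemma double_root_laurents_sum:
  "(\<And>i. i \<in> A \<Longrightarrow> f i \<in> double_root_laurents) \<Longrightarrow> (\<Sum>i\<in>A. f i) \<in> double_root_laurents"
  by (induction A rule: infinite_finite_induct) (simp_all add: double_root_laurents_closed)

text \<open>When k increases from i to i + 1, the Taylor remainder of first order at 1 grows by (t -
  1)(t^i - 1), which is a generator. The same relation read backwards serves negative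
  exponents.\<close>

lemma taylor_remainder_double_root: "t_pow k - 1 - of_int k * (t_pow 1 - 1) \<in> double_root_laurents"
proof -
  have one: "(t_pow 1 - 1) * (t_pow i - 1) \<in> double_root_laurents" for i
    unfolding double_root_laurents_def by (auto intro!: exI[of _ "[(1, i)]"] simp: signed_sum_def)
  show ?thesis
  proof (induction k rule: int_induct[where k = 0])
    case (step1 i)
    have "t_pow (i + 1) - 1 - of_int (i + 1) * (t_pow 1 - 1) =
        (t_pow i - 1 - of_int i * (t_pow 1 - 1)) + (t_pow 1 - 1) * (t_pow i - 1)"
      by (simp add: t_pow_add algebra_simps)
    then show ?case using double_root_laurents_closed(2)[OF step1(2) one[of i]] by (simp only:)
  next
    case (step2 i)
    have "t_pow i = t_pow (i - 1) * t_pow 1" using t_pow_add[of "i - 1" 1] by simp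
    then have "t_pow (i - 1) - 1 - of_int (i - 1) * (t_pow 1 - 1) =
        (t_pow i - 1 - of_int i * (t_pow 1 - 1)) + - ((t_pow 1 - 1) * (t_pow (i - 1) - 1))"
      by (simp add: algebra_simps)
    then show ?case
      using double_root_laurents_closed(2)[OF step2(2) double_root_laurents_closed(3)[OF one[of "i - 1"]]] by (simp only:)
  qed (simp add: double_root_laurents_closed)
qed

text \<open>Subtracting f(1) + f'(1)(t - 1), which is zero, exhibits f as an integer combination of
  the Taylor remainders of its monomials.\<close>

lemma double_root_laurentsI:
  assumes "laurent_pairing (\<lambda>_. 1) f = 0" "laurent_pairing (\<lambda>k. k) f = 0"
  shows "f \<in> double_root_laurents"
proof -
  let ?c = "\<lambda>k. of_int (Poly_Mapping.lookup f k) :: laurent"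
  have "(\<Sum>k\<in>Poly_Mapping.keys f. ?c k * (t_pow k - 1 - of_int k * (t_pow 1 - 1))) =
      (\<Sum>k\<in>Poly_Mapping.keys f. ?c k * t_pow k) - of_int (laurent_pairing (\<lambda>_. 1) f)
        - of_int (laurent_pairing (\<lambda>k. k) f) * (t_pow 1 - 1)"
    by (simp add: laurent_pairing_def sum_subtractf sum_distrib_left algebra_simps sum.distrib)
  also have "\<dots> = f" using assms by (simp add: laurent_sum_monomials)
  finally have eq: "(\<Sum>k\<in>Poly_Mapping.keys f. ?c k * (t_pow k - 1 - of_int k * (t_pow 1 - 1))) = f" .
  show ?thesis
    by (subst eq[symmetric]) (intro double_root_laurents_sum double_root_laurents_of_int taylor_remainder_double_root)
qed

text \<open>At t = 1 every term of the double sum vanishes. For the derivative, let \<gamma> be the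
  whole curve: \<beta>_d = \<gamma> - \<alpha>_d, so the two exponents in a term differ by
  -(\<alpha>_c \<cdot> \<alpha>_d). This is antisymmetric while the product of signs is symmetric,
  so the sum equals its own negative.\<close>

lemma (in diagram) G_word_double_root:
  "laurent_pairing (\<lambda>_. 1) (G_word a w) = 0" "laurent_pairing (\<lambda>k. k) (G_word a w) = 0"
proof -
  let ?T = "crossings_of_type a w"
  let ?e = "\<lambda>c d. intersection_number S (alpha_cycle S ds w c) (beta_cycle S ds w d)"
  have T: "?T \<subseteq> set w" by (auto simp: crossings_of_type_def)
  have e: "word_pairing w c d div 4 = ?e c d" if "c \<in> set w" "d \<in> set w" for c d
    by (simp flip: intersection_number_word[OF that])
  have G: "laurent_pairing g (G_word a w) =
      (\<Sum>c\<in>?T. \<Sum>d\<in>?T. crossing_sign c * crossing_sign d * (g (?e c d) - g (?e c c)))" for g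
    unfolding G_word_def G_sum_def laurent_pairing_sum laurent_pairing_of_int laurent_pairing_diff
    using T by (intro sum.cong refl) (auto simp: t_pow_def e subset_eq)
  show "laurent_pairing (\<lambda>_. 1) (G_word a w) = 0" unfolding G by simp
  let ?f = "\<lambda>e. int (first_pos w e)" and ?s = "\<lambda>e. int (second_pos w e)"
  \<comment> \<open>Four times \<alpha>_c \<cdot> \<alpha>_d. The constants 2 in
    \<open>pairing\<close> amount to \<alpha>_c \<cdot> \<gamma>, which does not depend on
    \<open>d\<close> and cancels in the difference.\<close>
  define M where "M c d = (\<Sum>e\<in>set w. orientation e *
      (winding ?f ?s c (?f e) * winding ?f ?s d (?s e) - winding ?f ?s c (?s e) * winding ?f ?s d (?f e)))" for c d
  have M: "word_pairing w c d - word_pairing w c c = - M c d" for c d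
    unfolding word_pairing_def pairing_def M_def sum_subtractf[symmetric] sum_negf[symmetric]
    by (intro sum.cong refl) (simp add: algebra_simps)
  have anti: "M d c = - M c d" for c d
    unfolding M_def sum_negf[symmetric] by (intro sum.cong refl) (simp add: algebra_simps)
  have "4 * laurent_pairing (\<lambda>k. k) (G_word a w) =
      (\<Sum>c\<in>?T. \<Sum>d\<in>?T. crossing_sign c * crossing_sign d * (word_pairing w c d - word_pairing w c c))"
    unfolding G sum_distrib_left using T
    by (intro sum.cong refl) (auto simp: subset_eq algebra_simps simp flip: intersection_number_word)
  also have "\<dots> = - (\<Sum>c\<in>?T. \<Sum>d\<in>?T. crossing_sign c * crossing_sign d * M c d)"
    unfolding M by (simp add: sum_negf)
  finally have 1: "4 * laurent_pairing (\<lambda>k. k) (G_word a w) = - (\<Sum>c\<in>?T. \<Sum>d\<in>?T. crossing_sign c * crossing_sign d * M c d)" .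
  have "(\<Sum>c\<in>?T. \<Sum>d\<in>?T. crossing_sign c * crossing_sign d * M c d) =
      (\<Sum>d\<in>?T. \<Sum>c\<in>?T. crossing_sign c * crossing_sign d * M c d)"
    by (rule sum.swap)
  also have "\<dots> = (\<Sum>d\<in>?T. \<Sum>c\<in>?T. - (crossing_sign d * crossing_sign c * M d c))"
    by (intro sum.cong refl) (subst anti, simp add: mult.commute)
  finally show "laurent_pairing (\<lambda>k. k) (G_word a w) = 0" using 1 by (simp add: sum_negf)
qed

section \<open>A surface realization of every Gauss word\<close>

text \<open>Darts of a surface are natural numbers, whereas the constructions below use tuples;
  \<open>to_nat\<close> transports them. Outside the image the map is the identity, as
  \<open>permutes\<close> demands.\<close>

definition encoded_perm :: "'a::countable set \<Rightarrow> ('a \<Rightarrow> 'a) \<Rightarrow> nat \<Rightarrow> nat" where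
  "encoded_perm A f n = (if n \<in> to_nat ` A then to_nat (f (from_nat n)) else n)"

definition encoded_surface :: "'a::countable set \<Rightarrow> ('a \<Rightarrow> 'a) \<Rightarrow> ('a \<Rightarrow> 'a) \<Rightarrow> surface" where
  "encoded_surface A r f = \<lparr>darts = to_nat ` A, rot = encoded_perm A r, flip = encoded_perm A f\<rparr>"

lemma encoded_perm_to_nat [simp]: "a \<in> A \<Longrightarrow> encoded_perm A f (to_nat a) = to_nat (f a)"
  by (auto simp: encoded_perm_def)

lemma encoded_surface_sel [simp]:
  "darts (encoded_surface A r f) = to_nat ` A"
  "rot (encoded_surface A r f) = encoded_perm A r"
  "flip (encoded_surface A r f) = encoded_perm A f"
  by (simp_all add: encoded_surface_def)

lemma encoded_perm_permutes:
  assumes "bij_betw f A A"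
  shows "encoded_perm A f permutes to_nat ` A"
proof (rule bij_imp_permutes)
  have "inj_on (encoded_perm A f) (to_nat ` A)"
    using bij_betw_imp_inj_on[OF assms] by (auto simp: inj_on_def)
  moreover have "encoded_perm A f ` to_nat ` A = to_nat ` A"
    using bij_betw_imp_surj_on[OF assms] by (force simp: image_image)
  ultimately show "bij_betw (encoded_perm A f) (to_nat ` A) (to_nat ` A)" by (simp add: bij_betw_def)
qed (simp add: encoded_perm_def)

lemma closed_surface_encoded:
  fixes A :: "'a::countable set"
  assumes A: "finite A" "A \<noteq> {}" and r: "bij_betw r A A"
    and f: "\<And>a. a \<in> A \<Longrightarrow> f a \<in> A \<and> f a \<noteq> a \<and> f (f a) = a"
    and conn: "\<And>a b. a \<in> A \<Longrightarrow> b \<in> A \<Longrightarrow> (\<lambda>x y. x \<in> A \<and> (y = r x \<or> y = f x))\<^sup>*\<^sup>* a b"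
  shows "closed_surface (encoded_surface A r f)"
proof -
  let ?S = "encoded_surface A r f"
  have bij: "bij_betw f A A" by (rule bij_betwI[of _ _ _ f]) (use f in auto)
  have step: "(\<lambda>x y. y = rot ?S x \<or> y = flip ?S x)\<^sup>*\<^sup>* (to_nat a) (to_nat b)"
    if "(\<lambda>x y. x \<in> A \<and> (y = r x \<or> y = f x))\<^sup>*\<^sup>* a b" for a b
    using that
  proof (induction rule: rtranclp_induct)
    case (step y z)
    then show ?case by (auto intro: rtranclp.rtrancl_into_rtrancl)
  qed simp
  show ?thesis unfolding closed_surface_def
  proof (intro conjI ballI)
    fix d e assume "d \<in> darts ?S" "e \<in> darts ?S"
    then show "(\<lambda>x y. y = rot ?S x \<or> y = flip ?S x)\<^sup>*\<^sup>* d e"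
      using step conn by auto
  next
    show "finite (darts ?S)" "darts ?S \<noteq> {}" using A by simp_all
    show "rot ?S permutes darts ?S" "flip ?S permutes darts ?S"
      using encoded_perm_permutes[OF r] encoded_perm_permutes[OF bij] by simp_all
    fix d assume "d \<in> darts ?S"
    then obtain a where "a \<in> A" "d = to_nat a" by auto
    then show "flip ?S d \<noteq> d" "flip ?S (flip ?S d) = d" using f[of a] by simp_all
  qed
qed

lemma orbit_encoded_perm:
  fixes A :: "'a::countable set"
  assumes "f ` A \<subseteq> A" "a \<in> A"
  shows "orbit (encoded_perm A f) (to_nat a) = to_nat ` orbit f a" "orbit f a \<subseteq> A"
proof -
  show A: "orbit f a \<subseteq> A"
  proof
    fix x assume "x \<in> orbit f a"
    then show "x \<in> A" by induction (use assms in auto)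
  qed
  show "orbit (encoded_perm A f) (to_nat a) = to_nat ` orbit f a"
  proof
    show "orbit (encoded_perm A f) (to_nat a) \<subseteq> to_nat ` orbit f a"
    proof
      fix x assume "x \<in> orbit (encoded_perm A f) (to_nat a)"
      then show "x \<in> to_nat ` orbit f a"
      proof induction
        case base
        show ?case using assms(2) orbit.base[of f a] by simp
      next
        case (step x)
        then obtain y where y: "y \<in> orbit f a" "x = to_nat y" by auto
        then have "y \<in> A" using A by auto
        then show ?case using y orbit.step[OF y(1)] by simp
      qed
    qed
    show "to_nat ` orbit f a \<subseteq> orbit (encoded_perm A f) (to_nat a)"
    proof clarify
      fix x assume "x \<in> orbit f a"
      then show "to_nat x \<in> orbit (encoded_perm A f) (to_nat a)"
      proof induction
        case base
        show ?case using orbit.base[of "encoded_perm A f" "to_nat a"] assms(2) by simp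
      next
        case (step x)
        then show ?case using orbit.step[OF step(2)] A by auto
      qed
    qed
  qed
qed

lemma vertex_encoded_eq_iff:
  fixes A :: "'a::countable set"
  assumes "r ` A \<subseteq> A" "a \<in> A" "b \<in> A"
  shows "vertex (encoded_surface A r f) (to_nat a) = vertex (encoded_surface A r f) (to_nat b) \<longleftrightarrow> orbit r a = orbit r b"
  using orbit_encoded_perm(1)[OF assms(1)] assms(2,3) by (simp add: vertex_def inj_image_eq_iff)

locale gauss =
  fixes w :: "crossing list"
  assumes gauss: "gauss_word w"
begin

abbreviation "n \<equiv> length w"

definition mate :: "nat \<Rightarrow> nat" where
  "mate k = (if k < n then partner w k else k)"

text \<open>A germ is a passage with a flag, \<open>True\<close> for the leaving edge and
  \<open>False\<close> for the arriving one. Passage \<open>n\<close> is a dummy, a bivalent vertex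
  next to the basepoint, which provides the curve with an edge even if the word is empty. At a
  crossing the next germ counterclockwise belongs to the other strand, and \<open>frame_sign\<close>
  decides to which end.\<close>

definition rotate_germ :: "nat \<times> bool \<Rightarrow> nat \<times> bool" where
  "rotate_germ = (\<lambda>(k, b). if k < n then (partner w k, (frame_sign w k = 1) = b) else (k, \<not> b))"

definition reverse_edge :: "nat \<times> bool \<Rightarrow> nat \<times> bool" where
  "reverse_edge = (\<lambda>(k, b). if b then (if k = n then 0 else Suc k, False) else (if k = 0 then n else k - 1, True))"

definition germs :: "(nat \<times> bool) set" where
  "germs = {..n} \<times> UNIV"

text \<open>The ribbon surface of the word with its boundary circles capped off. Its genus is
  whatever the word dictates; this surface serves for existence only.\<close>

definition word_surface :: surface where
  "word_surface = encoded_surface germs rotate_germ reverse_edge"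

text \<open>Edge 0 leads from the dummy passage to passage 0 and carries the basepoint. With this
  shift the \<open>j\<close>-th passage of the curve is the one at the \<open>j\<close>-th
  letter.\<close>

definition word_curve :: "nat list" where
  "word_curve = map (\<lambda>j. to_nat (if j = 0 then n else j - 1, True)) [0..<Suc n]"

lemma partner_props:
  assumes "k < n"
  shows "partner w k < n" "partner w (partner w k) = k" "partner w k \<noteq> k"
    "frame_sign w (partner w k) = - frame_sign w k" "frame_sign w k = 1 \<or> frame_sign w k = -1"
    "j < n \<Longrightarrow> w ! j = w ! k \<longleftrightarrow> j = k \<or> j = partner w k"
proof -
  have c: "w ! k \<in> set w" using assms by simp
  note p = first_pos_props[OF gauss c] gauss_word_positions(2)[OF gauss c]
  have cases: "k = first_pos w (w ! k) \<or> k = second_pos w (w ! k)" using p(5)[OF assms] by simp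
  show "partner w k < n" "partner w (partner w k) = k" "partner w k \<noteq> k"
    "frame_sign w (partner w k) = - frame_sign w k" "frame_sign w k = 1 \<or> frame_sign w k = -1"
    using cases p orientation_cases[of "w ! k"] by (auto simp: partner_def frame_sign_def)
  show "w ! j = w ! k \<longleftrightarrow> j = k \<or> j = partner w k" if "j < n"
    using cases p(1-4,6) p(5)[OF that] by (auto simp: partner_def)
qed

lemma mate_props: "k \<le> n \<Longrightarrow> mate k \<le> n" "mate (mate k) = k" "k < n \<Longrightarrow> mate k < n \<and> mate k \<noteq> k"
  using partner_props by (auto simp: mate_def le_less)

text \<open>Half a turn leads to the opposite end of the same strand, which is the transversality of
  the crossing.\<close>

lemma rotate_twice: "k < n \<Longrightarrow> rotate_germ (rotate_germ (k, b)) = (k, \<not> b)"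
  using partner_props(1,2,4,5)[of k] by (cases b) (auto simp: rotate_germ_def)

lemma rotate_dummy: "\<not> k < n \<Longrightarrow> rotate_germ (k, b) = (k, \<not> b)"
  by (simp add: rotate_germ_def)

lemma rotate_fst: "fst (rotate_germ x) = mate (fst x)"
  by (cases x) (simp add: rotate_germ_def mate_def)

lemma rotate_germs: "x \<in> germs \<Longrightarrow> rotate_germ x \<in> germs"
  using mate_props(1) rotate_fst by (cases x) (auto simp: germs_def mem_Times_iff)

lemma orbit_rotate: "orbit rotate_germ (k, b) = {k, mate k} \<times> UNIV"
proof
  show "orbit rotate_germ (k, b) \<subseteq> {k, mate k} \<times> UNIV"
  proof
    fix x assume "x \<in> orbit rotate_germ (k, b)"
    then show "x \<in> {k, mate k} \<times> UNIV"
    proof induction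
      case base
      then show ?case by (auto simp: mem_Times_iff rotate_fst)
    next
      case (step x)
      then show ?case using mate_props(2) by (auto simp: mem_Times_iff rotate_fst)
    qed
  qed
  have 2: "(k, \<not> b) \<in> orbit rotate_germ (k, b)" for k b
    using orbit.step[OF orbit.base, of rotate_germ "(k, b)"] orbit.base[of rotate_germ "(k, b)"] rotate_twice rotate_dummy
    by metis
  have 4: "(k, b) \<in> orbit rotate_germ (k, b)" for k b
    using 2[of k b] 2[of k "\<not> b"] orbit_trans by fastforce
  obtain c where c: "rotate_germ (k, b) = (mate k, c)" using rotate_fst[of "(k, b)"] by (cases "rotate_germ (k, b)") auto
  have m: "(mate k, c) \<in> orbit rotate_germ (k, b)" using orbit.base[of rotate_germ "(k, b)"] c by simp
  have "(mate k, \<not> c) \<in> orbit rotate_germ (k, b)" using orbit_trans[OF 2 m] .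
  then show "{k, mate k} \<times> UNIV \<subseteq> orbit rotate_germ (k, b)"
    using 2[of k b] 4[of k b] m by (cases b; cases c) (auto, (metis (full_types))+)
qed

lemma bij_rotate: "bij_betw rotate_germ germs germs"
proof (rule bij_betwI[of _ _ _ "\<lambda>x. rotate_germ (rotate_germ (rotate_germ x))"])
  show "rotate_germ (rotate_germ (rotate_germ (rotate_germ x))) = x" for x
  proof (cases x)
    case (Pair k b)
    then show ?thesis by (cases "k < n") (simp_all add: rotate_twice rotate_dummy)
  qed
  then show "rotate_germ (rotate_germ (rotate_germ (rotate_germ x))) = x" for x .
qed (use rotate_germs in auto)

lemma closed_surface_word: "closed_surface word_surface"
  unfolding word_surface_def
proof (rule closed_surface_encoded[OF _ _ bij_rotate])
  show "finite germs" "germs \<noteq> {}" by (auto simp: germs_def)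
  show "reverse_edge a \<in> germs \<and> reverse_edge a \<noteq> a \<and> reverse_edge (reverse_edge a) = a" if "a \<in> germs" for a
  proof -
    obtain N where N: "n = N" by simp
    show ?thesis using that unfolding germs_def reverse_edge_def N by (cases a) auto
  qed
  let ?R = "\<lambda>x y. x \<in> germs \<and> (y = rotate_germ x \<or> y = reverse_edge x)"
  have turn: "?R\<^sup>*\<^sup>* (k, b) (k, c)" if "k \<le> n" for k b c
  proof (cases "b = c")
    case False
    have "(k, b) \<in> germs" using that by (simp add: germs_def)
    then have r: "?R (k, b) (rotate_germ (k, b))" "?R (rotate_germ (k, b)) (rotate_germ (rotate_germ (k, b)))"
      using rotate_germs by blast+
    have "?R\<^sup>*\<^sup>* (k, b) (rotate_germ (k, b))" by (rule r_into_rtranclp) (rule r(1))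
    moreover have "?R\<^sup>*\<^sup>* (k, b) (rotate_germ (rotate_germ (k, b)))"
      by (rule rtranclp.rtrancl_into_rtrancl) (rule calculation, rule r(2))
    ultimately show ?thesis using False by (cases "k < n") (simp_all add: rotate_twice rotate_dummy)
  qed simp
  have next_edge: "?R\<^sup>*\<^sup>* (k, b) (if k = n then 0 else Suc k, c)" if "k \<le> n" for k b c
  proof -
    have R: "?R (k, True) (if k = n then 0 else Suc k, False)" using that by (simp add: germs_def reverse_edge_def)
    have le: "(if k = n then 0 else Suc k) \<le> n" using that by simp
    have "?R\<^sup>*\<^sup>* (k, b) (if k = n then 0 else Suc k, False)"
      by (rule rtranclp.rtrancl_into_rtrancl) (rule turn[OF that], rule R)
    then show ?thesis by (rule rtranclp_trans) (rule turn[OF le])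
  qed
  have up: "?R\<^sup>*\<^sup>* (k, b) (k + m, c)" if "k + m \<le> n" for k m b c
    using that
  proof (induction m arbitrary: c)
    case 0
    then show ?case using turn[of k b c] by simp
  next
    case (Suc m)
    have "?R\<^sup>*\<^sup>* (k, b) (k + m, True)" using Suc by simp
    moreover have "?R\<^sup>*\<^sup>* (k + m, True) (k + Suc m, c)" using next_edge[of "k + m" True c] Suc(2) by simp
    ultimately show ?case by (rule rtranclp_trans)
  qed
  show "?R\<^sup>*\<^sup>* a b" if "a \<in> germs" "b \<in> germs" for a b
  proof -
    obtain k b1 l b2 where ab: "a = (k, b1)" "b = (l, b2)" "k \<le> n" "l \<le> n"
      using \<open>a \<in> germs\<close> \<open>b \<in> germs\<close> unfolding germs_def by fastforce
    have "?R\<^sup>*\<^sup>* (k, b1) (n, True)" using up[of k "n - k" b1 True] ab by simp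
    also have "?R\<^sup>*\<^sup>* (n, True) (0, True)" using next_edge[of n True True] by simp
    also have "?R\<^sup>*\<^sup>* (0, True) (l, b2)" using up[of 0 l True b2] ab by simp
    finally show ?thesis unfolding ab .
  qed
qed

lemma length_word_curve [simp]: "length word_curve = Suc n"
  by (simp add: word_curve_def)

lemma word_curve_nth: "j \<le> n \<Longrightarrow> word_curve ! j = to_nat (if j = 0 then n else j - 1, True)"
  unfolding word_curve_def by (subst nth_map) (auto simp del: upt_Suc)

lemma word_germs:
  assumes "j \<le> n"
  shows "out_dart word_curve j = to_nat (j, True)" "in_dart word_surface word_curve j = to_nat (j, False)"
proof -
  show "out_dart word_curve j = to_nat (j, True)"
    using assms by (cases "j = n") (simp_all add: out_dart_def word_curve_nth)
  have "(if j = 0 then n else j - 1, True) \<in> germs" using assms by (auto simp: germs_def)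
  then show "in_dart word_surface word_curve j = to_nat (j, False)"
    using assms by (cases j) (auto simp add: in_dart_def word_curve_nth word_surface_def reverse_edge_def)
qed

lemma vertex_word:
  fixes b c :: bool
  assumes "j \<le> n" "l \<le> n"
  shows "vertex word_surface (to_nat (j, b)) = vertex word_surface (to_nat (l, c)) \<longleftrightarrow> l = j \<or> l = mate j"
proof -
  have "(j, b) \<in> germs" "(l, c) \<in> germs" using assms by (auto simp: germs_def)
  then have "vertex word_surface (to_nat (j, b)) = vertex word_surface (to_nat (l, c)) \<longleftrightarrow> {j, mate j} = {l, mate l}"
    unfolding word_surface_def
    by (subst vertex_encoded_eq_iff) (use rotate_germs in \<open>auto simp: orbit_rotate times_eq_iff\<close>)
  then show ?thesis using mate_props(2)[of l] mate_props(2)[of j] by (auto simp: doubleton_eq_iff)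
qed

lemma crossing_passages_word: "crossing_passages word_surface word_curve = [0..<n]"
proof -
  have "(\<exists>l<Suc n. l \<noteq> k \<and> vertex word_surface (out_dart word_curve l) = vertex word_surface (out_dart word_curve k))
      \<longleftrightarrow> k < n" if kn: "k \<le> n" for k
  proof
    assume "k < n"
    then show "\<exists>l<Suc n. l \<noteq> k \<and> vertex word_surface (out_dart word_curve l) = vertex word_surface (out_dart word_curve k)"
      using mate_props[of k] by (intro exI[of _ "mate k"]) (simp add: word_germs vertex_word)
  next
    assume "\<exists>l<Suc n. l \<noteq> k \<and> vertex word_surface (out_dart word_curve l) = vertex word_surface (out_dart word_curve k)"
    then obtain l where l: "l \<le> n" "l \<noteq> k" "k = l \<or> k = mate l"
      using kn by (auto simp: less_Suc_eq_le word_germs vertex_word)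
    then show "k < n" using mate_props(3)[of l] by (cases "l < n") (auto simp: mate_def)
  qed
  then show ?thesis unfolding crossing_passages_def length_word_curve
    by (auto simp: filter_empty_conv cong: filter_cong)
qed

lemma curve_diagram_word: "curve_diagram word_surface word_curve w"
proof -
  have curve: "closed_curve word_surface word_curve"
    unfolding closed_curve_def length_word_curve
  proof (intro conjI allI impI ballI)
    show "word_curve \<noteq> []" using length_word_curve by fastforce
    show "set word_curve \<subseteq> darts word_surface"
      by (auto simp: word_curve_def word_surface_def germs_def)
    show "distinct word_curve"
      unfolding word_curve_def distinct_map
      by (auto simp: inj_on_def split: if_splits simp del: length_greater_0_conv)
    show "vertex word_surface (in_dart word_surface word_curve k) = vertex word_surface (out_dart word_curve k)"
      if "k < Suc n" for k using that by (simp add: word_germs vertex_word)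
    show "flip word_surface d \<notin> set word_curve" if "d \<in> set word_curve" for d
    proof -
      obtain j where j: "j \<in> set [0..<Suc n]" "d = to_nat (if j = 0 then n else j - 1, True)"
        using \<open>d \<in> set word_curve\<close> unfolding word_curve_def set_map by blast
      define k where "k = (if j = 0 then n else j - 1)"
      have "(k, True) \<in> germs" using j(1) by (auto simp: germs_def k_def)
      then have "flip word_surface d = to_nat (if k = n then 0 else Suc k, False)"
        unfolding j(2) k_def[symmetric] by (simp add: word_surface_def reverse_edge_def)
      then show ?thesis by (auto simp: word_curve_def)
    qed
  qed
  have trans: "transversal word_surface word_curve i j (orientation (w ! i))"
    if ij: "i < j" "j < n" "w ! i = w ! j" for i j
  proof -
    have i: "i < n" using ij by simp
    have p: "partner w i = j" "partner w j = i" using partner_props(6)[OF i ij(2)] partner_props(2)[OF i] ij by auto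
    have fs: "first_pos w (w ! i) = i"
      by (rule gauss_word_pos_eqI(1)[OF gauss ij(1,2) refl]) (rule ij(3)[symmetric])
    have s: "frame_sign w i = orientation (w ! i)" "frame_sign w j = - orientation (w ! i)"
      using fs ij(1) by (simp_all add: frame_sign_def flip: ij(3))
    have rot: "rot word_surface (to_nat (k, b)) = to_nat (rotate_germ (k, b))" if "k < n" for k b
      using that by (simp add: word_surface_def germs_def)
    show ?thesis
      using orientation_cases[of "w ! i"] i ij(2)
      by (auto simp: transversal_def Let_def word_germs rot rotate_germ_def p s)
  qed
  have eq: "w ! i = w ! j \<longleftrightarrow> vertex word_surface (out_dart word_curve i) = vertex word_surface (out_dart word_curve j)"
    if "i < j" "j < n" for i j
    using partner_props(6)[of i j] that by (auto simp: word_germs vertex_word mate_def)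
  show ?thesis unfolding curve_diagram_def crossing_passages_word Let_def
    using closed_surface_word curve gauss trans eq by simp
qed

end

lemma ex_surface_realization: "gauss_word w \<Longrightarrow> \<exists>S ds. curve_diagram S ds w"
  using gauss.curve_diagram_word gauss.intro by blast

section \<open>The polynomial of a long virtual knot is well defined\<close>

lemma long_virtual_knotE:
  assumes "K \<in> long_virtual_knots"
  obtains D where "D \<in> K" "long_diagram D" "\<And>D'. D' \<in> K \<Longrightarrow> long_diagram D' \<and> equivclp move_step D D'"
proof -
  obtain D where D: "long_diagram D" "K = diagram_equiv `` {D}"
    using assms unfolding long_virtual_knots_def quotient_def by blast
  then show thesis by (intro that[of D]) (auto simp: diagram_equiv_def)
qed

text \<open>The description in \<open>G_poly\<close> is proper for two reasons: all realizations of
  all diagrams in \<open>K\<close> give the same value, and at least one realization exists. Without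
  the latter every polynomial would satisfy the description.\<close>

lemma G_poly_eq_G_word:
  assumes K: "K \<in> long_virtual_knots" and D: "D \<in> K"
  shows "G_poly a a K = G_word a (filter is_real D)"
proof -
  obtain E where E: "E \<in> K" "long_diagram E" "\<And>D'. D' \<in> K \<Longrightarrow> long_diagram D' \<and> equivclp move_step E D'"
    using long_virtual_knotE[OF K] by blast
  have eq: "G_word a (filter is_real D') = G_word a (filter is_real E)" if "D' \<in> K" for D'
    by (rule G_word_equiv[symmetric]) (use E(3)[OF that] in simp)
  obtain S ds where S: "curve_diagram S ds (filter is_real E)"
    using ex_surface_realization gauss_word_filter long_diagram_gauss_word[OF E(2)] by blast
  have real: "G_real a a S ds w = G_word a (filter is_real E)" if "knot_realization S ds w K" for S ds w
    using that eq diagram.G_real_word[OF diagram.intro]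
    by (auto simp: knot_realization_def surface_realization_def)
  have "knot_realization S ds (filter is_real E) K"
    using S E(1) by (auto simp: knot_realization_def surface_realization_def)
  then have "G_poly a a K = G_word a (filter is_real E)"
    unfolding G_poly_def using real by (intro the_equality) (blast, metis)
  then show ?thesis using eq[OF D] by simp
qed

lemma G_poly_double_root:
  assumes "K \<in> long_virtual_knots"
  shows "laurent_eval (G_poly a a K) (1 :: rat) = 0" "laurent_eval (laurent_deriv (G_poly a a K)) (1 :: rat) = 0"
proof -
  obtain D where D: "D \<in> K" "long_diagram D" using long_virtual_knotE[OF assms] by blast
  obtain S ds where S: "curve_diagram S ds (filter is_real D)"
    using ex_surface_realization gauss_word_filter long_diagram_gauss_word[OF D(2)] by blast
  show "laurent_eval (G_poly a a K) (1 :: rat) = 0" "laurent_eval (laurent_deriv (G_poly a a K)) (1 :: rat) = 0"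
    unfolding laurent_eval_deriv_1 G_poly_eq_G_word[OF assms D(1)]
    using diagram.G_word_double_root[OF diagram.intro[OF S]] by (simp_all add: laurent_eval_1)
qed

section \<open>Square grids on the torus and on the sphere\<close>

lemma orbit_period:
  assumes "f ` A \<subseteq> A" "\<And>a. a \<in> A \<Longrightarrow> (f ^^ k) a = a" "0 < k" "a \<in> A"
  shows "a \<in> orbit f a" "orbit f a \<subseteq> A" "b \<in> orbit f a \<Longrightarrow> orbit f b = orbit f a"
proof -
  show self: "a \<in> orbit f a" using assms(2)[OF assms(4)] assms(3) by (force simp: orbit_altdef)
  show "orbit f a \<subseteq> A"
  proof
    fix x assume "x \<in> orbit f a"
    then show "x \<in> A" by induction (use assms in auto)
  qed
  show "orbit f b = orbit f a" if b: "b \<in> orbit f a"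
    using orbit_swap[OF self b] b orbit_trans by (metis subsetI subset_antisym)
qed

lemma card_orbits_uniform:
  assumes A: "finite A" "f ` A \<subseteq> A" and k: "\<And>a. a \<in> A \<Longrightarrow> (f ^^ k) a = a" "0 < k"
    and card: "\<And>a. a \<in> A \<Longrightarrow> card (orbit f a) = k"
  shows "k * card (orbit f ` A) = card A"
proof -
  note o = orbit_period[OF A(2) k]
  have U: "\<Union> (orbit f ` A) = A" using o(1,2) by blast
  have "k * card (orbit f ` A) = card (\<Union> (orbit f ` A))"
  proof (rule card_partition)
    show "finite (orbit f ` A)" "finite (\<Union> (orbit f ` A))" using A unfolding U by simp_all
    show "card c = k" if "c \<in> orbit f ` A" for c using that card by auto
    show "c1 \<inter> c2 = {}" if "c1 \<in> orbit f ` A" "c2 \<in> orbit f ` A" "c1 \<noteq> c2" for c1 c2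
      using that o(3) by blast
  qed
  then show ?thesis by (simp only: U)
qed

lemma card_orbit_2: "f (f a) = a \<Longrightarrow> f a \<noteq> a \<Longrightarrow> card (orbit f a) = 2"
proof -
  assume f: "f (f a) = a" "f a \<noteq> a"
  have "orbit f a = {(f ^^ m) a | m. m < 2}"
    by (rule orbit_altdef_bounded) (simp_all add: f numeral_2_eq_2)
  also have "\<dots> = {a, f a}"
    by (auto simp: less_Suc_eq numeral_2_eq_2 intro: exI[of _ 0] exI[of _ 1])
  finally show ?thesis using f(2) by simp
qed

lemma card_orbit_4:
  assumes f: "f (f (f (f a))) = a" "f (f a) \<noteq> a"
  shows "card (orbit f a) = 4"
proof -
  have "orbit f a = {(f ^^ m) a | m. m < 4}"
    by (rule orbit_altdef_bounded) (simp_all add: f numeral_eq_Suc)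
  also have "\<dots> = (\<lambda>m. (f ^^ m) a) ` {..<4}" by blast
  also have "{..<4::nat} = {0, 1, 2, 3}" by auto
  also have "(\<lambda>m. (f ^^ m) a) ` {0, 1, 2, 3} = {a, f a, f (f a), f (f (f a))}" by (simp add: numeral_eq_Suc)
  finally have o: "orbit f a = {a, f a, f (f a), f (f (f a))}" .
  have "f a \<noteq> a" "f (f (f a)) \<noteq> a" "f (f a) \<noteq> f a" "f (f (f a)) \<noteq> f a" "f (f (f a)) \<noteq> f (f a)"
    using f by metis+
  then show ?thesis unfolding o using f(2) by (auto simp: card_insert_if)
qed

text \<open>All orbits have four or two elements, and weighting every orbit by 4 counts the elements
  of the short ones twice. This is meant for the faces of a grid, which are squares except for a few
  bigons.\<close>

lemma card_orbits_4_2: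
  assumes A: "finite A" "f ` A \<subseteq> A" and f: "\<And>a. a \<in> A \<Longrightarrow> f (f (f (f a))) = a" "\<And>a. a \<in> A \<Longrightarrow> f a \<noteq> a"
  shows "4 * card (orbit f ` A) = card A + card {a \<in> A. f (f a) = a}"
proof -
  define B C where "B = {a \<in> A. f (f a) = a}" and "C = {a \<in> A. f (f a) \<noteq> a}"
  have sub: "finite B" "finite C" "B \<union> C = A" "B \<inter> C = {}" using A by (auto simp: B_def C_def)
  have fB: "f ` B \<subseteq> B" using A by (auto simp: B_def)
  have fC: "f ` C \<subseteq> C"
  proof clarify
    fix a assume a: "a \<in> C"
    have "f (f (f a)) \<noteq> f a"
    proof
      assume "f (f (f a)) = f a"
      then have "f (f (f (f (f (f a))))) = f (f (f (f a)))" by simp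
      then show False using f(1) a A by (auto simp: C_def image_subset_iff)
    qed
    then show "f a \<in> C" using a A by (auto simp: C_def)
  qed
  have 2: "(f ^^ 2) a = a" if "a \<in> B" for a using that by (simp add: B_def numeral_2_eq_2)
  have 4: "(f ^^ 4) a = a" if "a \<in> C" for a using that f by (simp add: C_def numeral_eq_Suc)
  have B: "2 * card (orbit f ` B) = card B"
    by (rule card_orbits_uniform[OF sub(1) fB 2]) (use f in \<open>auto simp: B_def intro: card_orbit_2\<close>)
  have C: "4 * card (orbit f ` C) = card C"
    by (rule card_orbits_uniform[OF sub(2) fC 4]) (use f in \<open>auto simp: C_def intro!: card_orbit_4\<close>)
  have "orbit f b \<noteq> orbit f c" if "b \<in> B" "c \<in> C" for b c
    using orbit_period(1,2)[OF fB 2, of b] orbit_period(1,2)[OF fC 4, of c] that sub(4) by auto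
  then have disj: "orbit f ` B \<inter> orbit f ` C = {}" by blast
  have "card (orbit f ` A) = card (orbit f ` B) + card (orbit f ` C)"
    unfolding sub(3)[symmetric] image_Un using disj sub by (intro card_Un_disjoint) auto
  moreover have "card A = card B + card C"
    unfolding sub(3)[symmetric] using sub by (intro card_Un_disjoint) auto
  ultimately show ?thesis using B C by (simp add: B_def)
qed

lemma num_orbits_encoded:
  fixes A :: "'a::countable set"
  assumes "f ` A \<subseteq> A"
  shows "num_orbits (encoded_perm A f) (to_nat ` A) = card (orbit f ` A)"
proof -
  have "orbit (encoded_perm A f) ` to_nat ` A = (`) to_nat ` orbit f ` A"
    using orbit_encoded_perm(1)[OF assms] by (auto simp: image_image)
  moreover have "inj_on ((`) to_nat) (orbit f ` A)" by (simp add: inj_on_def inj_image_eq_iff)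
  ultimately show ?thesis by (simp add: num_orbits_def card_image)
qed

lemma euler_characteristic_encoded:
  fixes A :: "'a::countable set"
  assumes "r ` A \<subseteq> A" "f ` A \<subseteq> A"
  shows "euler_characteristic (encoded_surface A r f) =
    int (card (orbit r ` A)) - int (card (orbit f ` A)) + int (card (orbit (r \<circ> f) ` A))"
proof -
  have "encoded_perm A r \<circ> encoded_perm A f = encoded_perm A (r \<circ> f)"
    using assms by (auto simp: encoded_perm_def fun_eq_iff)
  then show ?thesis using assms
    by (simp add: euler_characteristic_def num_orbits_encoded image_subset_iff)
qed

type_synonym grid_dart = "(int \<times> int) \<times> int"

definition grid_darts :: "int \<Rightarrow> int \<Rightarrow> grid_dart set" where
  "grid_darts P Q = ({0..<P} \<times> {0..<Q}) \<times> {0..<4}"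

definition turn :: "grid_dart \<Rightarrow> grid_dart" where
  "turn = (\<lambda>(v, d). (v, (d + 1) mod 4))"

text \<open>
  The directions 0, 1, 2, 3 are right, up, left and down.  Columns are always cyclic.  Rows are cyclic
  on the torus, whereas on the sphere the edges leaving the top (and those leaving the bottom) row are
  identified in pairs by folding that boundary circle.
\<close>

definition across :: "bool \<Rightarrow> int \<Rightarrow> int \<Rightarrow> grid_dart \<Rightarrow> grid_dart" where
  "across sph P Q = (\<lambda>((x, y), d).
     if d = 0 then ((if x = P - 1 then 0 else x + 1, y), 2)
     else if d = 2 then ((if x = 0 then P - 1 else x - 1, y), 0)
     else if d = 1 then
       (if y = Q - 1 then (if sph then ((P - 1 - x, y), 1) else ((x, 0), 3)) else ((x, y + 1), 3))
     else (if y = 0 then (if sph then ((P - 1 - x, y), 3) else ((x, Q - 1), 1)) else ((x, y - 1), 1)))"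

definition grid_surface :: "bool \<Rightarrow> int \<Rightarrow> int \<Rightarrow> surface" where
  "grid_surface sph P Q = encoded_surface (grid_darts P Q) turn (across sph P Q)"

lemma turn_simps [simp]: "turn (v, 0) = (v, 1)" "turn (v, 1) = (v, 2)" "turn (v, 2) = (v, 3)" "turn (v, 3) = (v, 0)"
  by (simp_all add: turn_def)

definition face_right :: "bool \<Rightarrow> int \<Rightarrow> int \<Rightarrow> grid_dart \<Rightarrow> grid_dart" where
  "face_right sph P Q a = turn (across sph P Q a)"

lemma face_simps:
  "face_right sph P Q ((x, y), 0) = ((if x = P - 1 then 0 else x + 1, y), 3)"
  "face_right sph P Q ((x, y), 1) =
     (if y = Q - 1 then (if sph then ((P - 1 - x, y), 2) else ((x, 0), 0)) else ((x, y + 1), 0))"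
  "face_right sph P Q ((x, y), 2) = ((if x = 0 then P - 1 else x - 1, y), 1)"
  "face_right sph P Q ((x, y), 3) =
     (if y = 0 then (if sph then ((P - 1 - x, y), 0) else ((x, Q - 1), 2)) else ((x, y - 1), 2))"
  by (simp_all add: face_right_def across_def)

locale grid =
  fixes sph :: bool and P Q :: int
  assumes P: "2 \<le> P" and Q: "1 \<le> Q" and even: "sph \<Longrightarrow> even P"
begin

abbreviation "A \<equiv> grid_darts P Q"
abbreviation "flp \<equiv> across sph P Q"

lemma direction_cases: "(v, d) \<in> A \<Longrightarrow> d = 0 \<or> d = 1 \<or> d = 2 \<or> d = 3"
  by (auto simp: grid_darts_def)

lemma finite_A: "finite A" and card_A: "card A = 4 * nat P * nat Q" and A_nonempty: "((0, 0), 0) \<in> A"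
  using P Q by (auto simp: grid_darts_def card_cartesian_product)

lemma turn_A: "turn ` A \<subseteq> A"
  by (auto simp: turn_def grid_darts_def)

lemma turn_4: "a \<in> A \<Longrightarrow> turn (turn (turn (turn a))) = a" "a \<in> A \<Longrightarrow> turn (turn a) \<noteq> a" "a \<in> A \<Longrightarrow> turn a \<noteq> a"
  using direction_cases by (cases a; force)+

lemma across_A: "flp ` A \<subseteq> A"
  using P Q by (auto simp: across_def grid_darts_def split: if_splits)

lemma across_across: "a \<in> A \<Longrightarrow> flp (flp a) = a" "a \<in> A \<Longrightarrow> flp a \<noteq> a"
proof -
  assume a: "a \<in> A"
  obtain x y d where xyd: "a = ((x, y), d)" by (metis surj_pair)
  \<comment> \<open>As \<open>P\<close> is even, the fold fixes no column; otherwise an edge would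
    be identified with itself and \<open>flip\<close> would have a fixed point.\<close>
  have "P - 1 - x \<noteq> x" if sph
  proof
    assume "P - 1 - x = x"
    then have "P = 2 * x + 1" by simp
    then show False using even that by simp
  qed
  then show "flp (flp a) = a" "flp a \<noteq> a"
    using a direction_cases[of "(x, y)" d] unfolding xyd
    by (auto simp: across_def grid_darts_def)
qed

lemma bij_turn: "bij_betw turn A A"
  by (rule bij_betwI[of _ _ _ "\<lambda>a. turn (turn (turn a))"]) (use turn_A turn_4 in \<open>auto simp: image_subset_iff\<close>)

lemma closed_surface_grid: "closed_surface (grid_surface sph P Q)"
  unfolding grid_surface_def
proof (rule closed_surface_encoded[OF finite_A _ bij_turn])
  show "A \<noteq> {}" using A_nonempty by auto
  show "flp a \<in> A \<and> flp a \<noteq> a \<and> flp (flp a) = a" if "a \<in> A" for a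
    using that across_A across_across by auto
  let ?R = "\<lambda>x y. x \<in> A \<and> (y = turn x \<or> y = flp x)"
  have turns: "?R\<^sup>*\<^sup>* (v, d) (v, e)" if "(v, d) \<in> A" "(v, e) \<in> A" for v d e
  proof -
    have t: "?R\<^sup>*\<^sup>* a (turn a)" if "a \<in> A" for a using that by auto
    have tA: "turn a \<in> A" if "a \<in> A" for a using that turn_A by auto
    let ?a = "(v, d)"
    have 1: "?R\<^sup>*\<^sup>* ?a (turn ?a)" by (rule t[OF that(1)])
    have 2: "?R\<^sup>*\<^sup>* ?a (turn (turn ?a))" by (rule rtranclp_trans[OF 1 t]) (use tA that in auto)
    have 3: "?R\<^sup>*\<^sup>* ?a (turn (turn (turn ?a)))" by (rule rtranclp_trans[OF 2 t]) (use tA that in auto)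
    have "(v, e) \<in> {?a, turn ?a, turn (turn ?a), turn (turn (turn ?a))}"
      using direction_cases[OF that(1)] direction_cases[OF that(2)] by auto
    then show ?thesis using 1 2 3 by auto
  qed
  have move: "?R\<^sup>*\<^sup>* (v, d) (v', d')"
    if "(v, d) \<in> A" "(v', d') \<in> A" "(v, e) \<in> A" "flp (v, e) = (v', e')" for v d v' d' e e'
  proof -
    have "(v', e') \<in> A" using that across_A by (metis image_subset_iff)
    then have "?R\<^sup>*\<^sup>* (v', e') (v', d')" using turns that by blast
    moreover have "?R\<^sup>*\<^sup>* (v, d) (v, e)" using turns that by blast
    moreover have "?R\<^sup>*\<^sup>* (v, e) (v', e')" using that by (intro r_into_rtranclp) auto
    ultimately show ?thesis by (meson rtranclp_trans)
  qed
  have A_iff: "((x, y), d) \<in> A \<longleftrightarrow> 0 \<le> x \<and> x < P \<and> 0 \<le> y \<and> y < Q \<and> 0 \<le> d \<and> d < 4" for x y d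
    by (auto simp: grid_darts_def)
  have right: "?R\<^sup>*\<^sup>* ((0, y), 0) ((int k, y), 0)" and left: "?R\<^sup>*\<^sup>* ((int k, y), 0) ((0, y), 0)"
    if "int k < P" "0 \<le> y" "y < Q" for k y
  proof -
    show "?R\<^sup>*\<^sup>* ((0, y), 0) ((int k, y), 0)" using that
    proof (induction k)
      case (Suc k)
      have "?R\<^sup>*\<^sup>* ((int k, y), 0) ((int (Suc k), y), 0)"
        by (rule move[where e=0 and e'=2]) (use Suc in \<open>auto simp: A_iff across_def\<close>)
      then show ?case using Suc by (auto intro: rtranclp_trans)
    qed simp
    show "?R\<^sup>*\<^sup>* ((int k, y), 0) ((0, y), 0)" using that
    proof (induction k)
      case (Suc k)
      have "?R\<^sup>*\<^sup>* ((int (Suc k), y), 0) ((int k, y), 0)"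
        by (rule move[where e=2 and e'=0]) (use Suc in \<open>auto simp: A_iff across_def\<close>)
      then show ?case using Suc by (auto intro: rtranclp_trans)
    qed simp
  qed
  have up: "?R\<^sup>*\<^sup>* ((0, 0), 0) ((0, int k), 0)" and down: "?R\<^sup>*\<^sup>* ((0, int k), 0) ((0, 0), 0)"
    if "int k < Q" for k
  proof -
    show "?R\<^sup>*\<^sup>* ((0, 0), 0) ((0, int k), 0)" using that
    proof (induction k)
      case (Suc k)
      have "?R\<^sup>*\<^sup>* ((0, int k), 0) ((0, int (Suc k)), 0)"
        by (rule move[where e=1 and e'=3]) (use Suc P in \<open>auto simp: A_iff across_def\<close>)
      then show ?case using Suc by (auto intro: rtranclp_trans)
    qed simp
    show "?R\<^sup>*\<^sup>* ((0, int k), 0) ((0, 0), 0)" using that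
    proof (induction k)
      case (Suc k)
      have "?R\<^sup>*\<^sup>* ((0, int (Suc k)), 0) ((0, int k), 0)"
        by (rule move[where e=3 and e'=1]) (use Suc P in \<open>auto simp: A_iff across_def\<close>)
      then show ?case using Suc by (auto intro: rtranclp_trans)
    qed simp
  qed
  show "?R\<^sup>*\<^sup>* a b" if ab: "a \<in> A" "b \<in> A" for a b
  proof -
    have reach0: "?R\<^sup>*\<^sup>* a ((0, 0), 0)" and reached: "?R\<^sup>*\<^sup>* ((0, 0), 0) a" if a: "a \<in> A" for a
    proof -
      obtain x y d where xyd: "a = ((x, y), d)" by (metis surj_pair)
      have b: "int (nat x) < P" "int (nat y) < Q" "int (nat x) = x" "int (nat y) = y" "0 \<le> y" "y < Q"
        using a by (auto simp: xyd A_iff)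
      have t: "?R\<^sup>*\<^sup>* a ((x, y), 0)" "?R\<^sup>*\<^sup>* ((x, y), 0) a"
        unfolding xyd by (rule turns; use a in \<open>auto simp: xyd A_iff\<close>)+
      have "?R\<^sup>*\<^sup>* ((x, y), 0) ((0, y), 0)" "?R\<^sup>*\<^sup>* ((0, y), 0) ((0, 0), 0)"
        "?R\<^sup>*\<^sup>* ((0, 0), 0) ((0, y), 0)" "?R\<^sup>*\<^sup>* ((0, y), 0) ((x, y), 0)"
        using left[of "nat x" y] down[of "nat y"] up[of "nat y"] right[of "nat x" y] b by simp_all
      then show "?R\<^sup>*\<^sup>* a ((0, 0), 0)" "?R\<^sup>*\<^sup>* ((0, 0), 0) a"
        using t by (meson rtranclp_trans)+
    qed
    show ?thesis using reach0[OF ab(1)] reached[OF ab(2)] by (rule rtranclp_trans)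
  qed
qed

abbreviation "face \<equiv> face_right sph P Q"

lemma face_A: "face ` A \<subseteq> A"
  using turn_A across_A by (auto simp: face_right_def)

lemma A_cases:
  assumes "a \<in> A"
  obtains x y d where "a = ((x, y), d)" "0 \<le> x" "x < P" "0 \<le> y" "y < Q" "d = 0 \<or> d = 1 \<or> d = 2 \<or> d = 3"
  using assms direction_cases by (cases a) (auto simp: grid_darts_def)

lemma face_4: "a \<in> A \<Longrightarrow> face (face (face (face a))) = a"
proof (erule A_cases)
  fix x y d :: int
  assume "a = ((x, y), d)" "0 \<le> x" "x < P" "0 \<le> y" "y < Q" "d = 0 \<or> d = 1 \<or> d = 2 \<or> d = 3"
  then show "face (face (face (face a))) = a"
    using P by (elim disjE) (auto simp add: face_simps)
qed

lemma face_neq: "a \<in> A \<Longrightarrow> face a \<noteq> a"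
  by (erule A_cases) (auto simp: face_simps split: if_splits)

text \<open>Bigons arise only where a boundary circle of the sphere is folded. The fold exchanges
  the neighbouring columns P - 1 and 0 and likewise the two middle columns; in both places the
  horizontal edge and the folded vertical edge enclose a bigon. Two bigons on each of the two
  circles have eight darts in all.\<close>

lemma face_face_eq_iff:
  assumes "((x, y), d) \<in> A"
  shows "face (face ((x, y), d)) = ((x, y), d) \<longleftrightarrow> sph \<and>
    (y = 0 \<and> (d = 0 \<and> (x = P - 1 \<or> 2 * x = P - 2) \<or> d = 3 \<and> (x = 0 \<or> 2 * x = P)) \<or>
     y = Q - 1 \<and> (d = 1 \<and> (x = P - 1 \<or> 2 * x = P - 2) \<or> d = 2 \<and> (x = 0 \<or> 2 * x = P)))"
  using assms
proof (rule A_cases)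
  fix x' y' d' :: int
  assume "((x, y), d) = ((x', y'), d')" "0 \<le> x'" "x' < P" "0 \<le> y'" "y' < Q" "d' = 0 \<or> d' = 1 \<or> d' = 2 \<or> d' = 3"
  then have "0 \<le> x" "x < P" "0 \<le> y" "y < Q" "d = 0 \<or> d = 1 \<or> d = 2 \<or> d = 3" by auto
  then show ?thesis using P Q by (elim disjE) (auto simp: face_simps)
qed

text \<open>There are |A|/4 vertices, |A|/2 edges and (|A| + b)/4 faces, where b is the number of
  darts on bigons, so the terms in |A| cancel. This leaves 0 for the torus and 8/4 = 2 for the
  sphere.\<close>

lemma euler_grid: "4 * euler_characteristic (grid_surface sph P Q) = int (card {a \<in> A. face (face a) = a})"
proof -
  have rot: "4 * card (orbit turn ` A) = card A"
  proof -
    have "{a \<in> A. turn (turn a) = a} = {}" using turn_4(2) by blast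
    then show ?thesis using card_orbits_4_2[OF finite_A turn_A turn_4(1,3)] by (simp only: card.empty)
  qed
  have flip: "2 * card (orbit flp ` A) = card A"
    by (rule card_orbits_uniform[OF finite_A across_A])
      (use across_across card_orbit_2[of flp] in \<open>auto simp: numeral_2_eq_2\<close>)
  have f: "turn \<circ> flp = face" by (simp add: fun_eq_iff face_right_def)
  have "4 * card (orbit face ` A) = card A + card {a \<in> A. face (face a) = a}"
    by (rule card_orbits_4_2[OF finite_A face_A face_4 face_neq])
  then have "4 * int (card (orbit face ` A)) = int (card A) + int (card {a \<in> A. face (face a) = a})" by linarith
  moreover have "4 * int (card (orbit turn ` A)) = int (card A)" "2 * int (card (orbit flp ` A)) = int (card A)"
    using rot flip by linarith+
  ultimately show ?thesis
    unfolding grid_surface_def euler_characteristic_encoded[OF turn_A across_A] f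
    by (simp add: algebra_simps)
qed

lemma has_genus_torus: "\<not> sph \<Longrightarrow> has_genus (grid_surface sph P Q) 1"
proof -
  assume "\<not> sph"
  then have e: "{a \<in> A. face (face a) = a} = {}" using face_face_eq_iff by auto
  then show ?thesis using euler_grid[unfolded e] closed_surface_grid by (simp add: has_genus_def)
qed

lemma has_genus_sphere: "sph \<Longrightarrow> has_genus (grid_surface sph P Q) 0"
proof -
  assume sph: sph
  then obtain h where h: "P = 2 * h" using even by (auto elim: evenE)
  then have h1: "1 \<le> h" using P by simp
  have "{a \<in> A. face (face a) = a} = {((2 * h - 1, 0), 0), ((h - 1, 0), 0), ((0, 0), 3), ((h, 0), 3),
      ((2 * h - 1, Q - 1), 1), ((h - 1, Q - 1), 1), ((0, Q - 1), 2), ((h, Q - 1), 2)}" (is "?L = ?R")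
  proof (intro set_eqI)
    fix a :: grid_dart
    obtain x y d where a: "a = ((x, y), d)" by (metis surj_pair)
    have x: "2 * x = P - 2 \<longleftrightarrow> x = h - 1" "2 * x = P \<longleftrightarrow> x = h" by (auto simp: h)
    have R: "a \<in> ?R \<longleftrightarrow> y = 0 \<and> (d = 0 \<and> (x = P - 1 \<or> x = h - 1) \<or> d = 3 \<and> (x = 0 \<or> x = h)) \<or>
        y = Q - 1 \<and> (d = 1 \<and> (x = P - 1 \<or> x = h - 1) \<or> d = 2 \<and> (x = 0 \<or> x = h))"
      unfolding a h by auto
    have "a \<in> A" if "a \<in> ?R"
      using that h1 Q unfolding a grid_darts_def h by auto
    then show "a \<in> ?L \<longleftrightarrow> a \<in> ?R"
      using face_face_eq_iff[of x y d] sph unfolding R unfolding a x by blast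
  qed
  also have "card \<dots> = 8" using h1 Q by (simp add: card_insert_if)
  finally have e: "card {a \<in> A. face (face a) = a} = 8" .
  show ?thesis using euler_grid[unfolded e] closed_surface_grid by (simp add: has_genus_def)
qed

lemma orbit_turn: "(v, d) \<in> A \<Longrightarrow> orbit turn (v, d) = {v} \<times> {0..<4}"
proof -
  assume a: "(v, d) \<in> A"
  have 4: "(turn ^^ 4) b = b" if "b \<in> A" for b using turn_4(1)[OF that] by (simp add: numeral_eq_Suc)
  have "orbit turn (v, d) = (\<lambda>m. (turn ^^ m) (v, d)) ` {..<4}"
    using orbit_altdef_bounded[of 4 turn "(v, d)"] 4[OF a] by auto
  also have "{..<4::nat} = {0, 1, 2, 3}" by auto
  finally have "orbit turn (v, d) = {(v, d), turn (v, d), turn (turn (v, d)), turn (turn (turn (v, d)))}"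
    by (simp add: numeral_eq_Suc)
  also have "\<dots> = {v} \<times> {0, 1, 2, 3}" using direction_cases[OF a] by (elim disjE) auto
  also have "{0, 1, 2, 3} = {0..<4::int}" by auto
  finally show ?thesis .
qed

lemma vertex_grid:
  assumes "(v, d) \<in> A" "(v', d') \<in> A"
  shows "vertex (grid_surface sph P Q) (to_nat (v, d)) = vertex (grid_surface sph P Q) (to_nat (v', d')) \<longleftrightarrow> v = v'"
  unfolding grid_surface_def vertex_encoded_eq_iff[OF turn_A assms] orbit_turn[OF assms(1)] orbit_turn[OF assms(2)]
  by (auto simp: times_eq_iff)

lemma rot_grid: "a \<in> A \<Longrightarrow> rot (grid_surface sph P Q) (to_nat a) = to_nat (turn a)"
  and flip_grid: "a \<in> A \<Longrightarrow> flip (grid_surface sph P Q) (to_nat a) = to_nat (flp a)"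
  by (simp_all add: grid_surface_def)

end

section \<open>Rectilinear closed curves on a grid\<close>

lemma successively_nth: "successively P xs \<Longrightarrow> Suc i < length xs \<Longrightarrow> P (xs ! i) (xs ! Suc i)"
proof (induction xs arbitrary: i)
  case (Cons a xs)
  then show ?case by (cases i; cases xs) (auto simp: successively_Cons)
qed simp

text \<open>The triple \<open>(i, h, t)\<close> is the point after \<open>t\<close> steps on the
  \<open>i\<close>-th vertical (\<open>h\<close> false) or horizontal (\<open>h\<close> true)
  segment. The endpoint of a segment is counted as the start of the next one, so
  \<open>t = 0\<close> marks exactly the corners.\<close>

type_synonym curve_point = "nat \<times> bool \<times> nat"

text \<open>
  A closed rectilinear curve, given by lifts to the plane: the \<open>i\<close>-th vertical segment runs in column
  \<open>x i\<close> from height \<open>y i\<close> to \<open>y (Suc i)\<close>, and the \<open>i\<close>-th horizontal segment runs in row \<open>y (Suc i)\<close>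
  from \<open>x i\<close> to \<open>x (Suc i)\<close>.  If the columns and the rows are pairwise different and no segment closes
  up, then all double points are transversal crossings of a vertical and a horizontal segment.
\<close>

locale drawing = grid +
  fixes r :: nat and x y :: "nat \<Rightarrow> int"
  assumes r: "0 < r"
    and columns: "i < r \<Longrightarrow> j < r \<Longrightarrow> x i mod P = x j mod P \<Longrightarrow> i = j"
    and rows: "i < r \<Longrightarrow> j < r \<Longrightarrow> y (Suc i) mod Q = y (Suc j) mod Q \<Longrightarrow> i = j"
    and closing: "x r mod P = x 0 mod P" "y r mod Q = y 0 mod Q"
    and horizontal: "i < r \<Longrightarrow> x i \<noteq> x (Suc i) \<and> \<bar>x (Suc i) - x i\<bar> < P"
    and vertical: "i < r \<Longrightarrow> y i \<noteq> y (Suc i) \<and> \<bar>y (Suc i) - y i\<bar> < Q"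
    and bounded: "sph \<Longrightarrow> i \<le> r \<Longrightarrow> 0 \<le> y i \<and> y i < Q"
begin

definition seg_length :: "nat \<Rightarrow> bool \<Rightarrow> nat" where
  "seg_length i h = (if h then nat \<bar>x (Suc i) - x i\<bar> else nat \<bar>y (Suc i) - y i\<bar>)"

definition valid :: "curve_point \<Rightarrow> bool" where
  "valid = (\<lambda>(i, h, t). i < r \<and> t < seg_length i h)"

definition loc :: "curve_point \<Rightarrow> int \<times> int" where
  "loc = (\<lambda>(i, h, t). if h then (x i + int t * sgn (x (Suc i) - x i), y (Suc i))
     else (x i, y i + int t * sgn (y (Suc i) - y i)))"

definition dir :: "curve_point \<Rightarrow> int" where
  "dir = (\<lambda>(i, h, t). if h then (if x i < x (Suc i) then 0 else 2) else (if y i < y (Suc i) then 1 else 3))"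

definition proj :: "int \<times> int \<Rightarrow> int \<times> int" where
  "proj = (\<lambda>(a, b). (a mod P, b mod Q))"

definition point :: "curve_point \<Rightarrow> int \<times> int" where
  "point s = proj (loc s)"

definition dart :: "curve_point \<Rightarrow> grid_dart" where
  "dart s = (point s, dir s)"

definition next_point :: "curve_point \<Rightarrow> curve_point" where
  "next_point = (\<lambda>(i, h, t). if Suc t < seg_length i h then (i, h, Suc t)
     else if \<not> h then (i, True, 0) else (Suc i mod r, False, 0))"

definition curve_points :: "curve_point list" where
  "curve_points = concat (map (\<lambda>i. map (\<lambda>t. (i, False, t)) [0..<seg_length i False] @
     map (\<lambda>t. (i, True, t)) [0..<seg_length i True]) [0..<r])"

definition darts_list :: "nat list" where
  "darts_list = map (\<lambda>s. to_nat (dart s)) curve_points"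

lemma seg_length_pos: "i < r \<Longrightarrow> 0 < seg_length i h"
  using horizontal[of i] vertical[of i] by (auto simp: seg_length_def)

lemma set_curve_points: "set curve_points = {s. valid s}"
proof (intro set_eqI)
  fix s :: curve_point
  obtain i h t where s: "s = (i, h, t)" by (metis surj_pair)
  show "s \<in> set curve_points \<longleftrightarrow> s \<in> {s. valid s}"
    unfolding s by (cases h) (auto simp: curve_points_def valid_def image_iff)
qed

lemma distinct_curve_points: "distinct curve_points"
proof -
  have "distinct (concat (map (\<lambda>i. map (\<lambda>t. (i, False, t)) [0..<seg_length i False] @
     map (\<lambda>t. (i, True, t)) [0..<seg_length i True]) [0..<m]))" for m
    by (induction m) (auto simp: distinct_map inj_on_def)
  then show ?thesis by (simp only: curve_points_def)
qed

lemma curve_points_chain: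
  "successively (\<lambda>a b. b = next_point a) curve_points" "curve_points \<noteq> []"
  "hd curve_points = (0, False, 0)" "next_point (last curve_points) = (0, False, 0)"
proof -
  define block where "block i = map (\<lambda>t. (i, False, t)) [0..<seg_length i False] @
     map (\<lambda>t. (i, True, t)) [0..<seg_length i True]" for i :: nat
  have run: "successively (\<lambda>a b. b = next_point a) (map (\<lambda>t. (i, h, t)) [0..<m])" if "m \<le> seg_length i h" for i h m
    using that
  proof (induction m)
    case (Suc m)
    then show ?case by (cases m) (auto simp: successively_append_iff last_map next_point_def)
  qed simp
  have ends: "seg_length i False \<noteq> 0" "seg_length i True \<noteq> 0" if "i < r" for i
    using seg_length_pos that by auto
  have hd_run: "hd (map (\<lambda>t. (i, h, t)) [0..<m]) = (i, h, 0)" if "m \<noteq> 0" for i :: nat and h :: bool and m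
    using that by (simp add: hd_map upt_rec)
  have last_run: "last (map (\<lambda>t. (i, h, t)) [0..<m]) = (i, h, m - 1)" if "m \<noteq> 0" for i :: nat and h :: bool and m
    using that by (simp add: last_map)
  have block: "successively (\<lambda>a b. b = next_point a) (block i)" "block i \<noteq> []" "hd (block i) = (i, False, 0)"
    "last (block i) = (i, True, seg_length i True - 1)" if i: "i < r" for i
    using ends[OF i] run[of "seg_length i False" i False] run[of "seg_length i True" i True]
    by (auto simp: block_def successively_append_iff hd_run last_run next_point_def hd_append last_append)
  have "successively (\<lambda>a b. b = next_point a) (concat (map block [0..<m])) \<and>
      (m \<noteq> 0 \<longrightarrow> concat (map block [0..<m]) \<noteq> [] \<and> hd (concat (map block [0..<m])) = (0, False, 0) \<and>
        last (concat (map block [0..<m])) = (m - 1, True, seg_length (m - 1) True - 1))" if "m \<le> r" for m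
    using that
  proof (induction m)
    case (Suc m)
    have m: "m < r" using Suc(2) by simp
    note b = block[OF m]
    show ?case
    proof (cases "m = 0")
      case True
      then show ?thesis using b by simp
    next
      case False
      have "next_point (m - 1, True, seg_length (m - 1) True - 1) = (m, False, 0)"
        using False m ends[of "m - 1"] by (simp add: next_point_def)
      then show ?thesis using Suc False b by (simp add: successively_append_iff hd_append last_append)
    qed
  qed simp
  from this[of r] have all: "successively (\<lambda>a b. b = next_point a) curve_points" "curve_points \<noteq> []"
    "hd curve_points = (0, False, 0)" "last curve_points = (r - 1, True, seg_length (r - 1) True - 1)"
    using r by (auto simp: curve_points_def block_def[abs_def])
  then show "successively (\<lambda>a b. b = next_point a) curve_points" "curve_points \<noteq> []"
    "hd curve_points = (0, False, 0)" by auto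
  show "next_point (last curve_points) = (0, False, 0)"
    unfolding all(4) using r ends[of "r - 1"] by (simp add: next_point_def)
qed

lemma curve_points_next:
  assumes "k < length curve_points"
  shows "curve_points ! (Suc k mod length curve_points) = next_point (curve_points ! k)"
proof (cases "Suc k < length curve_points")
  case True
  then show ?thesis using successively_nth[OF curve_points_chain(1)] by simp
next
  case False
  then have "Suc k = length curve_points" using assms by simp
  then show ?thesis using curve_points_chain(2-4) by (simp add: hd_conv_nth last_conv_nth flip: \<open>Suc k = _\<close>)
qed

lemma valid_nth: "k < length curve_points \<Longrightarrow> valid (curve_points ! k)"
  using nth_mem set_curve_points by blast

lemma mod_eq_imp_zero: "\<bar>a - b\<bar> < m \<Longrightarrow> a mod m = b mod m \<Longrightarrow> a = (b :: int)"
proof -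
  assume "\<bar>a - b\<bar> < m" "a mod m = b mod m"
  then have "m dvd a - b" by (simp add: mod_eq_dvd_iff)
  then show "a = b" using \<open>\<bar>a - b\<bar> < m\<close> zdvd_not_zless[of "\<bar>a - b\<bar>" m] by (cases "a = b") auto
qed

text \<open>Two points of the same kind at one vertex share a column or a row, hence a segment, and
  on a segment shorter than the period positions are distinct. If a corner were involved, its column
  or row would identify the other segment as an adjacent one, and the meeting point as the excluded
  endpoint of a segment.\<close>

lemma double_point_aux:
  assumes "valid s" "valid s'" "s \<noteq> s'" "point s = point s'"
  shows "fst (snd s) \<noteq> fst (snd s')" "\<not> fst (snd s) \<Longrightarrow> 0 < snd (snd s) \<and> 0 < snd (snd s')"
proof -
  have strict: "\<bar>int t * sgn a - int t' * sgn a\<bar> < m" if "\<bar>a\<bar> < m" "t < nat \<bar>a\<bar>" "t' \<le> nat \<bar>a\<bar>" for t t' a m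
  proof -
    have "\<bar>int t * sgn a - int t' * sgn a\<bar> \<le> \<bar>int t - int t'\<bar>"
      by (cases a "0::int" rule: linorder_cases) auto
    also have "\<dots> < m" using that by linarith
    finally show ?thesis .
  qed
  have eq: "t = t'" if "\<bar>a\<bar> < m" "t < nat \<bar>a\<bar>" "t' \<le> nat \<bar>a\<bar>" "(b + int t * sgn a) mod m = (b + int t' * sgn a) mod m" for t t' a b m
  proof -
    have "b + int t * sgn a = b + int t' * sgn a"
      by (rule mod_eq_imp_zero[OF _ that(4)]) (use strict[OF that(1-3)] in simp)
    then show ?thesis using that(2) by (simp add: sgn_0_0 sgn_if split: if_splits)
  qed
  have full: "b + int (nat \<bar>a - b\<bar>) * sgn (a - b) = (a :: int)" for a b by (simp add: sgn_if)
  obtain i h t i' h' t' where s: "s = (i, h, t)" "s' = (i', h', t')" by (metis surj_pair)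
  have v: "i < r" "i' < r" "t < seg_length i h" "t' < seg_length i' h'" using assms(1,2) by (auto simp: valid_def s)
  show h: "fst (snd s) \<noteq> fst (snd s')"
  proof
    assume e: "fst (snd s) = fst (snd s')"
    show False
    proof (cases h)
      case True
      then have h: "h" "h'" using e s by auto
      have "y (Suc i) mod Q = y (Suc i') mod Q" using assms(4) h by (simp add: s point_def proj_def loc_def)
      then have i: "i = i'" using rows v by blast
      have "(x i + int t * sgn (x (Suc i) - x i)) mod P = (x i + int t' * sgn (x (Suc i) - x i)) mod P"
        using assms(4) h i by (simp add: s point_def proj_def loc_def)
      then have "t = t'" using eq[of "x (Suc i) - x i" P t t' "x i"] horizontal[OF v(1)] v h i by (simp add: seg_length_def)
      then show False using assms(3) s h i by simp
    next
      case False
      then have h: "\<not> h" "\<not> h'" using e s by auto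
      have "x i mod P = x i' mod P" using assms(4) h by (simp add: s point_def proj_def loc_def)
      then have i: "i = i'" using columns v by blast
      have "(y i + int t * sgn (y (Suc i) - y i)) mod Q = (y i + int t' * sgn (y (Suc i) - y i)) mod Q"
        using assms(4) h i by (simp add: s point_def proj_def loc_def)
      then have "t = t'" using eq[of "y (Suc i) - y i" Q t t' "y i"] vertical[OF v(1)] v h i by (simp add: seg_length_def)
      then show False using assms(3) s h i by simp
    qed
  qed
  show "0 < snd (snd s) \<and> 0 < snd (snd s')" if nh: "\<not> fst (snd s)"
  proof -
    have hh: "\<not> h" "h'" using h nh s by auto
    have p: "x i mod P = (x i' + int t' * sgn (x (Suc i') - x i')) mod P"
      "(y i + int t * sgn (y (Suc i) - y i)) mod Q = y (Suc i') mod Q"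
      using assms(4) hh by (auto simp: s point_def proj_def loc_def)
    have "t \<noteq> 0"
    proof
      assume "t = 0"
      then have yy: "y i mod Q = y (Suc i') mod Q" using p(2) by simp
      \<comment> \<open>The other point would lie on the horizontal segment that ends where segment
        \<open>i\<close> begins. For \<open>i = 0\<close> this is the last segment, by the closing
        condition.\<close>
      have e: "Suc i' mod r = i \<and> x i mod P = x (Suc i') mod P"
      proof (cases i)
        case 0
        then have "y (Suc (r - 1)) mod Q = y (Suc i') mod Q" using yy closing(2) r by simp
        then have "r - 1 = i'" using rows[of "r - 1" i'] v r by simp
        then show ?thesis using 0 closing(1) r by auto
      next
        case (Suc j)
        then have "j = i'" using rows[of j i'] yy v by simp
        then show ?thesis using Suc v by simp
      qed
      let ?a = "x (Suc i') - x i'"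
      have "(x i' + int t' * sgn ?a) mod P = (x i' + int (nat \<bar>?a\<bar>) * sgn ?a) mod P"
        using p(1) e full[of "x i'" "x (Suc i')"] by simp
      then have "t' = nat \<bar>?a\<bar>"
        using eq[of ?a P t' "nat \<bar>?a\<bar>" "x i'"] horizontal[OF v(2)] v hh by (simp add: seg_length_def)
      then show False using v hh by (simp add: seg_length_def)
    qed
    moreover have "t' \<noteq> 0"
    proof
      assume "t' = 0"
      then have "x i mod P = x i' mod P" using p(1) by simp
      then have i: "i = i'" using columns v by blast
      let ?a = "y (Suc i) - y i"
      have "(y i + int t * sgn ?a) mod Q = (y i + int (nat \<bar>?a\<bar>) * sgn ?a) mod Q"
        using p(2) i full[of "y i" "y (Suc i)"] by simp
      then have "t = nat \<bar>?a\<bar>"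
        using eq[of ?a Q t "nat \<bar>?a\<bar>" "y i"] vertical[OF v(1)] v hh by (simp add: seg_length_def)
      then show False using v hh by (simp add: seg_length_def)
    qed
    ultimately show ?thesis by (simp add: s)
  qed
qed

lemma double_point:
  assumes "valid s" "valid s'" "s \<noteq> s'" "point s = point s'"
  shows "fst (snd s) \<noteq> fst (snd s')" "0 < snd (snd s)" "0 < snd (snd s')"
  using double_point_aux[OF assms] double_point_aux[OF assms(2,1) assms(3)[symmetric] assms(4)[symmetric]] by auto

lemma dir_cases: "dir s = (if fst (snd s) then 0 else 1) \<or> dir s = (if fst (snd s) then 2 else 3)"
  by (cases s) (auto simp: dir_def)

lemma dart_A: "dart s \<in> A"
  using dir_cases[of s] P Q
  by (cases "loc s") (auto simp: dart_def point_def proj_def grid_darts_def split: if_splits)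

lemma mod_neighbours:
  "0 < m \<Longrightarrow> (if a mod m = m - 1 then 0 else a mod m + 1) = (a + 1) mod (m :: int)"
  "0 < m \<Longrightarrow> (if a mod m = 0 then m - 1 else a mod m - 1) = (a - 1) mod (m :: int)"
proof -
  assume m: "0 < m"
  have b: "0 \<le> a mod m" "a mod m < m" using m by simp_all
  have 1: "(a + 1) mod m = (a mod m + 1) mod m" "(a - 1) mod m = (a mod m - 1) mod m" by (simp_all add: mod_simps)
  show "(if a mod m = m - 1 then 0 else a mod m + 1) = (a + 1) mod m" unfolding 1 using b by auto
  show "(if a mod m = 0 then m - 1 else a mod m - 1) = (a - 1) mod m"
    unfolding 1 using b by (auto simp: zmod_minus1)
qed

text \<open>On the sphere the outer rows are folded and not joined to each other, so vertical steps
  agree with those in the plane only inside the strip of rows; the locale assumption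
  \<open>bounded\<close> keeps the curve there.\<close>

lemma across_proj:
  "flp (proj (a, b), 0) = (proj (a + 1, b), 2)"
  "flp (proj (a, b), 2) = (proj (a - 1, b), 0)"
  "(sph \<Longrightarrow> 0 \<le> b \<and> b + 1 < Q) \<Longrightarrow> flp (proj (a, b), 1) = (proj (a, b + 1), 3)"
  "(sph \<Longrightarrow> 0 \<le> b - 1 \<and> b < Q) \<Longrightarrow> flp (proj (a, b), 3) = (proj (a, b - 1), 1)"
proof -
  have pq: "0 < P" "0 < Q" using P Q by simp_all
  note m = mod_neighbours[OF pq(1), of a] mod_neighbours[OF pq(2), of b]
  show "flp (proj (a, b), 0) = (proj (a + 1, b), 2)" "flp (proj (a, b), 2) = (proj (a - 1, b), 0)"
    by (simp_all add: across_def proj_def m(1,2)[symmetric])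
  show "flp (proj (a, b), 1) = (proj (a, b + 1), 3)" if "sph \<Longrightarrow> 0 \<le> b \<and> b + 1 < Q"
    using that by (cases sph) (auto simp add: across_def proj_def m(3)[symmetric])
  show "flp (proj (a, b), 3) = (proj (a, b - 1), 1)" if "sph \<Longrightarrow> 0 \<le> b - 1 \<and> b < Q"
    using that by (cases sph) (auto simp add: across_def proj_def m(4)[symmetric])
qed

lemma point_next:
  assumes "valid (i, h, t)"
  shows "point (next_point (i, h, t)) = proj (if h then (x i + int (Suc t) * sgn (x (Suc i) - x i), y (Suc i))
    else (x i, y i + int (Suc t) * sgn (y (Suc i) - y i)))"
proof -
  have i: "i < r" and t: "t < seg_length i h" using assms by (auto simp: valid_def)
  have full: "int (nat \<bar>a - b\<bar>) * sgn (a - b) = a - b" for a b :: int by (simp add: sgn_if)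
  show ?thesis
  proof (cases "Suc t < seg_length i h")
    case False
    then have e: "seg_length i h = Suc t" using t by simp
    show ?thesis
    proof (cases h)
      case True
      have "int (Suc t) * sgn (x (Suc i) - x i) = x (Suc i) - x i"
        using e True full[of "x (Suc i)" "x i"] by (simp add: seg_length_def)
      moreover have "proj (x (Suc i mod r), y (Suc i mod r)) = proj (x (Suc i), y (Suc i))"
        using closing i by (cases "Suc i = r") (auto simp: proj_def)
      ultimately show ?thesis using e True by (simp add: point_def next_point_def loc_def)
    next
      case h: False
      have "int (Suc t) * sgn (y (Suc i) - y i) = y (Suc i) - y i"
        using e h full[of "y (Suc i)" "y i"] by (simp add: seg_length_def)
      then show ?thesis using e h by (simp add: point_def next_point_def loc_def)
    qed
  qed (simp add: point_def next_point_def loc_def)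
qed

lemma across_dart:
  assumes "valid s"
  shows "flp (dart s) = (point (next_point s), (dir s + 2) mod 4)"
proof -
  obtain i h t where s: "s = (i, h, t)" by (metis surj_pair)
  have i: "i < r" and t: "t < seg_length i h" using assms by (auto simp: valid_def s)
  note n = point_next[OF assms[unfolded s]]
  show ?thesis
  proof (cases h)
    case True
    have d: "x (Suc i) - x i \<noteq> 0" using horizontal[OF i] by simp
    show ?thesis unfolding s n using True d
      by (cases "x i < x (Suc i)") (auto simp: dart_def point_def loc_def dir_def across_proj algebra_simps)
  next
    case False
    have d: "y (Suc i) \<noteq> y i" using vertical[OF i] by simp
    have b: "0 \<le> y i \<and> y i < Q \<and> 0 \<le> y (Suc i) \<and> y (Suc i) < Q" if sph
      using bounded[OF that, of i] bounded[OF that, of "Suc i"] i by simp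
    have t: "t < nat \<bar>y (Suc i) - y i\<bar>" using t False by (simp add: seg_length_def)
    show ?thesis
    proof (cases "y i < y (Suc i)")
      case True
      have "flp (proj (x i, y i + int t), 1) = (proj (x i, y i + int t + 1), 3)"
        by (rule across_proj(3)) (use b t True in linarith)
      then show ?thesis unfolding s n using True False
        by (simp add: dart_def point_def loc_def dir_def algebra_simps)
    next
      case ny: False
      have "flp (proj (x i, y i - int t), 3) = (proj (x i, y i - int t - 1), 1)"
        by (rule across_proj(4)) (use b t ny d in linarith)
      then show ?thesis unfolding s n using ny False d
        by (simp add: dart_def point_def loc_def dir_def algebra_simps)
    qed
  qed
qed

abbreviation "S \<equiv> grid_surface sph P Q"
abbreviation "ds \<equiv> darts_list"
abbreviation "L \<equiv> length curve_points"

text \<open>Passage \<open>k\<close> occurs at the end of dart \<open>k\<close>, which is the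
  starting point of the following dart; hence the cyclic shift by one.\<close>

definition visit :: "nat \<Rightarrow> curve_point" where
  "visit k = curve_points ! (Suc k mod L)"

lemma length_ds: "length ds = L"
  by (simp add: darts_list_def)

lemma L_pos: "0 < L"
  using curve_points_chain(2) by simp

lemma ds_nth: "k < L \<Longrightarrow> ds ! k = to_nat (dart (curve_points ! k))"
  by (simp add: darts_list_def)

lemma valid_visit: "valid (visit k)"
  unfolding visit_def using L_pos by (intro valid_nth) simp

lemma out_dart_ds: "out_dart ds k = to_nat (dart (visit k))"
  using L_pos by (simp add: out_dart_def length_ds ds_nth visit_def)

lemma in_dart_ds: "k < L \<Longrightarrow> in_dart S ds k = to_nat (point (visit k), (dir (curve_points ! k) + 2) mod 4)"
  using across_dart[OF valid_nth] curve_points_next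
  by (simp add: in_dart_def ds_nth flip_grid dart_A visit_def)

lemma vertex_visit:
  "vertex S (out_dart ds k) = vertex S (out_dart ds l) \<longleftrightarrow> point (visit k) = point (visit l)"
  unfolding out_dart_ds dart_def using dart_A[of "visit k"] dart_A[of "visit l"]
  by (subst vertex_grid) (simp_all add: dart_def)

lemma visit_inj: "k < L \<Longrightarrow> l < L \<Longrightarrow> visit k = visit l \<longleftrightarrow> k = l"
proof -
  assume kl: "k < L" "l < L"
  have "Suc k mod L = Suc l mod L \<longleftrightarrow> k = l"
    using kl by (auto simp: mod_Suc split: if_splits)
  then show ?thesis
    unfolding visit_def using L_pos distinct_curve_points by (simp add: nth_eq_iff_index_eq)
qed

lemma straight:
  assumes "k < L" "0 < snd (snd (visit k))"
  shows "dir (curve_points ! k) = dir (visit k)"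
proof -
  obtain i h t where e: "curve_points ! k = (i, h, t)" by (metis surj_pair)
  show ?thesis
    using assms(2) unfolding visit_def curve_points_next[OF assms(1)] e
    by (cases h) (auto simp: next_point_def dir_def split: if_splits)
qed

lemma corner:
  assumes "k < L" "snd (snd (visit k)) = 0"
  shows "fst (snd (curve_points ! k)) \<noteq> fst (snd (visit k))"
proof -
  obtain i h t where e: "curve_points ! k = (i, h, t)" by (metis surj_pair)
  show ?thesis
    using assms(2) unfolding visit_def curve_points_next[OF assms(1)] e
    by (cases h) (auto simp: next_point_def split: if_splits)
qed

lemma dart_inj: "valid s \<Longrightarrow> valid s' \<Longrightarrow> dart s = dart s' \<Longrightarrow> s = s'"
  using double_point(1)[of s s'] dir_cases[of s] dir_cases[of s'] by (auto simp: dart_def split: if_splits)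

lemma closed_curve_ds: "closed_curve S ds"
  unfolding closed_curve_def
proof (intro conjI ballI allI impI)
  show "ds \<noteq> []" using L_pos length_ds by force
  show "set ds \<subseteq> darts S" using dart_A by (auto simp: darts_list_def grid_surface_def)
  show "distinct ds"
    unfolding darts_list_def distinct_map
    using distinct_curve_points dart_inj set_curve_points by (auto simp: inj_on_def)
  show "vertex S (in_dart S ds k) = vertex S (out_dart ds k)" if "k < length ds" for k
  proof -
    have k: "k < L" using that length_ds by simp
    have "(point (visit k), (dir (curve_points ! k) + 2) mod 4) \<in> A"
      using dart_A[of "visit k"] by (auto simp: dart_def grid_darts_def)
    then show ?thesis unfolding in_dart_ds[OF k] out_dart_ds dart_def
      using dart_A[of "visit k"] by (subst vertex_grid) (auto simp: dart_def)
  qed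
  show "flip S d \<notin> set ds" if "d \<in> set ds" for d
  proof
    assume "flip S d \<in> set ds"
    then obtain s' where s': "valid s'" "flip S d = to_nat (dart s')"
      using set_curve_points by (auto simp: darts_list_def)
    obtain k where k: "k < L" "d = ds ! k" using \<open>d \<in> set ds\<close> length_ds by (auto simp: in_set_conv_nth)
    have e: "point (visit k) = point s'" "(dir (curve_points ! k) + 2) mod 4 = dir s'"
      using s'(2) in_dart_ds[OF k(1)] unfolding in_dart_def k(2)[symmetric] by (simp_all add: dart_def)
    show False
    proof (cases "s' = visit k")
      case True
      then show False
        using e(2) straight[OF k(1)] corner[OF k(1)] dir_cases[of s'] dir_cases[of "curve_points ! k"]
        by (cases "snd (snd (visit k)) = 0") (auto split: if_splits)
    next
      case False
      note d = double_point[OF s'(1) valid_visit False e(1)[symmetric]]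
      show False
        using d(1) e(2) straight[OF k(1) d(3)] dir_cases[of s'] dir_cases[of "visit k"] by (auto split: if_splits)
    qed
  qed
qed

definition is_crossing :: "curve_point \<Rightarrow> bool" where
  "is_crossing s \<longleftrightarrow> (\<exists>s'. valid s' \<and> s' \<noteq> s \<and> point s' = point s)"

lemma crossing_passages_ds: "crossing_passages S ds = filter (\<lambda>k. is_crossing (visit k)) [0..<L]"
proof -
  have "(\<exists>l<L. l \<noteq> k \<and> point (visit l) = point (visit k)) \<longleftrightarrow> is_crossing (visit k)" if k: "k < L" for k
  proof
    assume "\<exists>l<L. l \<noteq> k \<and> point (visit l) = point (visit k)"
    then show "is_crossing (visit k)" using valid_visit visit_inj k unfolding is_crossing_def by metis
  next
    assume "is_crossing (visit k)"
    then obtain s' where s': "valid s'" "s' \<noteq> visit k" "point s' = point (visit k)" by (auto simp: is_crossing_def)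
    then obtain j where j: "j < L" "s' = curve_points ! j" using set_curve_points by (metis in_set_conv_nth mem_Collect_eq)
    define l where "l = (if j = 0 then L - 1 else j - 1)"
    have "l < L" "visit l = s'" using j L_pos by (auto simp: l_def visit_def)
    then show "\<exists>l<L. l \<noteq> k \<and> point (visit l) = point (visit k)" using s' by metis
  qed
  then show ?thesis
    unfolding crossing_passages_def length_ds vertex_visit by (intro filter_cong) auto
qed

lemma visits: "map visit [0..<L] = tl curve_points @ [hd curve_points]"
proof (rule nth_equalityI)
  show "length (map visit [0..<L]) = length (tl curve_points @ [hd curve_points])" using L_pos by simp
  fix k assume "k < length (map visit [0..<L])"
  then have k: "k < L" by simp
  show "map visit [0..<L] ! k = (tl curve_points @ [hd curve_points]) ! k"
    using k curve_points_chain(2) by (cases "Suc k = L") (auto simp: visit_def nth_append nth_tl hd_conv_nth)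
qed

text \<open>Passages enumerate the curve points rotated by one place. Only the first point changes
  its position, and being a corner it is no crossing, so the crossings are met in the same
  order.\<close>

lemma filter_visits:
  "map (\<lambda>k. g (visit k)) (filter (\<lambda>k. is_crossing (visit k)) [0..<L]) = map g (filter is_crossing curve_points)"
proof -
  have "\<not> is_crossing (hd curve_points)"
  proof
    assume "is_crossing (hd curve_points)"
    then obtain s' where "valid s'" "s' \<noteq> (0, False, 0)" "point s' = point (0, False, 0)"
      unfolding curve_points_chain(3) by (auto simp: is_crossing_def)
    moreover have "valid (0, False, 0)" using r seg_length_pos[of 0 False] by (simp add: valid_def)
    ultimately show False using double_point(3)[of s' "(0, False, 0)"] by simp
  qed
  moreover have "filter is_crossing curve_points = filter is_crossing (hd curve_points # tl curve_points)"
    using curve_points_chain(2) by simp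
  ultimately have "filter is_crossing curve_points = filter is_crossing (map visit [0..<L])"
    unfolding visits by simp
  then show ?thesis by (simp add: filter_map comp_def)
qed

lemma transversal_visit:
  assumes "k < L" "l < L" "k \<noteq> l" "point (visit k) = point (visit l)"
  shows "transversal S ds k l (if dir (visit l) = (dir (visit k) + 1) mod 4 then 1 else -1)"
proof -
  have ne: "visit k \<noteq> visit l" using visit_inj assms by blast
  note d = double_point[OF valid_visit valid_visit ne assms(4)]
  have dk: "dir (curve_points ! k) = dir (visit k)" "dir (curve_points ! l) = dir (visit l)"
    using straight assms(1,2) d(2,3) by auto
  have rot: "rot S (to_nat (point (visit l), e)) = to_nat (turn (point (visit l), e))"
    if "e = 0 \<or> e = 1 \<or> e = 2 \<or> e = 3" for e
    using dart_A[of "visit l"] that by (intro rot_grid) (auto simp: dart_def grid_darts_def)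
  show ?thesis
    unfolding transversal_def Let_def out_dart_ds in_dart_ds[OF assms(1)] in_dart_ds[OF assms(2)] dk dart_def assms(4)
    using d(1) dir_cases[of "visit k"] dir_cases[of "visit l"]
    by (cases "fst (snd (visit k))") (auto simp: rot)
qed

text \<open>\<open>lab\<close> names the vertices. Every name occurs exactly twice: among three
  points at a vertex, two would be of the same kind, vertical or horizontal, which
  \<open>double_point\<close> excludes.\<close>

lemma curve_diagram_ds:
  assumes inj: "\<And>s s'. valid s \<Longrightarrow> valid s' \<Longrightarrow> is_crossing s \<Longrightarrow> is_crossing s' \<Longrightarrow> lab (point s) = lab (point s') \<Longrightarrow> point s = point s'"
    and orient: "\<And>k l. k < l \<Longrightarrow> l < L \<Longrightarrow> point (visit k) = point (visit l) \<Longrightarrow>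
      orientation (lab (point (visit k))) = (if dir (visit l) = (dir (visit k) + 1) mod 4 then 1 else -1)"
  shows "curve_diagram S ds (map (\<lambda>s. lab (point s)) (filter is_crossing curve_points))"
proof -
  define ps where "ps = crossing_passages S ds"
  define w where "w = map (\<lambda>s. lab (point s)) (filter is_crossing curve_points)"
  have w: "w = map (\<lambda>k. lab (point (visit k))) ps"
    unfolding w_def ps_def crossing_passages_ds by (rule filter_visits[symmetric])
  have ps: "\<And>k. k \<in> set ps \<Longrightarrow> k < L \<and> is_crossing (visit k)" "sorted ps" "distinct ps"
    unfolding ps_def crossing_passages_ds by (auto simp: sorted_wrt_filter)
  have lt: "ps ! i < ps ! j" if "i < j" "j < length ps" for i j
    using ps(2,3) that by (metis nth_eq_iff_index_eq order_less_imp_not_eq sorted_nth_mono less_imp_le order_le_less less_trans)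
  have gauss: "gauss_word w"
    unfolding gauss_word_def
  proof
    fix c assume "c \<in> set w"
    then obtain s where s: "valid s" "is_crossing s" "c = lab (point s)"
      using set_curve_points by (auto simp: w_def)
    then obtain s' where s': "valid s'" "s' \<noteq> s" "point s' = point s" by (auto simp: is_crossing_def)
    have "count_list w c = length (filter (\<lambda>a. lab (point a) = c) (filter is_crossing curve_points))"
      unfolding w_def by (simp add: count_list_eq_length_filter filter_map comp_def eq_commute[of c])
    also have "\<dots> = card {a. valid a \<and> is_crossing a \<and> lab (point a) = c}"
      using distinct_card[of "filter (\<lambda>a. lab (point a) = c) (filter is_crossing curve_points)"]
        distinct_curve_points set_curve_points by (auto simp: conj_ac cong: conj_cong)
    also have "{a. valid a \<and> is_crossing a \<and> lab (point a) = c} = {s, s'}"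
    proof
      show "{s, s'} \<subseteq> {a. valid a \<and> is_crossing a \<and> lab (point a) = c}"
      proof -
        have "is_crossing s'" unfolding is_crossing_def using s(1) s'(2,3) by metis
        then show ?thesis using s s' by simp
      qed
      show "{a. valid a \<and> is_crossing a \<and> lab (point a) = c} \<subseteq> {s, s'}"
      proof
        fix a assume "a \<in> {a. valid a \<and> is_crossing a \<and> lab (point a) = c}"
        then have a: "valid a" "point a = point s" using inj s by auto
        show "a \<in> {s, s'}"
        proof (rule ccontr)
          assume "a \<notin> {s, s'}"
          then show False
            using double_point(1)[of a s] double_point(1)[of a s'] double_point(1)[of s s'] a s s' by auto
        qed
      qed
    qed
    finally show "count_list w c = 2" using s'(2) by simp
  qed
  have pair: "(w ! i = w ! j \<longleftrightarrow> vertex S (out_dart ds (ps ! i)) = vertex S (out_dart ds (ps ! j))) \<and>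
      (w ! i = w ! j \<longrightarrow> transversal S ds (ps ! i) (ps ! j) (orientation (w ! i)))" if ij: "i < j" "j < length w" for i j
  proof -
    have len: "i < length ps" "j < length ps" using ij by (simp_all add: w)
    have in_ps: "ps ! i \<in> set ps" "ps ! j \<in> set ps" using len by simp_all
    have eq: "w ! i = w ! j \<longleftrightarrow> point (visit (ps ! i)) = point (visit (ps ! j))"
      using inj[OF valid_visit valid_visit] ps(1) in_ps len by (auto simp: w)
    have "transversal S ds (ps ! i) (ps ! j) (orientation (w ! i))" if "point (visit (ps ! i)) = point (visit (ps ! j))"
      using transversal_visit[of "ps ! i" "ps ! j"] orient[OF lt[OF ij(1) len(2)] _ that] ps(1) in_ps lt[OF ij(1) len(2)] that len
      by (simp add: w)
    then show ?thesis unfolding eq vertex_visit by blast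
  qed
  show ?thesis
    unfolding curve_diagram_def Let_def w_def[symmetric] ps_def[symmetric]
  proof (intro conjI allI impI)
    show "closed_surface S" "closed_curve S ds" "gauss_word w" by (fact closed_surface_grid closed_curve_ds gauss)+
    show "length ps = length w" by (simp add: w)
    fix i j assume "i < j \<and> j < length w"
    then have ij: "i < j" "j < length w" by simp_all
    show "w ! i = w ! j \<longleftrightarrow> vertex S (out_dart ds (ps ! i)) = vertex S (out_dart ds (ps ! j))"
      by (rule conjunct1[OF pair[OF ij]])
    show "transversal S ds (ps ! i) (ps ! j) (orientation (w ! i))" if "w ! i = w ! j"
      using conjunct2[OF pair[OF ij]] that by (rule mp)
  qed
qed

end

fun earlier :: "curve_point \<Rightarrow> curve_point \<Rightarrow> bool" where
  "earlier (i, h, t) (i', h', t') \<longleftrightarrow> i < i' \<or> i = i' \<and> (\<not> h \<and> h' \<or> h = h' \<and> t < t')"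

context drawing
begin

lemma sorted_curve_points: "sorted_wrt earlier curve_points"
proof -
  have run: "sorted_wrt earlier (map (\<lambda>t. (i, h, t)) [0..<m])" for i h m
    by (induction m) (auto simp: sorted_wrt_append)
  have "sorted_wrt earlier (concat (map (\<lambda>i. map (\<lambda>t. (i, False, t)) [0..<seg_length i False] @
     map (\<lambda>t. (i, True, t)) [0..<seg_length i True]) [0..<m]))" for m
    by (induction m) (auto simp: sorted_wrt_append run)
  then show ?thesis by (simp only: curve_points_def)
qed

lemma ex_visit:
  assumes "valid s" "0 < snd (snd s)"
  obtains k where "Suc k < L" "curve_points ! Suc k = s" "visit k = s"
proof -
  obtain j where j: "j < L" "curve_points ! j = s" using assms(1) set_curve_points by (metis in_set_conv_nth mem_Collect_eq)
  have "j \<noteq> 0"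
  proof
    assume "j = 0"
    then have "s = (0, False, 0)" using j(2) curve_points_chain(2,3) by (simp add: hd_conv_nth)
    then show False using assms(2) by simp
  qed
  then show thesis using that[of "j - 1"] j by (simp add: visit_def)
qed

lemma ex_visits:
  assumes "valid s" "0 < snd (snd s)" "valid s'" "0 < snd (snd s')" "earlier s s'"
  obtains k l where "k < l" "Suc l < L" "visit k = s" "visit l = s'" "curve_points ! Suc k = s" "curve_points ! Suc l = s'"
proof -
  obtain k where k: "Suc k < L" "curve_points ! Suc k = s" "visit k = s" using ex_visit[OF assms(1,2)] .
  obtain l where l: "Suc l < L" "curve_points ! Suc l = s'" "visit l = s'" using ex_visit[OF assms(3,4)] .
  have "\<not> l \<le> k"
  proof
    assume "l \<le> k"
    then have "s' = s \<or> earlier s' s"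
      using sorted_wrt_nth_less[OF sorted_curve_points, of "Suc l" "Suc k"] k l by (cases "l = k") auto
    then show False using assms(5) by (cases s; cases s') auto
  qed
  then have "k < l" by simp
  then show thesis by (rule that) (fact k l)+
qed

lemma visits_unique:
  assumes "k < L" "l < L" "j < L" "k \<noteq> l" "point (visit k) = point (visit l)" "point (visit j) = point (visit l)"
  shows "j = k \<or> j = l"
proof (rule ccontr)
  assume n: "\<not> (j = k \<or> j = l)"
  have d: "a \<noteq> b \<Longrightarrow> a < L \<Longrightarrow> b < L \<Longrightarrow> point (visit a) = point (visit b) \<Longrightarrow> fst (snd (visit a)) \<noteq> fst (snd (visit b))" for a b
    using double_point(1)[OF valid_visit valid_visit] visit_inj by blast
  show False using d[of k l] d[of j k] d[of j l] assms n by auto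
qed

text \<open>An existential over the passages makes this a function of the vertex, as the labels are.
  At a crossing the witnesses are unique by \<open>visits_unique\<close>; elsewhere the value -1 is
  a default.\<close>

definition orient_at :: "int \<times> int \<Rightarrow> int" where
  "orient_at v = (if \<exists>k l. k < l \<and> l < L \<and> point (visit k) = v \<and> point (visit l) = v \<and>
     dir (visit l) = (dir (visit k) + 1) mod 4 then 1 else -1)"

lemma orient_at_visits:
  assumes kl: "k < l" "l < L" "point (visit k) = point (visit l)"
  shows "orient_at (point (visit k)) = (if dir (visit l) = (dir (visit k) + 1) mod 4 then 1 else -1)"
proof -
  have "k' = k \<and> l' = l" if "k' < l'" "l' < L" "point (visit k') = point (visit k)" "point (visit l') = point (visit k)" for k' l'
    using visits_unique[of k l k'] visits_unique[of k l l'] that kl by auto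
  then show ?thesis unfolding orient_at_def using kl by metis
qed

lemma orient_at_eq:
  assumes "valid s" "valid s'" "point s = point s'" "earlier s s'"
  shows "orient_at (point s) = (if dir s' = (dir s + 1) mod 4 then 1 else -1)"
proof -
  have "s \<noteq> s'" using assms(4) by (cases s) auto
  note d = double_point[OF assms(1,2) this assms(3)]
  obtain k l where "k < l" "Suc l < L" "visit k = s" "visit l = s'"
    using ex_visits[OF assms(1) d(2) assms(2) d(3) assms(4)] by metis
  then show ?thesis using orient_at_visits[of k l] assms(3) by simp
qed

lemma curve_diagram_lab:
  assumes "inj_on lab (point ` {s. valid s \<and> is_crossing s})"
    and orient: "\<And>s. valid s \<Longrightarrow> is_crossing s \<Longrightarrow> orientation (lab (point s)) = orient_at (point s)"
  shows "curve_diagram S ds (map (\<lambda>s. lab (point s)) (filter is_crossing curve_points))"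
proof (rule curve_diagram_ds)
  show "point s = point s'" if "valid s" "valid s'" "is_crossing s" "is_crossing s'" "lab (point s) = lab (point s')" for s s'
    using inj_onD[OF assms(1) that(5)] that by blast
  show "orientation (lab (point (visit k))) = (if dir (visit l) = (dir (visit k) + 1) mod 4 then 1 else -1)"
    if "k < l" "l < L" "point (visit k) = point (visit l)" for k l
  proof -
    have "visit k \<noteq> visit l" using visit_inj[of k l] that by simp
    then have "is_crossing (visit k)" unfolding is_crossing_def using valid_visit that(3) by metis
    then show ?thesis using orient[OF valid_visit] orient_at_visits[OF that] by simp
  qed
qed

end

section \<open>Planar diagrams with prescribed real crossings\<close>

text \<open>
  A planar diagram with a given Gauss word of real crossings: the first passage through the crossing
  \<open>w ! p = w ! q\<close> (where \<open>p < q\<close>) goes upwards in column \<open>n + p\<close>, the second one goes to the right or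
  to the left in row \<open>n + q\<close>, and all remaining double points are virtual.
\<close>

lemma sorted_wrt_unique:
  assumes "\<And>a b. R a b \<Longrightarrow> \<not> R b a" "sorted_wrt R xs" "sorted_wrt R ys" "set xs = set ys"
  shows "xs = ys"
  using assms(2-4)
proof (induction xs arbitrary: ys)
  case (Cons a xs)
  then obtain b ys' where ys: "ys = b # ys'" by (cases ys) auto
  have "a = b \<or> R b a" "b = a \<or> R a b" using Cons(2-4) by (auto simp: ys)
  then have ab: "a = b" using assms(1) by blast
  have "a \<notin> set xs" "b \<notin> set ys'" using Cons(2,3) assms(1)[of a a] by (auto simp: ys ab)
  then have "set xs = set ys'" using Cons(4) by (auto simp: ys ab)
  then show ?case using Cons(1)[of ys'] Cons(2,3) by (simp add: ys ab)
qed simp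

context gauss
begin

declare length_greater_0_conv [simp del]

definition is_first :: "nat \<Rightarrow> bool" where
  "is_first k \<longleftrightarrow> k = first_pos w (w ! k)"

text \<open>Columns and rows come in three bands of width \<open>n\<close>. First passages climb in
  the middle band of columns and second passages run through the middle band of rows, so all real
  crossings lie in the central square; the outer bands hold connecting arcs. Passage
  \<open>k\<close> occupies the segments with indices \<open>2 * k\<close> and
  \<open>2 * k + 1\<close>, and the last of them, in row \<open>k\<close>, leads on to the next
  passage. Since first passages go upwards, a second passage runs to the right exactly for
  orientation -1.\<close>

definition plane_x :: "nat \<Rightarrow> int" where
  "plane_x i = (let j = if i = 2 * n then 0 else i; k = int (j div 2) in
     if is_first (j div 2) then (if even j then int n + k else 2 * int n + k)
     else if even j \<longleftrightarrow> orientation (w ! (j div 2)) = -1 then k else 2 * int n + k)"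

definition plane_y :: "nat \<Rightarrow> int" where
  "plane_y i = (case i of 0 \<Rightarrow> int n - 1 | Suc j \<Rightarrow>
     if odd j then int (j div 2) else if is_first (j div 2) then 2 * int n + int (j div 2) else int n + int (j div 2))"

lemma is_first_partner: "k < n \<Longrightarrow> is_first (partner w k) \<longleftrightarrow> \<not> is_first k"
proof -
  assume k: "k < n"
  then have c: "w ! k \<in> set w" by simp
  note p = first_pos_props[OF gauss c] gauss_word_positions(2)[OF gauss c]
  have "k = first_pos w (w ! k) \<or> k = second_pos w (w ! k)" using p(5)[OF k] by simp
  then show ?thesis using p by (auto simp: is_first_def partner_def)
qed

lemma plane_x_simps:
  assumes "k < n"
  shows "plane_x (2 * k) = (if is_first k then int n + int k else if orientation (w ! k) = -1 then int k else 2 * int n + int k)"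
    "plane_x (Suc (2 * k)) = (if is_first k then 2 * int n + int k else if orientation (w ! k) = -1 then 2 * int n + int k else int k)"
proof -
  have d: "Suc (2 * k) div 2 = k" "(2 * k) div 2 = k" by simp_all
  have ne: "2 * k \<noteq> 2 * n" "Suc (2 * k) \<noteq> 2 * n" using assms by simp presburger
  show "plane_x (2 * k) = (if is_first k then int n + int k else if orientation (w ! k) = -1 then int k else 2 * int n + int k)"
    unfolding plane_x_def Let_def if_not_P[OF ne(1)] d by simp
  show "plane_x (Suc (2 * k)) = (if is_first k then 2 * int n + int k else if orientation (w ! k) = -1 then 2 * int n + int k else int k)"
    unfolding plane_x_def Let_def if_not_P[OF ne(2)] d by simp
qed

lemma plane_y_simps:
  "plane_y (Suc (2 * k)) = (if is_first k then 2 * int n + int k else int n + int k)"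
  "plane_y (Suc (Suc (2 * k))) = int k"
  by (simp_all add: plane_y_def)

lemma less_double_cases:
  assumes "i < 2 * n"
  obtains k where "k < n" "i = 2 * k" | k where "k < n" "i = Suc (2 * k)"
proof (cases "even i")
  case True
  then obtain k where "i = 2 * k" by (elim evenE)
  then show thesis using that(1)[of k] assms by simp
next
  case False
  then obtain k where "i = 2 * k + 1" by (elim oddE)
  then show thesis using that(2)[of k] assms by simp
qed

lemma plane_bounds: "0 < n \<Longrightarrow> 0 \<le> plane_x i \<and> plane_x i < 3 * int n" if "i \<le> 2 * n" for i
proof -
  assume n: "0 < n"
  show ?thesis
  proof (cases "i = 2 * n")
    case True
    then have "plane_x i = plane_x (2 * 0)" by (simp add: plane_x_def)
    then show ?thesis using plane_x_simps(1)[OF n] n by simp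
  next
    case False
    then have "i < 2 * n" using that by simp
    then show ?thesis by (cases rule: less_double_cases) (auto simp: plane_x_simps)
  qed
qed

lemma plane_y_bounds: "0 < n \<Longrightarrow> i \<le> 2 * n \<Longrightarrow> 0 \<le> plane_y i \<and> plane_y i < 3 * int n"
proof (cases i)
  case (Suc j)
  assume "0 < n" "i \<le> 2 * n"
  then have "j < 2 * n" using Suc by simp
  then show ?thesis unfolding Suc by (cases rule: less_double_cases) (auto simp: plane_y_simps)
qed (simp add: plane_y_def)

lemma plane_x_inj: "i < 2 * n \<Longrightarrow> j < 2 * n \<Longrightarrow> plane_x i = plane_x j \<Longrightarrow> i = j"
  by (elim less_double_cases) (auto simp: plane_x_simps split: if_splits)

lemma plane_y_inj: "i < 2 * n \<Longrightarrow> j < 2 * n \<Longrightarrow> plane_y (Suc i) = plane_y (Suc j) \<Longrightarrow> i = j"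
  by (elim less_double_cases) (auto simp: plane_y_simps split: if_splits)

lemma plane_closing: "0 < n \<Longrightarrow> plane_x (2 * n) = plane_x 0" "0 < n \<Longrightarrow> plane_y (2 * n) = plane_y 0"
proof -
  assume n: "0 < n"
  show "plane_x (2 * n) = plane_x 0" by (simp add: plane_x_def)
  obtain m where m: "n = Suc m" using n by (cases n) auto
  then show "plane_y (2 * n) = plane_y 0" using plane_y_simps(2)[of m] by (simp add: plane_y_def[of 0])
qed

text \<open>Width \<open>4 * n\<close> is even for every \<open>n\<close>, as the fold requires, and
  exceeds all coordinates; height \<open>3 * n\<close> accommodates exactly the three bands. No
  segment wraps around.\<close>

lemma plane_drawing:
  assumes "0 < n"
  shows "drawing True (4 * int n) (3 * int n) (2 * n) plane_x plane_y"
proof unfold_locales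
  have xm: "plane_x i mod (4 * int n) = plane_x i" if "i \<le> 2 * n" for i
    using plane_bounds[OF that assms] by simp
  have ym: "plane_y i mod (3 * int n) = plane_y i" if "i \<le> 2 * n" for i
    using plane_y_bounds[OF assms that] by simp
  show "2 \<le> 4 * int n" "1 \<le> 3 * int n" "even (4 * int n)" "0 < 2 * n" using assms by simp_all
  show "i = j" if "i < 2 * n" "j < 2 * n" "plane_x i mod (4 * int n) = plane_x j mod (4 * int n)" for i j
    using that plane_x_inj xm by simp
  show "i = j" if "i < 2 * n" "j < 2 * n" "plane_y (Suc i) mod (3 * int n) = plane_y (Suc j) mod (3 * int n)" for i j
    using that plane_y_inj ym by simp
  show "plane_x (2 * n) mod (4 * int n) = plane_x 0 mod (4 * int n)" "plane_y (2 * n) mod (3 * int n) = plane_y 0 mod (3 * int n)"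
    using plane_closing assms by simp_all
  show "plane_x i \<noteq> plane_x (Suc i) \<and> \<bar>plane_x (Suc i) - plane_x i\<bar> < 4 * int n" if i: "i < 2 * n" for i
  proof -
    have "plane_x i \<noteq> plane_x (Suc i)"
    proof (cases "Suc i = 2 * n")
      case True
      then have "plane_x (Suc i) = plane_x 0" "i \<noteq> 0" using plane_closing(1)[OF assms] by (simp, presburger)
      then show ?thesis using plane_x_inj[OF i, of 0] assms by auto
    qed (use plane_x_inj[OF i, of "Suc i"] i in auto)
    then show ?thesis using plane_bounds[of i] plane_bounds[of "Suc i"] assms i by auto
  qed
  show "plane_y i \<noteq> plane_y (Suc i) \<and> \<bar>plane_y (Suc i) - plane_y i\<bar> < 3 * int n" if i: "i < 2 * n" for i
  proof -
    have "plane_y i \<noteq> plane_y (Suc i)"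
    proof (cases i)
      case 0
      have "plane_y (Suc (2 * n - 1)) = plane_y 0" using plane_closing(2)[OF assms] assms by simp
      then show ?thesis using plane_y_inj[OF i, of "2 * n - 1"] assms 0 by auto
    next
      case (Suc j)
      then show ?thesis using plane_y_inj[of j i] i by auto
    qed
    then show ?thesis using plane_y_bounds[OF assms, of i] plane_y_bounds[OF assms, of "Suc i"] i by auto
  qed
  show "0 \<le> plane_y i \<and> plane_y i < 3 * int n" if "i \<le> 2 * n" for i
    using plane_y_bounds[OF assms that] .
qed

lemma partner_less: "q < n \<Longrightarrow> \<not> is_first q \<Longrightarrow> partner w q < q"
proof -
  assume q: "q < n" "\<not> is_first q"
  then have c: "w ! q \<in> set w" by simp
  show "partner w q < q"
    using first_pos_props(5)[OF gauss c q(1) refl] gauss_word_positions(2)[OF gauss c] q(2)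
    by (auto simp: partner_def is_first_def)
qed

lemma w_partner: "k < n \<Longrightarrow> w ! partner w k = w ! k"
  using partner_props(1,6)[of k] by simp

lemma ex_planar_diagram:
  assumes n: "0 < n" and real: "\<And>c. c \<in> set w \<Longrightarrow> is_real c"
  shows "\<exists>D. long_diagram D \<and> filter is_real D = w"
proof -
  interpret D: drawing True "4 * int n" "3 * int n" "2 * n" plane_x plane_y
    using plane_drawing[OF n] .
  \<comment> \<open>The number of steps from the start of the segment to the row (for a first
    passage) or the column (for a second passage) of the partner.\<close>
  define off where "off k = nat (if is_first k then int n + int (partner w k) - plane_y (2 * k)
    else \<bar>int n + int (partner w k) - plane_x (2 * k)\<bar>)" for k
  define st :: "nat \<Rightarrow> curve_point" where "st k = (2 * k, \<not> is_first k, off k)" for k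
  define pt where "pt k = (if is_first k then (int n + int k, int n + int (partner w k))
    else (int n + int (partner w k), int n + int k))" for k
  have y_even: "plane_y (2 * k) < int n" if "k < n" for k
    using that plane_y_simps(2)[of "k - 1"] by (cases k) (auto simp: plane_y_def)
  have mods: "(int n + int k) mod (4 * int n) = int n + int k" "(int n + int k) mod (3 * int n) = int n + int k" if "k < n" for k
    using that by simp_all
  have st: "D.valid (st k) \<and> D.point (st k) = pt k \<and>
      D.dir (st k) = (if is_first k then 1 else if orientation (w ! k) = -1 then 0 else 2)" if k: "k < n" for k
  proof -
    have p: "partner w k < n" using partner_props(1)[OF k] .
    show ?thesis
    proof (cases "is_first k")
      case True
      have b: "plane_y (2 * k) < int n" "plane_y (Suc (2 * k)) = 2 * int n + int k"
        using y_even[OF k] True plane_y_simps(1)[of k] by simp_all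
      have o: "int (off k) = int n + int (partner w k) - plane_y (2 * k)" using b True by (simp add: off_def)
      have len: "int (D.seg_length (2 * k) False) = 2 * int n + int k - plane_y (2 * k)"
        using b by (simp add: D.seg_length_def)
      have "off k < D.seg_length (2 * k) False" using o len p by linarith
      moreover have "sgn (plane_y (Suc (2 * k)) - plane_y (2 * k)) = 1" using b by simp
      ultimately show ?thesis
        using True k o b mods[OF k] mods[OF p] plane_x_simps(1)[OF k]
        by (simp add: st_def D.valid_def D.point_def D.loc_def D.proj_def D.dir_def pt_def)
    next
      case False
      have xs: "plane_x (2 * k) = (if orientation (w ! k) = -1 then int k else 2 * int n + int k)"
        "plane_x (Suc (2 * k)) = (if orientation (w ! k) = -1 then 2 * int n + int k else int k)"
        using plane_x_simps[OF k] False by simp_all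
      have y: "plane_y (Suc (2 * k)) = int n + int k" using plane_y_simps(1)[of k] False by simp
      have o: "int (off k) = (if orientation (w ! k) = -1 then int n + int (partner w k) - int k
          else int n + int k - int (partner w k))"
        using xs False k p by (auto simp: off_def)
      have len: "D.seg_length (2 * k) True = 2 * n"
        using xs by (auto simp: D.seg_length_def)
      have "off k < 2 * n" using o p k by (cases "orientation (w ! k) = -1") auto
      then show ?thesis
        using False k o xs y len mods[OF k] mods[OF p] n
        by (auto simp: st_def D.valid_def D.point_def D.loc_def D.proj_def D.dir_def pt_def)
    qed
  qed
  have pt_partner: "pt (partner w k) = pt k" if "k < n" for k
    using that is_first_partner partner_props(2) by (simp add: pt_def)
  define real_pt where "real_pt v \<longleftrightarrow> (\<exists>k<n. v = pt k)" for v
  have only: "s = st k \<or> s = st (partner w k)" if s: "D.valid s" "D.point s = pt k" and k: "k < n" for s k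
  proof (rule ccontr)
    assume ne: "\<not> (s = st k \<or> s = st (partner w k))"
    note p = partner_props[OF k]
    have e: "D.point s = D.point (st k)" "D.point s = D.point (st (partner w k))"
      using st[OF k] st[OF p(1)] pt_partner[OF k] s by simp_all
    show False
      using D.double_point(1)[of s "st k"] D.double_point(1)[of s "st (partner w k)"] st[OF k] st[OF p(1)] s e ne
        is_first_partner[OF k] by (auto simp: st_def)
  qed
  have crossing: "D.is_crossing (st k)" if k: "k < n" for k
    unfolding D.is_crossing_def
    by (rule exI[of _ "st (partner w k)"])
      (use st[OF k] st[OF partner_props(1)[OF k]] pt_partner[OF k] partner_props(3)[OF k] in \<open>simp add: st_def\<close>)
  \<comment> \<open>Both indices \<open>k\<close> of a real point carry the same letter, so the
    choice is harmless. A virtual letter is named after its vertex; should this name occur in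
    \<open>w\<close>, the kinds still keep the letters apart.\<close>
  define lab where "lab v = (if real_pt v then w ! (SOME k. k < n \<and> v = pt k) else (to_nat v, Virtual (D.orient_at v = 1)))" for v
  have pt_eq: "pt k = pt l \<Longrightarrow> w ! k = w ! l" if "k < n" "l < n" for k l
    using that w_partner by (auto simp: pt_def split: if_splits)
  have lab_real: "lab (pt k) = w ! k" if k: "k < n" for k
  proof -
    have "\<exists>l. l < n \<and> pt k = pt l" using k by auto
    from someI_ex[OF this] show ?thesis using pt_eq k unfolding lab_def real_pt_def by metis
  qed
  have is_real_lab: "is_real (lab v) \<longleftrightarrow> real_pt v" for v
  proof (cases "real_pt v")
    case True
    then obtain k where "k < n" "v = pt k" by (auto simp: real_pt_def)
    then show ?thesis using lab_real[of k] real[of "w ! k"] True by simp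
  qed (simp add: lab_def)
  define D where "D = map (\<lambda>s. lab (D.point s)) (filter D.is_crossing D.curve_points)"
  have "curve_diagram D.S D.ds D"
    unfolding D_def
  proof (rule D.curve_diagram_lab)
    show "inj_on lab (D.point ` {s. D.valid s \<and> D.is_crossing s})"
    proof (rule inj_onI)
      fix v v' assume e: "lab v = lab v'"
      show "v = v'"
      proof (cases "real_pt v")
        case True
        then have "real_pt v'" using is_real_lab[of v] is_real_lab[of v'] e by simp
        then obtain k l where kl: "k < n" "v = pt k" "l < n" "v' = pt l" using True by (auto simp: real_pt_def)
        then have "w ! l = w ! k" using e lab_real by simp
        then have "l = k \<or> l = partner w k" using partner_props(6)[OF kl(1,3)] by simp
        then show ?thesis using kl pt_partner by auto
      next
        case False
        then have "\<not> real_pt v'" using is_real_lab[of v] is_real_lab[of v'] e by simp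
        then show ?thesis using e False by (simp add: lab_def)
      qed
    qed
    fix s assume s: "D.valid s" "D.is_crossing s"
    show "orientation (lab (D.point s)) = D.orient_at (D.point s)"
    proof (cases "real_pt (D.point s)")
      case True
      then obtain k where "k < n" "D.point s = pt k" by (auto simp: real_pt_def)
      \<comment> \<open>Of the two passages through the point take the second one; its partner is
        then the first, which travels upwards.\<close>
      then obtain q where q: "q < n" "\<not> is_first q" "D.point s = pt q"
        using is_first_partner pt_partner partner_props(1) by metis
      define p where "p = partner w q"
      have p: "p < n" "is_first p" "pt p = pt q" "p < q" "w ! p = w ! q"
        using partner_props(1)[OF q(1)] is_first_partner[OF q(1)] q pt_partner[OF q(1)] partner_less w_partner by (auto simp: p_def)
      have "D.orient_at (D.point (st p)) = (if D.dir (st q) = (D.dir (st p) + 1) mod 4 then 1 else -1)"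
        by (rule D.orient_at_eq) (use st[OF q(1)] st[OF p(1)] p in \<open>auto simp: st_def\<close>)
      then have "D.orient_at (pt q) = orientation (w ! q)"
        using st[OF q(1)] st[OF p(1)] p(2,3) q(2) orientation_cases[of "w ! q"] by auto
      then show ?thesis using q lab_real by simp
    next
      case False
      then show ?thesis by (simp add: lab_def D.orient_at_def)
    qed
  qed
  then have "long_diagram D" using D.has_genus_sphere by (auto simp: long_diagram_def)
  moreover have "filter is_real D = w"
  proof -
    \<comment> \<open>Both lists are ordered by traversal and have the same elements, hence they are
      equal. The virtual crossings between the real ones need not be determined.\<close>
    have "filter (\<lambda>s. is_real (lab (D.point s))) (filter D.is_crossing D.curve_points) = map st [0..<n]"
    proof (rule sorted_wrt_unique[of earlier])
      show "\<not> earlier b a" if "earlier a b" for a b using that by (cases a; cases b) auto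
      show "sorted_wrt earlier (filter (\<lambda>s. is_real (lab (D.point s))) (filter D.is_crossing D.curve_points))"
        using D.sorted_curve_points by (simp add: sorted_wrt_filter)
      show "sorted_wrt earlier (map st [0..<n])"
        unfolding sorted_wrt_map by (rule sorted_wrt_mono_rel[OF _ sorted_wrt_upt]) (auto simp: st_def)
      show "set (filter (\<lambda>s. is_real (lab (D.point s))) (filter D.is_crossing D.curve_points)) = set (map st [0..<n])"
      proof
        show "set (map st [0..<n]) \<subseteq> set (filter (\<lambda>s. is_real (lab (D.point s))) (filter D.is_crossing D.curve_points))"
          using st crossing by (auto simp: D.set_curve_points is_real_lab real_pt_def)
        show "set (filter (\<lambda>s. is_real (lab (D.point s))) (filter D.is_crossing D.curve_points)) \<subseteq> set (map st [0..<n])"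
        proof
          fix s assume "s \<in> set (filter (\<lambda>s. is_real (lab (D.point s))) (filter D.is_crossing D.curve_points))"
          then obtain k where "D.valid s" "k < n" "D.point s = pt k"
            by (auto simp: D.set_curve_points is_real_lab real_pt_def)
          then show "s \<in> set (map st [0..<n])" using only[of s k] partner_props(1)[of k] by auto
        qed
      qed
    qed
    then have "filter is_real D = map (\<lambda>s. lab (D.point s)) (map st [0..<n])"
      unfolding D_def filter_map comp_def by (simp only:)
    also have "\<dots> = map (\<lambda>k. w ! k) [0..<n]"
      using st lab_real by simp
    finally show ?thesis by (simp add: map_nth)
  qed
  ultimately show ?thesis by blast
qed

end

section \<open>Intersection numbers of closed walks on the torus\<close>

definition step_x :: "int \<Rightarrow> int" where
  "step_x d = (if d = 0 then 1 else if d = 2 then -1 else 0)"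

definition step_y :: "int \<Rightarrow> int" where
  "step_y d = (if d = 1 then 1 else if d = 3 then -1 else 0)"

abbreviation direction :: "int \<Rightarrow> bool" where
  "direction d \<equiv> d = 0 \<or> d = 1 \<or> d = 2 \<or> d = 3"

text \<open>
  A closed walk on the torus is given by lifts of its vertices and by its directions.
  \<open>turn_sum f X Y e d\<close> adds up \<open>f\<close> over the germs to the left of a passage through \<open>(X, Y)\<close> which
  enters in direction \<open>e\<close> and leaves in direction \<open>d\<close>.
\<close>

definition turn_sum :: "(int \<Rightarrow> int \<Rightarrow> int \<Rightarrow> int) \<Rightarrow> int \<Rightarrow> int \<Rightarrow> int \<Rightarrow> int \<Rightarrow> int" where
  "turn_sum f X Y e d = (if d = e then f X Y ((d + 1) mod 4) else if d = (e + 1) mod 4 then 0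
     else f X Y ((d + 1) mod 4) + f X Y ((d + 2) mod 4))"

definition walk_sum :: "(int \<Rightarrow> int \<Rightarrow> int \<Rightarrow> int) \<Rightarrow> (nat \<Rightarrow> int) \<Rightarrow> (nat \<Rightarrow> int) \<Rightarrow> (nat \<Rightarrow> int) \<Rightarrow> nat \<Rightarrow> int" where
  "walk_sum f px py o' m = (\<Sum>k<m. turn_sum f (px (Suc k)) (py (Suc k)) (o' k) (o' (Suc k)))"

text \<open>\<open>g X Y\<close> is attached to the unit square with lower left corner
  \<open>(X, Y)\<close>; the value is taken at the square to the left of the dart.\<close>

definition left_face :: "(int \<Rightarrow> int \<Rightarrow> int) \<Rightarrow> int \<Rightarrow> int \<Rightarrow> int \<Rightarrow> int" where
  "left_face g X Y d = (if d = 0 then g X Y else if d = 1 then g (X - 1) Y else if d = 2 then g (X - 1) (Y - 1) else g X (Y - 1))"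

locale closed_walk =
  fixes P Q :: int and px py o' :: "nat \<Rightarrow> int" and m :: nat
  assumes moves: "j < m \<Longrightarrow> px (Suc j) = px j + step_x (o' j)" "j < m \<Longrightarrow> py (Suc j) = py j + step_y (o' j)"
    and directions: "direction (o' j)"
    and closed: "o' m = o' 0" "px m mod P = px 0 mod P" "py m mod Q = py 0 mod Q" "0 < m"
    and no_uturn: "j < m \<Longrightarrow> o' (Suc j) \<noteq> (o' j + 2) mod 4"
begin

lemma walk_sum_telescope:
  fixes \<mu> :: "nat \<Rightarrow> int"
  assumes "\<And>k. k < m \<Longrightarrow> turn_sum f (px (Suc k)) (py (Suc k)) (o' k) (o' (Suc k)) = h k + (\<mu> k - \<mu> (Suc k))"
    "\<mu> m = \<mu> 0"
  shows "walk_sum f px py o' m = (\<Sum>k<m. h k)"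
proof -
  have "walk_sum f px py o' m = (\<Sum>k<m. h k) + (\<Sum>k<m. \<mu> k - \<mu> (Suc k))"
    unfolding walk_sum_def sum.distrib[symmetric] by (rule sum.cong[OF refl]) (simp add: assms(1))
  also have "(\<Sum>k<m. \<mu> k - \<mu> (Suc k)) = 0" using assms(2) by (simp add: sum_lessThan_telescope')
  finally show ?thesis by simp
qed

text \<open>The equations for \<open>f\<close> say that the flow is the boundary of the face chain
  \<open>g\<close>: along each dart it is the value on the left minus the value on the right. The
  pushed walk runs through left faces, so what it crosses at a passage is the difference between two
  consecutive values of \<open>g\<close>.\<close>

lemma turn_sum_potential:
  assumes "j < m"
    and f: "\<And>X Y. f X Y 0 = left_face g X Y 0 - left_face g X Y 3" "\<And>X Y. f X Y 1 = left_face g X Y 1 - left_face g X Y 0"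
      "\<And>X Y. f X Y 2 = left_face g X Y 2 - left_face g X Y 1" "\<And>X Y. f X Y 3 = left_face g X Y 3 - left_face g X Y 2"
  shows "turn_sum f (px (Suc j)) (py (Suc j)) (o' j) (o' (Suc j)) =
    0 + (left_face g (px j) (py j) (o' j) - left_face g (px (Suc j)) (py (Suc j)) (o' (Suc j)))"
  using directions[of j] directions[of "Suc j"] no_uturn[OF assms(1)]
  unfolding turn_sum_def moves[OF assms(1)]
  by (elim disjE) (simp_all add: f left_face_def step_x_def step_y_def)

lemma walk_sum_potential:
  assumes f: "\<And>X Y. f X Y 0 = left_face g X Y 0 - left_face g X Y 3" "\<And>X Y. f X Y 1 = left_face g X Y 1 - left_face g X Y 0"
      "\<And>X Y. f X Y 2 = left_face g X Y 2 - left_face g X Y 1" "\<And>X Y. f X Y 3 = left_face g X Y 3 - left_face g X Y 2"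
    and periodic: "\<And>X Y X' Y'. X mod P = X' mod P \<Longrightarrow> Y mod Q = Y' mod Q \<Longrightarrow> g X Y = g X' Y'"
  shows "walk_sum f px py o' m = 0"
proof -
  have c: "(px m - 1) mod P = (px 0 - 1) mod P" "(py m - 1) mod Q = (py 0 - 1) mod Q"
    using mod_diff_left_eq[of "px m" P 1] mod_diff_left_eq[of "px 0" P 1]
      mod_diff_left_eq[of "py m" Q 1] mod_diff_left_eq[of "py 0" Q 1] closed by simp_all
  have "left_face g (px m) (py m) (o' m) = left_face g (px 0) (py 0) (o' 0)"
    unfolding left_face_def closed(1) by (intro if_cong refl periodic closed c)
  then have "walk_sum f px py o' m = (\<Sum>k<m. 0)"
    by (intro walk_sum_telescope[of f "\<lambda>_. 0" "\<lambda>k. left_face g (px k) (py k) (o' k)"] turn_sum_potential[OF _ f]) auto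
  then show ?thesis by simp
qed

text \<open>In a constant flow each step crosses a fixed amount, up to a correction \<mu> caused by
  turning. It depends on the direction alone and cancels around a closed walk.\<close>

lemma walk_sum_constant:
  "walk_sum (\<lambda>X Y d. if d = 0 then c0 else if d = 1 then c1 else if d = 2 then - c0 else - c1) px py o' m =
    (px m - px 0) * c1 - (py m - py 0) * c0"
proof -
  let ?f = "\<lambda>X Y d. if d = 0 then c0 else if d = 1 then c1 else if d = 2 then - c0 else - c1"
  define \<mu> where "\<mu> d = (if d = 0 then 0 else if d = 1 then - c0 else if d = 2 then - c0 - c1 else - c1)" for d :: int
  have "walk_sum ?f px py o' m = (\<Sum>k<m. step_x (o' (Suc k)) * c1 - step_y (o' (Suc k)) * c0)"
  proof (rule walk_sum_telescope[of _ _ "\<lambda>k. \<mu> (o' k)"])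
    show "turn_sum ?f (px (Suc k)) (py (Suc k)) (o' k) (o' (Suc k)) =
        step_x (o' (Suc k)) * c1 - step_y (o' (Suc k)) * c0 + (\<mu> (o' k) - \<mu> (o' (Suc k)))" if "k < m" for k
      using directions[of k] directions[of "Suc k"] no_uturn[OF that]
      by (elim disjE) (simp_all add: turn_sum_def \<mu>_def step_x_def step_y_def)
  qed (simp add: closed(1))
  also have "\<dots> = (\<Sum>k<m. step_x (o' k) * c1 - step_y (o' k) * c0)"
  proof -
    let ?h = "\<lambda>k. step_x (o' k) * c1 - step_y (o' k) * c0"
    have "(\<Sum>k<m. ?h (Suc k)) - (\<Sum>k<m. ?h k) = ?h m - ?h 0"
      unfolding sum_subtractf[symmetric] by (rule sum_lessThan_telescope)
    then show ?thesis using closed(1) by simp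
  qed
  also have "\<dots> = (px m - px 0) * c1 - (py m - py 0) * c0"
  proof -
    have "px m - px 0 = (\<Sum>k<m. px (Suc k) - px k)" "py m - py 0 = (\<Sum>k<m. py (Suc k) - py k)"
      by (simp_all only: sum_lessThan_telescope)
    then have "px m - px 0 = (\<Sum>k<m. step_x (o' k))" "py m - py 0 = (\<Sum>k<m. step_y (o' k))"
      using moves by simp_all
    then show ?thesis by (simp add: sum_subtractf sum_distrib_right)
  qed
  finally show ?thesis .
qed

text \<open>
  For a cycle on the torus with \<open>a\<close> (\<open>b\<close>) the flow through the edge to the right of (above) a vertex,
  translating it changes it by the boundary of a chain of faces, hence does not change intersection
  numbers.  Averaging over all translations makes the flow constant.
\<close>

lemma walk_sum_cycle:
  fixes a b :: "int \<Rightarrow> int \<Rightarrow> int"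
  defines "f \<equiv> \<lambda>X Y d. if d = 0 then a X Y else if d = 1 then b X Y else if d = 2 then - a (X - 1) Y else - b X (Y - 1)"
  assumes PQ: "0 < P" "0 < Q"
    and kirchhoff: "\<And>X Y. a X Y + b X Y = a (X - 1) Y + b X (Y - 1)"
    and periodic: "\<And>X Y X' Y'. X mod P = X' mod P \<Longrightarrow> Y mod Q = Y' mod Q \<Longrightarrow> a X Y = a X' Y'"
      "\<And>X Y X' Y'. X mod P = X' mod P \<Longrightarrow> Y mod Q = Y' mod Q \<Longrightarrow> b X Y = b X' Y'"
  shows "P * Q * walk_sum f px py o' m =
    (px m - px 0) * (\<Sum>X\<in>{0..<P}. \<Sum>Y\<in>{0..<Q}. b X Y) - (py m - py 0) * (\<Sum>X\<in>{0..<P}. \<Sum>Y\<in>{0..<Q}. a X Y)"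
proof -
  \<comment> \<open>The flow of the cycle translated by \<open>i\<close> to the right and by
    \<open>j\<close> upwards.\<close>
  define sh where "sh i j = (\<lambda>X Y d. f (X - int i) (Y - int j) d)" for i j
  have diff: "walk_sum (\<lambda>X Y d. f1 X Y d - f2 X Y d) px py o' m = walk_sum f1 px py o' m - walk_sum f2 px py o' m" for f1 f2
    unfolding walk_sum_def sum_subtractf[symmetric] by (rule sum.cong[OF refl]) (auto simp: turn_sum_def)
  have per: "(X - c) mod M = (X' - c) mod M" if "X mod M = X' mod M" for X X' c M :: int
    using mod_diff_left_eq[of X M c] mod_diff_left_eq[of X' M c] that by simp
  have k: "a (X - 1) Y = a X Y + b X Y - b X (Y - 1)" for X Y using kirchhoff[of X Y] by simp
  have kb: "b X (Y - 1) = a X Y + b X Y - a (X - 1) Y" for X Y using kirchhoff[of X Y] by simp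
  have right: "walk_sum (sh (Suc i) j) px py o' m = walk_sum (sh i j) px py o' m" for i j
  proof -
    \<comment> \<open>A cycle and its translate to the right bound the faces swept out by its
      vertical edges, weighted by the flow \<open>b\<close> through them.\<close>
    let ?g = "\<lambda>X Y. b (X - int i) (Y - int j)"
    have e: "X - (1 + int i) = X - int i - 1" "X - 1 - int i = X - int i - 1" "Y - 1 - int j = Y - int j - 1"
        "X - (1 + int i) - 1 = X - int i - 1 - 1" for X Y by simp_all
    have "walk_sum (\<lambda>X Y d. sh (Suc i) j X Y d - sh i j X Y d) px py o' m = 0"
    proof (rule walk_sum_potential[of _ ?g])
      show "sh (Suc i) j X Y 0 - sh i j X Y 0 = left_face ?g X Y 0 - left_face ?g X Y 3" for X Y
        using k[of "X - int i" "Y - int j"] by (simp add: sh_def f_def left_face_def e)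
      show "sh (Suc i) j X Y 1 - sh i j X Y 1 = left_face ?g X Y 1 - left_face ?g X Y 0" for X Y
        by (simp add: sh_def f_def left_face_def e)
      show "sh (Suc i) j X Y 2 - sh i j X Y 2 = left_face ?g X Y 2 - left_face ?g X Y 1" for X Y
        using k[of "X - int i - 1" "Y - int j"] by (simp add: sh_def f_def left_face_def e)
      show "sh (Suc i) j X Y 3 - sh i j X Y 3 = left_face ?g X Y 3 - left_face ?g X Y 2" for X Y
        by (simp add: sh_def f_def left_face_def e)
    qed (rule periodic(2); rule per; assumption)
    then show ?thesis unfolding diff by simp
  qed
  have up: "walk_sum (sh i (Suc j)) px py o' m = walk_sum (sh i j) px py o' m" for i j
  proof -
    \<comment> \<open>An upward translation sweeps out the faces above the horizontal edges; here
      the boundary has the opposite sign.\<close>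
    let ?g = "\<lambda>X Y. - a (X - int i) (Y - int j)"
    have e: "Y - (1 + int j) = Y - int j - 1" "X - 1 - int i = X - int i - 1" "Y - 1 - int j = Y - int j - 1"
        "Y - (1 + int j) - 1 = Y - int j - 1 - 1" for X Y by simp_all
    have "walk_sum (\<lambda>X Y d. sh i (Suc j) X Y d - sh i j X Y d) px py o' m = 0"
    proof (rule walk_sum_potential[of _ ?g])
      show "sh i (Suc j) X Y 0 - sh i j X Y 0 = left_face ?g X Y 0 - left_face ?g X Y 3" for X Y
        by (simp add: sh_def f_def left_face_def e)
      show "sh i (Suc j) X Y 1 - sh i j X Y 1 = left_face ?g X Y 1 - left_face ?g X Y 0" for X Y
        using kb[of "X - int i" "Y - int j"] by (simp add: sh_def f_def left_face_def e)
      show "sh i (Suc j) X Y 2 - sh i j X Y 2 = left_face ?g X Y 2 - left_face ?g X Y 1" for X Y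
        by (simp add: sh_def f_def left_face_def e)
      show "sh i (Suc j) X Y 3 - sh i j X Y 3 = left_face ?g X Y 3 - left_face ?g X Y 2" for X Y
        using kb[of "X - int i" "Y - int j - 1"] by (simp add: sh_def f_def left_face_def e)
    qed (simp, rule periodic(1); rule per; assumption)
    then show ?thesis unfolding diff by simp
  qed
  have all: "walk_sum (sh i j) px py o' m = walk_sum f px py o' m" for i j
  proof -
    have "walk_sum (sh i j) px py o' m = walk_sum (sh 0 j) px py o' m" by (induction i) (simp_all add: right)
    also have "\<dots> = walk_sum (sh 0 0) px py o' m" by (induction j) (simp_all add: up)
    finally show ?thesis by (simp add: sh_def)
  qed
  define A0 B0 where "A0 = (\<Sum>X\<in>{0..<P}. \<Sum>Y\<in>{0..<Q}. a X Y)" and "B0 = (\<Sum>X\<in>{0..<P}. \<Sum>Y\<in>{0..<Q}. b X Y)"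
  \<comment> \<open>The values \<open>X - i\<close> run through every residue class exactly once, so
    a sum over all translations does not depend on the place and the averaged flow is
    constant.\<close>
  have period_sum: "(\<Sum>i<nat M. h (X - int i)) = (\<Sum>X\<in>{0..<M}. h X)"
    if "0 < M" "\<And>X X'. X mod M = X' mod M \<Longrightarrow> h X = h X'" for M X :: int and h :: "int \<Rightarrow> int"
  proof -
    have "(\<Sum>i<nat M. h (X - int i)) = (\<Sum>i<nat M. h ((X - int i) mod M))"
      by (rule sum.cong[OF refl]) (rule that(2), simp)
    also have "\<dots> = (\<Sum>X\<in>{0..<M}. h X)"
    proof (rule sum.reindex_bij_witness[of _ "\<lambda>Y. nat ((X - Y) mod M)" "\<lambda>i. (X - int i) mod M"])
      show "nat ((X - (X - int i) mod M) mod M) = i" if "i \<in> {..<nat M}" for i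
        using that \<open>0 < M\<close> by (simp add: mod_diff_right_eq)
      show "(X - int (nat ((X - Y) mod M))) mod M = Y" if "Y \<in> {0..<M}" for Y
        using that \<open>0 < M\<close> by (simp add: mod_diff_right_eq)
      show "nat ((X - Y) mod M) \<in> {..<nat M}" if "Y \<in> {0..<M}" for Y
        using \<open>0 < M\<close> by (simp add: nat_less_iff)
    qed (use that(1) in auto)
    finally show ?thesis .
  qed
  have total: "(\<Sum>i<nat P. \<Sum>j<nat Q. u (X - int i) (Y - int j)) = (\<Sum>X\<in>{0..<P}. \<Sum>Y\<in>{0..<Q}. u X Y)"
    if u: "\<And>X Y X' Y'. X mod P = X' mod P \<Longrightarrow> Y mod Q = Y' mod Q \<Longrightarrow> u X Y = (u X' Y' :: int)" for u X Y
  proof -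
    have "(\<Sum>j<nat Q. u Z (Y - int j)) = (\<Sum>Y\<in>{0..<Q}. u Z Y)" for Z
      by (rule period_sum[OF PQ(2)]) (rule u, simp_all)
    then have "(\<Sum>i<nat P. \<Sum>j<nat Q. u (X - int i) (Y - int j)) = (\<Sum>i<nat P. \<Sum>Y\<in>{0..<Q}. u (X - int i) Y)" by simp
    also have "\<dots> = (\<Sum>X\<in>{0..<P}. \<Sum>Y\<in>{0..<Q}. u X Y)"
      by (rule period_sum[OF PQ(1), of "\<lambda>Z. \<Sum>Y\<in>{0..<Q}. u Z Y"]) (rule sum.cong[OF refl], rule u, simp_all)
    finally show ?thesis .
  qed
  have avg: "(\<Sum>i<nat P. \<Sum>j<nat Q. sh i j X Y d) = (if d = 0 then A0 else if d = 1 then B0 else if d = 2 then - A0 else - B0)" for X Y d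
  proof -
    have T: "(\<Sum>i<nat P. \<Sum>j<nat Q. a (X - int i) (Y - int j)) = A0" "(\<Sum>i<nat P. \<Sum>j<nat Q. b (X - int i) (Y - int j)) = B0" for X Y
      unfolding A0_def B0_def by (rule total; rule periodic; assumption)+
    have e: "X - int i - 1 = (X - 1) - int i" "Y - int j - 1 = (Y - 1) - int j" for i j by simp_all
    have ne: "(1 :: int) \<noteq> 0" "(2 :: int) \<noteq> 0" "(2 :: int) \<noteq> 1" by simp_all
    consider "d = 0" | "d = 1" | "d = 2" | "d \<noteq> 0" "d \<noteq> 1" "d \<noteq> 2" by blast
    then show ?thesis
      by cases (simp_all only: sh_def f_def e T sum_negf if_True if_False simp_thms ne)
  qed
  have lin: "(\<Sum>i<nat P. \<Sum>j<nat Q. walk_sum (sh i j) px py o' m) = walk_sum (\<lambda>X Y d. \<Sum>i<nat P. \<Sum>j<nat Q. sh i j X Y d) px py o' m"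
  proof -
    have t: "(\<Sum>i<nat P. \<Sum>j<nat Q. turn_sum (sh i j) X Y e d) = turn_sum (\<lambda>X Y d. \<Sum>i<nat P. \<Sum>j<nat Q. sh i j X Y d) X Y e d" for X Y e d
      by (simp add: turn_sum_def sum.distrib)
    have swap: "(\<Sum>i<nat P. \<Sum>j<nat Q. \<Sum>k<m. u i j k) = (\<Sum>k<m. \<Sum>i<nat P. \<Sum>j<nat Q. u i j k)"
      for u :: "nat \<Rightarrow> nat \<Rightarrow> nat \<Rightarrow> int"
    proof -
      have "(\<Sum>i<nat P. \<Sum>j<nat Q. \<Sum>k<m. u i j k) = (\<Sum>i<nat P. \<Sum>k<m. \<Sum>j<nat Q. u i j k)"
        by (rule sum.cong[OF refl]) (rule sum.swap)
      also have "\<dots> = (\<Sum>k<m. \<Sum>i<nat P. \<Sum>j<nat Q. u i j k)" by (rule sum.swap)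
      finally show ?thesis .
    qed
    show ?thesis unfolding walk_sum_def t[symmetric] by (rule swap)
  qed
  have "P * Q * walk_sum f px py o' m = (\<Sum>i<nat P. \<Sum>j<nat Q. walk_sum (sh i j) px py o' m)"
    unfolding all using PQ by simp
  also have "\<dots> = (px m - px 0) * B0 - (py m - py 0) * A0"
    unfolding lin avg by (rule walk_sum_constant)
  finally show ?thesis by (simp only: A0_def B0_def)
qed

end

locale torus_drawing = drawing False P Q r x y for P Q :: int and r :: nat and x y :: "nat \<Rightarrow> int"
begin

definition walk_darts :: "(nat \<Rightarrow> int) \<Rightarrow> (nat \<Rightarrow> int) \<Rightarrow> (nat \<Rightarrow> int) \<Rightarrow> nat \<Rightarrow> nat list" where
  "walk_darts px py o' m = map (\<lambda>j. to_nat (proj (px j, py j), o' j)) [0..<m]"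

lemma PQ_pos: "0 < P" "0 < Q"
  using P Q by simp_all

lemma across_step: "direction d \<Longrightarrow> flp (proj (X, Y), d) = (proj (X + step_x d, Y + step_y d), (d + 2) mod 4)"
  by (elim disjE) (simp_all add: across_proj step_x_def step_y_def)

lemma proj_A: "direction d \<Longrightarrow> (proj (X, Y), d) \<in> A"
  using PQ_pos by (auto simp: proj_def grid_darts_def)

lemma flip_proj:
  "direction d \<Longrightarrow> flip S (to_nat (proj (X, Y), d)) = to_nat (proj (X + step_x d, Y + step_y d), (d + 2) mod 4)"
  using proj_A[of d X Y] across_step[of d X Y] by (simp add: flip_grid)

lemma count_walk: "int (count_list (walk_darts px py o' m) (to_nat a)) = (\<Sum>j<m. of_bool ((proj (px j, py j), o' j) = a))"
  unfolding walk_darts_def by (induction m) (auto simp: count_list_append)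

lemma flux_walk:
  assumes "closed_walk P Q px py o' m" "(v, d) \<in> A"
  shows "flux S (walk_darts px py o' m) (to_nat (v, d)) =
    (\<Sum>j<m. of_bool (proj (px j, py j) = v \<and> o' j = d) - of_bool (proj (px (Suc j), py (Suc j)) = v \<and> (o' j + 2) mod 4 = d))"
proof -
  interpret closed_walk P Q px py o' m by fact
  have "(proj (px j, py j), o' j) = flp (v, d) \<longleftrightarrow> (proj (px (Suc j), py (Suc j)), (o' j + 2) mod 4) = (v, d)" if "j < m" for j
    using across_step[OF directions[of j], of "px j" "py j"] moves[OF that]
      across_across(1)[OF assms(2)] across_across(1)[OF proj_A[OF directions[of j], of "px j" "py j"]] by metis
  then show ?thesis
    unfolding flux_def flip_grid[OF assms(2)] count_walk sum_subtractf[symmetric]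
    by (intro sum.cong refl) simp
qed

lemma between_sum:
  assumes "(v, d) \<in> A" "direction d" "direction e" "d \<noteq> (e + 2) mod 4"
  shows "(\<Sum>z\<in>darts_between S (to_nat (v, d)) (to_nat (v, (e + 2) mod 4)). h z) =
    (if d = e then h (to_nat (v, (d + 1) mod 4)) else if d = (e + 1) mod 4 then (0::int)
     else h (to_nat (v, (d + 1) mod 4)) + h (to_nat (v, (d + 2) mod 4)))"
proof -
  have A: "(v, c) \<in> A" if "direction c" for c using assms(1) that by (auto simp: grid_darts_def)
  have rot: "rot S (to_nat (v, c)) = to_nat (v, (c + 1) mod 4)" if "direction c" for c
    using rot_grid[OF A[OF that]] by (simp add: turn_def)
  have r4: "rot S (to_nat (v, 0 :: int)) = to_nat (v, 1 :: int)" "rot S (to_nat (v, 1 :: int)) = to_nat (v, 2 :: int)"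
    "rot S (to_nat (v, 2 :: int)) = to_nat (v, 3 :: int)" "rot S (to_nat (v, 3 :: int)) = to_nat (v, 0 :: int)"
    using rot[of 0] rot[of 1] rot[of 2] rot[of 3] by simp_all
  consider "d = e" | "d = (e + 1) mod 4" "d \<noteq> e" | "d \<noteq> e" "d \<noteq> (e + 1) mod 4" by blast
  then show ?thesis
  proof cases
    case 1
    have "darts_between S (to_nat (v, d)) (to_nat (v, (e + 2) mod 4)) = {to_nat (v, (d + 1) mod 4)}"
      by (rule darts_between_2) (use assms(2) 1 r4 in auto)
    then show ?thesis using 1 by simp
  next
    case 2
    have "darts_between S (to_nat (v, d)) (to_nat (v, (e + 2) mod 4)) = {}"
      by (rule darts_between_1) (use assms(2,3) 2 r4 in auto)
    then show ?thesis using 2 by simp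
  next
    case 3
    have "darts_between S (to_nat (v, d)) (to_nat (v, (e + 2) mod 4)) = {to_nat (v, (d + 1) mod 4), to_nat (v, (d + 2) mod 4)}"
      by (rule darts_between_3) (use assms(2,3,4) 3 r4 in auto)
    then show ?thesis using 3 assms(2) by auto
  qed
qed

text \<open>Displacements in the plane are P and Q times the coordinates of the homology classes, so
  the right-hand side is P Q times the determinant of the two classes.\<close>

lemma intersection_walks:
  assumes X: "closed_walk P Q px py o' m" and Y: "closed_walk P Q qx qy u n"
  shows "P * Q * intersection_number S (walk_darts px py o' m) (walk_darts qx qy u n) =
    (px m - px 0) * (qy n - qy 0) - (py m - py 0) * (qx n - qx 0)"
proof -
  interpret X: closed_walk P Q px py o' m by fact
  interpret Y: closed_walk P Q qx qy u n by fact
  define ys where "ys = walk_darts qx qy u n"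
  define f where "f X Y d = flux S ys (to_nat (proj (X, Y), d))" for X Y d :: int
  define a b where "a X Y = f X Y 0" and "b X Y = f X Y 1" for X Y
  have anti: "f X Y 2 = - a (X - 1) Y" "f X Y 3 = - b X (Y - 1)" for X Y
    using flip_proj[of 2 X Y] flip_proj[of 0 "X - 1" Y] flip_proj[of 3 X Y] flip_proj[of 1 X "Y - 1"]
    by (simp_all add: a_def b_def f_def flux_def step_x_def step_y_def)
  have fl: "f X Y d = (\<Sum>j<n. of_bool (proj (qx j, qy j) = proj (X, Y) \<and> u j = d) -
      of_bool (proj (qx (Suc j), qy (Suc j)) = proj (X, Y) \<and> (u j + 2) mod 4 = d))" if "direction d" for X Y d
    unfolding f_def ys_def by (rule flux_walk[OF Y proj_A[OF that]])
  have dd: "direction 0" "direction 1" "direction 2" "direction 3" by simp_all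
  have kirchhoff: "a X Y + b X Y = a (X - 1) Y + b X (Y - 1)" for X Y
  proof -
    have "f X Y 0 + f X Y 1 + f X Y 2 + f X Y 3 =
        (\<Sum>j<n. of_bool (proj (qx j, qy j) = proj (X, Y)) - of_bool (proj (qx (Suc j), qy (Suc j)) = proj (X, Y)))"
      unfolding fl[OF dd(1)] fl[OF dd(2)] fl[OF dd(3)] fl[OF dd(4)] sum.distrib[symmetric]
    proof (rule sum.cong[OF refl])
      fix j
      show "of_bool (proj (qx j, qy j) = proj (X, Y) \<and> u j = 0) -
          of_bool (proj (qx (Suc j), qy (Suc j)) = proj (X, Y) \<and> (u j + 2) mod 4 = 0) +
          (of_bool (proj (qx j, qy j) = proj (X, Y) \<and> u j = 1) -
          of_bool (proj (qx (Suc j), qy (Suc j)) = proj (X, Y) \<and> (u j + 2) mod 4 = 1)) +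
          (of_bool (proj (qx j, qy j) = proj (X, Y) \<and> u j = 2) -
          of_bool (proj (qx (Suc j), qy (Suc j)) = proj (X, Y) \<and> (u j + 2) mod 4 = 2)) +
          (of_bool (proj (qx j, qy j) = proj (X, Y) \<and> u j = 3) -
          of_bool (proj (qx (Suc j), qy (Suc j)) = proj (X, Y) \<and> (u j + 2) mod 4 = 3)) =
          (of_bool (proj (qx j, qy j) = proj (X, Y)) - of_bool (proj (qx (Suc j), qy (Suc j)) = proj (X, Y)) :: int)"
        using Y.directions[of j] by (elim disjE) simp_all
    qed
    also have "\<dots> = of_bool (proj (qx 0, qy 0) = proj (X, Y)) - of_bool (proj (qx n, qy n) = proj (X, Y))"
      by (rule sum_lessThan_telescope')
    also have "\<dots> = 0" using Y.closed by (simp add: proj_def)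
    finally show ?thesis using anti[of X Y] by (simp add: a_def b_def)
  qed
  have per: "f X Y d = f X' Y' d" if "X mod P = X' mod P" "Y mod Q = Y' mod Q" for X Y X' Y' d
    using that by (simp add: f_def proj_def)
  \<comment> \<open>Each point of the walk has one representative in the fundamental rectangle. The
    total flow in a direction is therefore the number of steps taken that way minus the number of
    opposite steps, that is, a displacement.\<close>
  have all: "(\<Sum>X\<in>{0..<P}. \<Sum>Y\<in>{0..<Q}. of_bool (proj (s, t) = proj (X, Y) \<and> R)) = (of_bool R :: int)" for s t R
  proof -
    have "(\<Sum>X\<in>{0..<P}. \<Sum>Y\<in>{0..<Q}. of_bool (proj (s, t) = proj (X, Y) \<and> R)) =
        (\<Sum>X\<in>{0..<P}. \<Sum>Y\<in>{0..<Q}. if s mod P = X then (if t mod Q = Y then of_bool R else 0) else (0::int))"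
      by (intro sum.cong refl) (auto simp: proj_def)
    also have "\<dots> = (\<Sum>X\<in>{0..<P}. if s mod P = X then (\<Sum>Y\<in>{0..<Q}. if t mod Q = Y then of_bool R else 0) else (0::int))"
      by (intro sum.cong refl) simp
    also have "\<dots> = of_bool R" using PQ_pos by simp
    finally show ?thesis .
  qed
  have tot: "(\<Sum>X\<in>{0..<P}. \<Sum>Y\<in>{0..<Q}. f X Y d) = (\<Sum>j<n. of_bool (u j = d) - of_bool ((u j + 2) mod 4 = d))" if d: "direction d" for d
  proof -
    have "(\<Sum>X\<in>{0..<P}. \<Sum>Y\<in>{0..<Q}. f X Y d) = (\<Sum>X\<in>{0..<P}. \<Sum>j<n. \<Sum>Y\<in>{0..<Q}.
        of_bool (proj (qx j, qy j) = proj (X, Y) \<and> u j = d) -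
        of_bool (proj (qx (Suc j), qy (Suc j)) = proj (X, Y) \<and> (u j + 2) mod 4 = d))"
      unfolding fl[OF d] by (rule sum.cong[OF refl]) (rule sum.swap)
    also have "\<dots> = (\<Sum>j<n. \<Sum>X\<in>{0..<P}. \<Sum>Y\<in>{0..<Q}.
        of_bool (proj (qx j, qy j) = proj (X, Y) \<and> u j = d) -
        of_bool (proj (qx (Suc j), qy (Suc j)) = proj (X, Y) \<and> (u j + 2) mod 4 = d))"
      by (rule sum.swap)
    finally show ?thesis unfolding sum_subtractf all .
  qed
  have "(\<Sum>X\<in>{0..<P}. \<Sum>Y\<in>{0..<Q}. a X Y) = (\<Sum>j<n. qx (Suc j) - qx j)"
    unfolding a_def tot[OF dd(1)]
  proof (rule sum.cong[OF refl])
    fix j assume "j \<in> {..<n}"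
    then have "j < n" by simp
    show "of_bool (u j = 0) - of_bool ((u j + 2) mod 4 = 0) = qx (Suc j) - qx j"
      unfolding Y.moves[OF \<open>j < n\<close>] using Y.directions[of j] by (elim disjE) (simp_all add: step_x_def)
  qed
  then have A0: "(\<Sum>X\<in>{0..<P}. \<Sum>Y\<in>{0..<Q}. a X Y) = qx n - qx 0" by (simp only: sum_lessThan_telescope)
  have "(\<Sum>X\<in>{0..<P}. \<Sum>Y\<in>{0..<Q}. b X Y) = (\<Sum>j<n. qy (Suc j) - qy j)"
    unfolding b_def tot[OF dd(2)]
  proof (rule sum.cong[OF refl])
    fix j assume "j \<in> {..<n}"
    then have "j < n" by simp
    show "of_bool (u j = 1) - of_bool ((u j + 2) mod 4 = 1) = qy (Suc j) - qy j"
      unfolding Y.moves[OF \<open>j < n\<close>] using Y.directions[of j] by (elim disjE) (simp_all add: step_y_def)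
  qed
  then have B0: "(\<Sum>X\<in>{0..<P}. \<Sum>Y\<in>{0..<Q}. b X Y) = qy n - qy 0" by (simp only: sum_lessThan_telescope)
  let ?f = "\<lambda>X Y d. if d = 0 then a X Y else if d = 1 then b X Y else if d = 2 then - a (X - 1) Y else - b X (Y - 1)"
  have feq: "f X Y d = ?f X Y d" if "direction d" for X Y d
    using that anti[of X Y] by (elim disjE) (simp_all add: a_def b_def)
  have "intersection_number S (walk_darts px py o' m) ys = walk_sum ?f px py o' m"
    unfolding intersection_number_def walk_sum_def
  proof (rule sum.cong)
    show "{..<length (walk_darts px py o' m)} = {..<m}" by (simp add: walk_darts_def)
    fix k assume "k \<in> {..<m}"
    then have k: "k < m" by simp
    define v where "v = proj (px (Suc k), py (Suc k))"
    have out: "out_dart (walk_darts px py o' m) k = to_nat (v, o' (Suc k))"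
    proof (cases "Suc k = m")
      case True
      then show ?thesis using X.closed k by (simp add: out_dart_def walk_darts_def v_def proj_def)
    next
      case False
      then have "Suc k < m" using k by simp
      then show ?thesis by (simp add: out_dart_def walk_darts_def v_def)
    qed
    have ind: "in_dart S (walk_darts px py o' m) k = to_nat (v, (o' k + 2) mod 4)"
      using k flip_proj[OF X.directions[of k]] X.moves[OF k] by (simp add: in_dart_def walk_darts_def v_def)
    have h: "direction ((o' (Suc k) + c) mod 4)" for c
      using pos_mod_bound[of 4 "o' (Suc k) + c"] pos_mod_sign[of 4 "o' (Suc k) + c"] by linarith
    show "(\<Sum>e\<in>darts_between S (out_dart (walk_darts px py o' m) k) (in_dart S (walk_darts px py o' m) k).
        int (count_list ys e) - int (count_list ys (flip S e))) =
        turn_sum ?f (px (Suc k)) (py (Suc k)) (o' k) (o' (Suc k))"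
      unfolding out ind flux_def[symmetric]
      unfolding between_sum[OF proj_A[OF X.directions[of "Suc k"], of "px (Suc k)" "py (Suc k)", folded v_def] X.directions X.directions X.no_uturn[OF k]]
      unfolding turn_sum_def feq[OF h[of 1], symmetric] feq[OF h[of 2], symmetric] f_def v_def by (rule refl)
  qed
  then have "P * Q * intersection_number S (walk_darts px py o' m) ys = P * Q * walk_sum ?f px py o' m" by simp
  also have "\<dots> = (px m - px 0) * (qy n - qy 0) - (py m - py 0) * (qx n - qx 0)"
  proof -
    have "P * Q * walk_sum ?f px py o' m = (px m - px 0) * (\<Sum>X\<in>{0..<P}. \<Sum>Y\<in>{0..<Q}. b X Y) -
        (py m - py 0) * (\<Sum>X\<in>{0..<P}. \<Sum>Y\<in>{0..<Q}. a X Y)"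
    proof (rule X.walk_sum_cycle[OF PQ_pos])
      show "a X Y + b X Y = a (X - 1) Y + b X (Y - 1)" for X Y by (rule kirchhoff)
      show "a X Y = a X' Y'" "b X Y = b X' Y'" if "X mod P = X' mod P" "Y mod Q = Y' mod Q" for X Y X' Y'
        unfolding a_def b_def by (rule per[OF that])+
    qed
    then show ?thesis unfolding A0 B0 .
  qed
  finally show ?thesis by (simp only: ys_def)
qed

text \<open>The lift goes on after one turn, each turn adding the displacement of the whole curve.
  So a cycle through the basepoint is an interval of indices as well.\<close>

definition lift_x :: "nat \<Rightarrow> int" where
  "lift_x j = fst (loc (curve_points ! (j mod L))) + int (j div L) * (x r - x 0)"

definition lift_y :: "nat \<Rightarrow> int" where
  "lift_y j = snd (loc (curve_points ! (j mod L))) + int (j div L) * (y r - y 0)"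

definition lift_dir :: "nat \<Rightarrow> int" where
  "lift_dir j = dir (curve_points ! (j mod L))"

lemma direction_dir: "direction (dir s)"
  using dir_cases[of s] by (auto split: if_splits)

lemma loc_next:
  assumes "valid s"
  shows "(fst (loc s) + step_x (dir s), snd (loc s) + step_y (dir s)) =
    (if next_point s = (0, False, 0) then (x r, y r) else loc (next_point s))"
proof -
  obtain i h t where s: "s = (i, h, t)" by (metis surj_pair)
  have i: "i < r" and t: "t < seg_length i h" using assms by (auto simp: valid_def s)
  have full: "int (nat \<bar>a - b\<bar>) * sgn (a - b) = a - b" for a b :: int by (simp add: sgn_if)
  have next_eq: "(fst (loc s) + step_x (dir s), snd (loc s) + step_y (dir s)) =
    (if h then (x i + int (Suc t) * sgn (x (Suc i) - x i), y (Suc i)) else (x i, y i + int (Suc t) * sgn (y (Suc i) - y i)))"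
    using horizontal[OF i] vertical[OF i]
    by (auto simp: s loc_def dir_def step_x_def step_y_def algebra_simps sgn_if)
  show ?thesis
  proof (cases "Suc t < seg_length i h")
    case True
    then show ?thesis unfolding next_eq by (simp add: s next_point_def loc_def)
  next
    case False
    then have e: "seg_length i h = Suc t" using t by simp
    show ?thesis
    proof (cases h)
      case True
      have l: "int (Suc t) * sgn (x (Suc i) - x i) = x (Suc i) - x i"
        using e True full[of "x (Suc i)" "x i"] by (simp add: seg_length_def)
      show ?thesis unfolding next_eq l using e True i
        by (cases "Suc i = r") (simp_all add: s next_point_def loc_def)
    next
      case h: False
      have l: "int (Suc t) * sgn (y (Suc i) - y i) = y (Suc i) - y i"
        using e h full[of "y (Suc i)" "y i"] by (simp add: seg_length_def)
      show ?thesis unfolding next_eq l using e h by (simp add: s next_point_def loc_def)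
    qed
  qed
qed

lemma lift_step:
  "lift_x (Suc j) = lift_x j + step_x (lift_dir j)" "lift_y (Suc j) = lift_y j + step_y (lift_dir j)"
proof -
  define k where "k = j mod L"
  have k: "k < L" using L_pos by (simp add: k_def)
  have n: "next_point (curve_points ! k) = curve_points ! (Suc j mod L)"
    using curve_points_next[OF k] by (simp add: k_def mod_Suc_eq)
  note l = loc_next[OF valid_nth[OF k], unfolded n]
  have zero: "curve_points ! 0 = (0, False, 0)" using curve_points_chain(2,3) by (simp add: hd_conv_nth)
  have "lift_x (Suc j) = lift_x j + step_x (lift_dir j) \<and> lift_y (Suc j) = lift_y j + step_y (lift_dir j)"
  proof (cases "Suc k = L")
    case True
    then have m: "Suc j mod L = 0" "Suc j div L = Suc (j div L)" by (simp_all add: mod_Suc div_Suc k_def)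
    have "loc (0, False, 0) = (x 0, y 0)" by (simp add: loc_def)
    then show ?thesis using l unfolding m zero
      by (simp add: lift_x_def lift_y_def lift_dir_def m zero algebra_simps flip: k_def)
  next
    case False
    then have m: "Suc j mod L = Suc k" "Suc j div L = j div L" by (simp_all add: mod_Suc div_Suc k_def)
    have "Suc k < L" using k False by simp
    then have "curve_points ! Suc k \<noteq> (0, False, 0)"
      unfolding zero[symmetric] using distinct_curve_points L_pos by (simp add: nth_eq_iff_index_eq)
    then have "loc (curve_points ! Suc k) = (fst (loc (curve_points ! k)) + step_x (dir (curve_points ! k)),
        snd (loc (curve_points ! k)) + step_y (dir (curve_points ! k)))" using l m by simp
    then show ?thesis
      by (simp add: lift_x_def lift_y_def lift_dir_def m flip: k_def)
  qed
  then show "lift_x (Suc j) = lift_x j + step_x (lift_dir j)" "lift_y (Suc j) = lift_y j + step_y (lift_dir j)" by auto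
qed

lemma proj_lift: "proj (lift_x j, lift_y j) = point (curve_points ! (j mod L))"
proof -
  have "(a + int k * (x r - x 0)) mod P = a mod P" "(a + int k * (y r - y 0)) mod Q = a mod Q" for a k
    using closing by (simp_all add: mod_eq_dvd_iff)
  then show ?thesis by (simp add: lift_x_def lift_y_def point_def proj_def split: prod.split)
qed

text \<open>Between two visits to the same vertex the curve is a closed walk. Resetting the
  direction at index \<open>m\<close> to the initial one creates the corner of the smoothing; it is
  not a U-turn because the strands at a double point are perpendicular.\<close>

lemma closed_walk_loop:
  assumes m: "0 < m" and pt: "point (curve_points ! (c mod L)) = point (curve_points ! ((c + m) mod L))"
    and ne: "curve_points ! (c mod L) \<noteq> curve_points ! ((c + m) mod L)"
  shows "closed_walk P Q (\<lambda>j. lift_x (c + j)) (\<lambda>j. lift_y (c + j)) (\<lambda>j. if j = m then lift_dir c else lift_dir (c + j)) m"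
proof
  have v: "valid (curve_points ! (j mod L))" for j using L_pos by (intro valid_nth) simp
  note d = double_point[OF v v ne pt]
  show "lift_x (c + Suc j) = lift_x (c + j) + step_x (if j = m then lift_dir c else lift_dir (c + j))"
    "lift_y (c + Suc j) = lift_y (c + j) + step_y (if j = m then lift_dir c else lift_dir (c + j))" if "j < m" for j
    using that lift_step by simp_all
  show "direction (if j = m then lift_dir c else lift_dir (c + j))" for j
    using direction_dir by (simp add: lift_dir_def)
  show "(if m = m then lift_dir c else lift_dir (c + m)) = (if 0 = m then lift_dir c else lift_dir (c + 0))" by simp
  have "proj (lift_x (c + m), lift_y (c + m)) = proj (lift_x (c + 0), lift_y (c + 0))"
    unfolding proj_lift using pt by simp
  then show "lift_x (c + m) mod P = lift_x (c + 0) mod P" "lift_y (c + m) mod Q = lift_y (c + 0) mod Q"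
    by (simp_all add: proj_def)
  show "0 < m" by fact
  have vis: "visit (j mod L) = curve_points ! (Suc j mod L)" for j by (simp add: visit_def mod_Suc_eq)
  have modL: "j mod L < L" for j using L_pos by simp
  show "(if Suc j = m then lift_dir c else lift_dir (c + Suc j)) \<noteq> ((if j = m then lift_dir c else lift_dir (c + j)) + 2) mod 4"
    if j: "j < m" for j
  proof (cases "Suc j = m")
    case True
    then have e: "visit ((c + j) mod L) = curve_points ! ((c + m) mod L)"
      using vis[of "c + j"] unfolding True[symmetric] by simp
    have "lift_dir (c + j) = dir (curve_points ! ((c + m) mod L))"
      using straight[OF modL, of "c + j"] d(3) unfolding e by (simp add: lift_dir_def)
    then show ?thesis
      using True j d(1) dir_cases[of "curve_points ! (c mod L)"] dir_cases[of "curve_points ! ((c + m) mod L)"]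
      by (auto simp: lift_dir_def split: if_splits)
  next
    case False
    have e: "visit ((c + j) mod L) = curve_points ! ((c + Suc j) mod L)" using vis[of "c + j"] by simp
    note sc = straight[OF modL, of "c + j"] corner[OF modL, of "c + j"]
    have "lift_dir (c + Suc j) \<noteq> (lift_dir (c + j) + 2) mod 4"
      using sc dir_cases[of "curve_points ! ((c + j) mod L)"] dir_cases[of "curve_points ! ((c + Suc j) mod L)"]
      unfolding e lift_dir_def
      by (cases "snd (snd (curve_points ! ((c + Suc j) mod L))) = 0") (auto split: if_splits)
    then show ?thesis using False j by simp
  qed
qed

lemma loop_darts:
  "walk_darts (\<lambda>j. lift_x (c + j)) (\<lambda>j. lift_y (c + j)) (\<lambda>j. if j = m then lift_dir c else lift_dir (c + j)) m =
    map (\<lambda>j. ds ! ((c + j) mod L)) [0..<m]"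
  unfolding walk_darts_def
proof (rule map_cong[OF refl])
  fix j assume "j \<in> set [0..<m]"
  then have "j \<noteq> m" by simp
  then show "to_nat (proj (lift_x (c + j), lift_y (c + j)), if j = m then lift_dir c else lift_dir (c + j)) = ds ! ((c + j) mod L)"
    using ds_nth[of "(c + j) mod L"] L_pos by (simp add: proj_lift dart_def lift_dir_def)
qed

definition word :: "(int \<times> int \<Rightarrow> crossing) \<Rightarrow> crossing list" where
  "word lab = map (\<lambda>s. lab (point s)) (filter is_crossing curve_points)"

text \<open>Both cycles are intervals of the cyclic list of darts, \<beta> running across the
  basepoint. In this shape they match the walks in \<open>loop_darts\<close>.\<close>

lemma smoothing_cycles:
  assumes D: "curve_diagram S ds (word lab)" and kl: "k < l" "Suc l < L" "point (visit k) = point (visit l)"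
  shows "alpha_cycle S ds (word lab) (lab (point (visit k))) = map (\<lambda>j. ds ! ((Suc k + j) mod L)) [0..<l - k]"
    and "beta_cycle S ds (word lab) (lab (point (visit k))) = map (\<lambda>j. ds ! ((Suc l + j) mod L)) [0..<L - l + k]"
    and "lab (point (visit k)) \<in> set (word lab)"
proof -
  interpret diagram S ds "word lab" using D by unfold_locales
  define c where "c = lab (point (visit k))"
  have w: "word lab = map (\<lambda>k. lab (point (visit k))) ps"
    unfolding word_def crossing_passages_ds by (rule filter_visits[symmetric])
  have "visit k \<noteq> visit l" using visit_inj[of k l] kl by simp
  then have "is_crossing (visit k)" "is_crossing (visit l)"
    unfolding is_crossing_def using valid_visit kl(3) by metis+
  then have "k \<in> set ps" "l \<in> set ps" unfolding crossing_passages_ds using kl by auto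
  then obtain i j where ij: "i < length ps" "ps ! i = k" "j < length ps" "ps ! j = l" by (metis in_set_conv_nth)
  have len: "length (word lab) = length ps" by (simp add: w)
  have "i < j" using ps_props(4)[of j i] ij kl(1) len by (cases i j rule: linorder_cases) auto
  moreover have "word lab ! i = c" "word lab ! j = c" using ij kl(3) by (simp_all add: w c_def)
  ultimately have pos: "first_pos (word lab) c = i" "second_pos (word lab) c = j"
    using gauss_word_pos_eqI[OF gauss, of i j c] ij(3) len by simp_all
  show cw: "lab (point (visit k)) \<in> set (word lab)" using \<open>word lab ! i = c\<close> ij(1) len by (metis c_def nth_mem)
  then have passages: "passages_of S ds (word lab) c = [k, l]"
    using passages_of_eq[of c] pos ij by (simp add: c_def)
  have "alpha_cycle S ds (word lab) c = drop (Suc k) (take (Suc l) ds)"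
    by (simp add: alpha_cycle_def passages)
  also have "\<dots> = map (\<lambda>j. ds ! ((Suc k + j) mod L)) [0..<l - k]"
    by (rule nth_equalityI) (use kl length_ds in auto)
  finally show "alpha_cycle S ds (word lab) (lab (point (visit k))) = map (\<lambda>j. ds ! ((Suc k + j) mod L)) [0..<l - k]"
    by (simp only: c_def)
  have "beta_cycle S ds (word lab) c = drop (Suc l) ds @ take (Suc k) ds"
    by (simp add: beta_cycle_def passages)
  also have "\<dots> = map (\<lambda>j. ds ! ((Suc l + j) mod L)) [0..<L - l + k]"
  proof (rule nth_equalityI)
    show "length (drop (Suc l) ds @ take (Suc k) ds) = length (map (\<lambda>j. ds ! ((Suc l + j) mod L)) [0..<L - l + k])"
      using kl length_ds by simp
    fix q assume "q < length (drop (Suc l) ds @ take (Suc k) ds)"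
    then have q: "q < L - l + k" using kl length_ds by simp
    show "(drop (Suc l) ds @ take (Suc k) ds) ! q = map (\<lambda>j. ds ! ((Suc l + j) mod L)) [0..<L - l + k] ! q"
    proof (cases "Suc l + q < L")
      case True
      then have "q < L - Suc l" by linarith
      then show ?thesis using True q kl length_ds by (simp add: nth_append)
    next
      case False
      then have "(Suc l + q) mod L = Suc l + q - L" using q kl by (simp add: mod_if)
      moreover have "\<not> q < length (drop (Suc l) ds)" "q - length (drop (Suc l) ds) = Suc l + q - L" "Suc l + q - L < Suc k"
        using False q kl length_ds by auto
      ultimately show ?thesis using q by (simp add: nth_append del: length_drop)
    qed
  qed
  finally show "beta_cycle S ds (word lab) (lab (point (visit k))) = map (\<lambda>j. ds ! ((Suc l + j) mod L)) [0..<L - l + k]"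
    by (simp only: c_def)
qed

lemma lift_eq: "k < L \<Longrightarrow> lift_x k = fst (loc (curve_points ! k))" "k < L \<Longrightarrow> lift_y k = snd (loc (curve_points ! k))"
  "k < L \<Longrightarrow> lift_x (L + k) = fst (loc (curve_points ! k)) + (x r - x 0)"
  "k < L \<Longrightarrow> lift_y (L + k) = snd (loc (curve_points ! k)) + (y r - y 0)"
  using L_pos by (simp_all add: lift_x_def lift_y_def div_add_self1)

text \<open>The determinant form for \<alpha> at the first crossing and \<beta> at the second, where
  the displacement of \<beta> is that of the whole curve minus that of its \<alpha>.\<close>

lemma intersection_loops:
  assumes D: "curve_diagram S ds (word lab)"
    and s: "valid s1" "valid s2" "point s1 = point s2" "earlier s1 s2"
    and t: "valid t1" "valid t2" "point t1 = point t2" "earlier t1 t2"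
  shows "P * Q * intersection_number S (alpha_cycle S ds (word lab) (lab (point s1))) (beta_cycle S ds (word lab) (lab (point t1))) =
    (fst (loc s2) - fst (loc s1)) * (y r - y 0 - (snd (loc t2) - snd (loc t1))) -
    (snd (loc s2) - snd (loc s1)) * (x r - x 0 - (fst (loc t2) - fst (loc t1)))"
proof -
  have ne: "s1 \<noteq> s2" "t1 \<noteq> t2" using s(4) t(4) by (cases s1; cases t1; auto)+
  note ds = double_point[OF s(1,2) ne(1) s(3)] and dt = double_point[OF t(1,2) ne(2) t(3)]
  obtain k l where kl: "k < l" "Suc l < L" "visit k = s1" "visit l = s2" "curve_points ! Suc k = s1" "curve_points ! Suc l = s2"
    using ex_visits[OF s(1) ds(2) s(2) ds(3) s(4)] .
  obtain k' l' where kl': "k' < l'" "Suc l' < L" "visit k' = t1" "visit l' = t2" "curve_points ! Suc k' = t1" "curve_points ! Suc l' = t2"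
    using ex_visits[OF t(1) dt(2) t(2) dt(3) t(4)] .
  have a: "closed_walk P Q (\<lambda>j. lift_x (Suc k + j)) (\<lambda>j. lift_y (Suc k + j))
      (\<lambda>j. if j = l - k then lift_dir (Suc k) else lift_dir (Suc k + j)) (l - k)"
    by (rule closed_walk_loop) (use kl s(3) ne(1) in auto)
  have "Suc k' < L" using kl' by simp
  then have m: "Suc l' + (L - l' + k') = L + Suc k'" "(L + Suc k') mod L = Suc k'"
    using kl' by (simp, simp only: mod_add_self1 mod_less)
  have b: "closed_walk P Q (\<lambda>j. lift_x (Suc l' + j)) (\<lambda>j. lift_y (Suc l' + j))
      (\<lambda>j. if j = L - l' + k' then lift_dir (Suc l') else lift_dir (Suc l' + j)) (L - l' + k')"
    by (rule closed_walk_loop) (simp_all only: m, use kl' t(3) ne(2) in simp_all)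
  have pts: "point (visit k) = point (visit l)" "point (visit k') = point (visit l')" using kl kl' s t by simp_all
  have A: "alpha_cycle S ds (word lab) (lab (point s1)) = walk_darts (\<lambda>j. lift_x (Suc k + j)) (\<lambda>j. lift_y (Suc k + j))
      (\<lambda>j. if j = l - k then lift_dir (Suc k) else lift_dir (Suc k + j)) (l - k)"
    unfolding loop_darts using smoothing_cycles(1)[OF D kl(1,2) pts(1)] kl(3) by simp
  have B: "beta_cycle S ds (word lab) (lab (point t1)) = walk_darts (\<lambda>j. lift_x (Suc l' + j)) (\<lambda>j. lift_y (Suc l' + j))
      (\<lambda>j. if j = L - l' + k' then lift_dir (Suc l') else lift_dir (Suc l' + j)) (L - l' + k')"
    unfolding loop_darts using smoothing_cycles(2)[OF D kl'(1,2) pts(2)] kl'(3) by simp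
  have e: "Suc k + (l - k) = Suc l" "Suc k < L" "Suc k' < L" using kl kl' by simp_all
  show ?thesis
    unfolding A B intersection_walks[OF a b] m e(1) add_0_right
      lift_eq(1,2)[OF e(2)] lift_eq(1,2)[OF kl(2)] lift_eq(1,2)[OF kl'(2)] lift_eq(3,4)[OF e(3)] kl(5,6) kl'(5,6)
    by (simp add: algebra_simps)
qed

end

section \<open>A curve on the torus with prescribed loops\<close>

text \<open>
  On the torus with meridian \<open>X\<close>, the curve starts upwards in column 0, winds \<open>N\<close> times around the
  rows \<open>0, \<dots>, N - 1\<close> to the right, and then crosses these rows in \<open>2 M\<close> vertical strands, winding once
  to the left between consecutive strands.  The crossing of row \<open>j\<close> and strand \<open>i\<close> has
  \<open>\<alpha> = (N - i - j) X\<close>.  Finally the curve crosses its initial segment, with \<open>\<alpha> = \<gamma> + X\<close> where \<open>\<gamma>\<close> is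
  the whole curve, and \<open>X \<cdot> \<gamma> = 1\<close>.
\<close>

locale winding_curve =
  fixes N M :: nat and P Q :: int
  assumes M: "0 < M" and P_eq: "P = int N + 2 * int M + 3" and Q_eq: "Q = int N + 4 * int M"
begin

definition r :: nat where
  "r = N + 2 * M + 2"

text \<open>Modulo P the vertical segment before row \<open>i\<close> is in column -i and strand
  \<open>k\<close> in column 1 + k. These are N + 2M + 2 different residues, and P leaves one column
  free. The multiple of P records the horizontal winding, which increases along the rows and
  decreases after each strand.\<close>

definition cx :: "nat \<Rightarrow> int" where
  "cx i = (if i \<le> N then int i * P - int i else if i < r then (int N - (int i - int N - 1)) * P + (int i - int N)
     else (int N - 2 * int M) * P)"

text \<open>Strands go down and up alternately and overshoot the rows 0 to N - 1 a little further
  each time, so their connections use the separate rows -1, -3, ... below and N + 2, N + 4, ...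
  above. The final row N + 2M - 1 fits between these and is congruent modulo Q to the initial height
  -2M - 1.\<close>

definition cy :: "nat \<Rightarrow> int" where
  "cy i = (if i = 0 then - 2 * int M - 1 else if i \<le> N + 1 then int i - 1 else if i = r then int N + 2 * int M - 1
     else if even (i + N) then int N + 1 - int i else int i - 1)"

lemma cx_strand: "k \<le> 2 * M \<Longrightarrow> cx (N + 1 + k) = (int N - int k) * P + (1 + int k)"
  by (simp add: cx_def r_def)

lemma cy_strand: "k < 2 * M \<Longrightarrow> cy (N + 2 + k) = (if even k then - 1 - int k else int N + 1 + int k)"
  by (simp add: cy_def r_def)

lemma cy_last: "cy (N + 2 + 2 * M) = int N + 2 * int M - 1"
  by (simp add: cy_def r_def)

lemma segment_cases:
  assumes "i < r"
  obtains "i \<le> N" | k where "k \<le> 2 * M" "i = N + 1 + k"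
proof (cases "i \<le> N")
  case False
  then have "i = N + 1 + (i - N - 1)" "i - N - 1 \<le> 2 * M" using assms by (auto simp: r_def)
  then show thesis using that by metis
qed (use that in auto)

lemma cx_mod: "i < r \<Longrightarrow> cx i mod P = (if i \<le> N then - int i else int i - int N) mod P"
proof (erule segment_cases)
  assume i: "i \<le> N"
  have "cx i = - int i + int i * P" using i by (simp add: cx_def)
  then show ?thesis using i by (simp only: mod_mult_self1 if_True)
next
  fix k assume k: "k \<le> 2 * M" "i = N + 1 + k"
  have "cx i = (1 + int k) + (int N - int k) * P" using cx_strand[OF k(1)] k(2) by simp
  then show ?thesis using k by (simp only: mod_mult_self1) simp
qed

lemma int_mod_inj: "\<bar>a - b\<bar> < m \<Longrightarrow> a mod m = b mod m \<Longrightarrow> a = (b :: int)"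
proof -
  assume "\<bar>a - b\<bar> < m" "a mod m = b mod m"
  then have "m dvd a - b" by (simp add: mod_eq_dvd_iff)
  then show "a = b" using \<open>\<bar>a - b\<bar> < m\<close> zdvd_not_zless[of "\<bar>a - b\<bar>" m] by (cases "a = b") auto
qed

lemma cy_range: "i < r \<Longrightarrow> - 2 * int M + 1 \<le> cy (Suc i) \<and> cy (Suc i) \<le> int N + 2 * int M"
proof (erule segment_cases)
  fix k assume k: "k \<le> 2 * M" "i = N + 1 + k"
  show ?thesis
  proof (cases "k = 2 * M")
    case True
    then show ?thesis using cy_last k M by simp
  next
    case False
    then show ?thesis using cy_strand[of k] k by (cases "even k") (auto elim: evenE)
  qed
qed (use M in \<open>simp add: cy_def\<close>)

lemma cy_inj: "i < r \<Longrightarrow> j < r \<Longrightarrow> cy (Suc i) = cy (Suc j) \<Longrightarrow> i = j"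
proof -
  have s: "cy (Suc (Suc (N + k))) = (if k = 2 * M then int N + 2 * int M - 1 else if even k then - 1 - int k else int N + 1 + int k)"
    if "k \<le> 2 * M" for k
    using that cy_strand[of k] cy_last by auto
  \<comment> \<open>The final row N + 2M - 1 could coincide with a connecting row N + 1 + k only for
    k + 2 = 2M, impossible for odd \<open>k\<close>.\<close>
  have odd: "int k + 2 \<noteq> 2 * int M" if "odd k" for k
  proof
    assume "int k + 2 = 2 * int M"
    then have "k + 2 = 2 * M" by linarith
    then show False using that by presburger
  qed
  have base: "cy (Suc i) = int i" if "i \<le> N" for i using that by (simp add: cy_def)
  assume "i < r" "j < r" "cy (Suc i) = cy (Suc j)"
  then show "i = j"
    using odd odd[unfolded add.commute[of _ 2]] M by (elim segment_cases) (auto simp: s base split: if_splits)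
qed

lemma drawing: "torus_drawing P Q r cx cy"
proof unfold_locales
  show "2 \<le> P" "1 \<le> Q" "False \<Longrightarrow> even P" "0 < r" using M by (simp_all add: P_eq Q_eq r_def)
  show "i = j" if "i < r" "j < r" "cx i mod P = cx j mod P" for i j
  proof -
    define c where "c i = (if i \<le> N then - int i else int i - int N)" for i
    have "c i = c j"
      by (rule int_mod_inj) (use that cx_mod in \<open>auto simp: c_def P_eq r_def\<close>)
    then show ?thesis by (auto simp: c_def split: if_splits)
  qed
  show "i = j" if "i < r" "j < r" "cy (Suc i) mod Q = cy (Suc j) mod Q" for i j
  proof -
    have "\<bar>cy (Suc i) - cy (Suc j)\<bar> < Q"
      unfolding Q_eq using cy_range[OF that(1)] cy_range[OF that(2)] by linarith
    then have "cy (Suc i) = cy (Suc j)" using that(3) by (rule int_mod_inj)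
    then show ?thesis using cy_inj that by blast
  qed
  show "cx r mod P = cx 0 mod P" by (simp add: cx_def r_def)
  have "cy r = cy 0 + 1 * Q" by (simp add: cy_def r_def Q_eq)
  then show "cy r mod Q = cy 0 mod Q" by (simp only: mod_mult_self1)
  show "cx i \<noteq> cx (Suc i) \<and> \<bar>cx (Suc i) - cx i\<bar> < P" if "i < r" for i
    using that
  proof (cases rule: segment_cases)
    case 1
    have P: "1 < P" by (simp add: P_eq)
    show ?thesis
    proof (cases "i = N")
      case True
      then have "cx i = int N * P - int N" "cx (Suc i) = int N * P + 1"
        using cx_strand[of 0] by (simp_all add: cx_def)
      then show ?thesis by (simp add: P_eq)
    next
      case False
      then have "cx i = int i * P - int i" "cx (Suc i) = int i * P + P - int i - 1"
        using 1 by (simp_all add: cx_def algebra_simps)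
      then show ?thesis using P by simp
    qed
  next
    case (2 k)
    have c: "cx i = (int N - int k) * P + (1 + int k)" using cx_strand[OF 2(1)] 2(2) by simp
    show ?thesis
    proof (cases "k = 2 * M")
      case True
      then have "cx (Suc i) = (int N - int k) * P" using 2 by (simp add: cx_def r_def)
      then show ?thesis using c True by (simp add: P_eq)
    next
      case False
      then have "cx (Suc i) = (int N - int k) * P - P + (2 + int k)"
        using cx_strand[of "Suc k"] 2 by (simp add: algebra_simps)
      then show ?thesis using c M by (simp add: P_eq)
    qed
  qed
  show "cy i \<noteq> cy (Suc i) \<and> \<bar>cy (Suc i) - cy i\<bar> < Q" if "i < r" for i
    using that
  proof (cases rule: segment_cases)
    case 1
    then show ?thesis using M by (cases i) (simp_all add: cy_def Q_eq)
  next
    case (2 k)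
    have prev: "cy i = (if k = 0 then int N else if even k then int N + int k else - int k)"
    proof (cases k)
      case (Suc l)
      then show ?thesis using cy_strand[of l] 2 by simp
    qed (use 2 in \<open>simp add: cy_def\<close>)
    show ?thesis
    proof (cases "k = 2 * M")
      case True
      then show ?thesis using prev cy_last 2 M by (simp add: Q_eq)
    next
      case False
      then have k: "k < 2 * M" using 2 by simp
      then have "odd k \<or> k + 2 \<le> 2 * M" by presburger
      then show ?thesis using prev cy_strand[OF k] 2 k M by (auto simp: Q_eq)
    qed
  qed
qed simp_all

sublocale T: torus_drawing P Q r cx cy
  by (rule drawing)

text \<open>Row \<open>j\<close> begins in column -j, so 1 + i + j steps lead to column 1 + i, that
  of strand \<open>i\<close>.\<close>

definition row_point :: "nat \<Rightarrow> nat \<Rightarrow> curve_point" where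
  "row_point i j = (j, True, 1 + i + j)"

text \<open>Downward strands begin at height N + i and upward strands at height -i; the offset leads
  to height \<open>j\<close>.\<close>

definition strand_point :: "nat \<Rightarrow> nat \<Rightarrow> curve_point" where
  "strand_point i j = (N + 1 + i, False, if even i then N + i - j else j + i)"

definition first_point :: curve_point where
  "first_point = (0, False, 1)"

text \<open>The connection after strand 2M - 1 lies in row N + 2M, congruent to -2M modulo Q. It
  starts in column 2M, so after 2M steps to the left it meets column 0, one step above the start of
  the curve.\<close>

definition last_point :: curve_point where
  "last_point = (N + 2 * M, True, 2 * M)"

lemma cy_strand_ends:
  assumes "i < 2 * M"
  shows "cy (N + 1 + i) = (if even i then int N + int i else - int i)"
    and "cy (Suc (N + 1 + i)) = (if even i then - 1 - int i else int N + 1 + int i)"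
proof -
  show "cy (N + 1 + i) = (if even i then int N + int i else - int i)"
  proof (cases i)
    case (Suc l)
    then show ?thesis using cy_strand[of l] assms by simp
  qed (simp add: cy_def)
  show "cy (Suc (N + 1 + i)) = (if even i then - 1 - int i else int N + 1 + int i)"
    using cy_strand[OF assms] by simp
qed

lemma row_point:
  assumes i: "i < 2 * M" and j: "j < N"
  shows "T.valid (row_point i j)" "T.loc (row_point i j) = (int j * P + 1 + int i, int j)" "T.dir (row_point i j) = 0"
proof -
  have x: "cx (Suc j) - cx j = P - 1" using j by (simp add: cx_def algebra_simps)
  have P: "0 < P - 1" by (simp add: P_eq)
  have y: "cy (Suc j) = int j" using j by (simp add: cy_def)
  have "nat \<bar>P - 1\<bar> = N + 2 * M + 2" using P_eq by simp
  then show "T.valid (row_point i j)"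
    unfolding row_point_def T.valid_def T.seg_length_def using i j by (simp add: x r_def)
  show "T.loc (row_point i j) = (int j * P + 1 + int i, int j)"
    using P x y j by (simp add: row_point_def T.loc_def cx_def)
  show "T.dir (row_point i j) = 0" using x P by (simp add: row_point_def T.dir_def)
qed

lemma strand_point:
  assumes i: "i < 2 * M" and j: "j < N"
  shows "T.valid (strand_point i j)" "T.loc (strand_point i j) = ((int N - int i) * P + 1 + int i, int j)"
    "T.dir (strand_point i j) = (if even i then 3 else 1)"
proof -
  note y = cy_strand_ends[OF i]
  have x: "cx (N + 1 + i) = (int N - int i) * P + (1 + int i)" by (rule cx_strand) (use i in simp)
  show "T.valid (strand_point i j)"
    unfolding strand_point_def T.valid_def T.seg_length_def using i j y by (cases "even i") (simp_all add: r_def)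
  show "T.loc (strand_point i j) = ((int N - int i) * P + 1 + int i, int j)"
    using i j y x by (cases "even i") (simp_all add: strand_point_def T.loc_def)
  show "T.dir (strand_point i j) = (if even i then 3 else 1)"
    using y by (cases "even i") (simp_all add: strand_point_def T.dir_def)
qed

lemma first_point: "T.valid first_point" "T.loc first_point = (0, - 2 * int M)" "T.dir first_point = 1"
proof -
  have y: "cy 0 = - 2 * int M - 1" "cy (Suc 0) = 0" "cx 0 = 0" by (simp_all add: cy_def cx_def)
  show "T.valid first_point"
    unfolding first_point_def T.valid_def T.seg_length_def using y M by (simp add: r_def)
  show "T.loc first_point = (0, - 2 * int M)" "T.dir first_point = 1"
    using y M by (simp_all add: first_point_def T.loc_def T.dir_def)
qed

lemma last_point: "T.valid last_point" "T.loc last_point = ((int N - 2 * int M + 1) * P, int N + 2 * int M)"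
  "T.dir last_point = 2"
proof -
  have i: "N + 2 * M = N + 1 + (2 * M - 1)" "Suc (N + 2 * M) = N + 1 + 2 * M" using M by simp_all
  have x1: "cx (N + 2 * M) = (int N - 2 * int M + 1) * P + 2 * int M"
    using cx_strand[of "2 * M - 1"] M unfolding i(1)[symmetric] by (simp add: of_nat_diff algebra_simps)
  have x2: "cx (Suc (N + 2 * M)) = (int N - 2 * int M + 1) * P - P + 1 + 2 * int M"
    using cx_strand[of "2 * M"] unfolding i(2)[symmetric] by (simp add: algebra_simps)
  have P: "1 < P" by (simp add: P_eq)
  have d: "cx (Suc (N + 2 * M)) - cx (N + 2 * M) = - (P - 1)" unfolding x1 x2 by simp
  have s: "sgn (- (P - 1)) = -1" using P by simp
  have "N + 2 * M + 1 = N + 2 + (2 * M - 1)" "odd (2 * M - 1)" using M by simp_all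
  then have y: "cy (Suc (N + 2 * M)) = int N + 2 * int M"
    using cy_strand[of "2 * M - 1"] M by (simp add: of_nat_diff)
  have n: "nat \<bar>- (P - 1)\<bar> = N + 2 * M + 2" using P_eq by simp
  show "T.valid last_point"
    unfolding last_point_def T.valid_def T.seg_length_def prod.case d n if_True by (simp add: r_def)
  have "T.loc last_point = (cx (N + 2 * M) + int (2 * M) * sgn (cx (Suc (N + 2 * M)) - cx (N + 2 * M)), cy (Suc (N + 2 * M)))"
    by (simp only: last_point_def T.loc_def prod.case if_True)
  then show "T.loc last_point = ((int N - 2 * int M + 1) * P, int N + 2 * int M)"
    unfolding d unfolding s y x1 by simp
  show "T.dir last_point = 2" using d P by (simp add: last_point_def T.dir_def)
qed

lemma points:
  assumes i: "i < 2 * M" and j: "j < N"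
  shows "T.point (row_point i j) = T.point (strand_point i j)" "earlier (row_point i j) (strand_point i j)"
    "T.orient_at (T.point (row_point i j)) = (if even i then -1 else 1)"
    "T.point first_point = T.point last_point" "earlier first_point last_point" "T.orient_at (T.point first_point) = 1"
    "T.point (row_point i j) = (1 + int i, int j)" "snd (T.point first_point) = int N + 2 * int M"
proof -
  have "int i + 1 < P" "int j < Q" using i j by (simp_all add: P_eq Q_eq)
  then have m: "(1 + int i + c * P) mod P = 1 + int i" "int j mod Q = int j" for c by simp_all
  show pt: "T.point (row_point i j) = (1 + int i, int j)"
    using m(1)[of "int j"] m(2) row_point(2)[OF i j] by (simp add: T.point_def T.proj_def algebra_simps)
  show eq: "T.point (row_point i j) = T.point (strand_point i j)"
    unfolding pt using m(1)[of "int N - int i"] m(2) strand_point(2)[OF i j] by (simp add: T.point_def T.proj_def algebra_simps)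
  show e: "earlier (row_point i j) (strand_point i j)" using j by (simp add: row_point_def strand_point_def)
  show "T.orient_at (T.point (row_point i j)) = (if even i then -1 else 1)"
    using T.orient_at_eq[OF row_point(1)[OF i j] strand_point(1)[OF i j] eq e] row_point(3)[OF i j] strand_point(3)[OF i j] by simp
  have q: "(- 2 * int M) mod Q = int N + 2 * int M" "(int N + 2 * int M) mod Q = int N + 2 * int M"
  proof -
    show 2: "(int N + 2 * int M) mod Q = int N + 2 * int M" using M by (simp add: Q_eq)
    have "(int N + 2 * int M) mod Q = (- 2 * int M + 1 * Q) mod Q"
      by (rule arg_cong[of _ _ "\<lambda>z. z mod Q"]) (simp add: Q_eq)
    then show "(- 2 * int M) mod Q = int N + 2 * int M" unfolding mod_mult_self1 2 by simp
  qed
  have pf: "T.point first_point = (0, int N + 2 * int M)"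
    unfolding T.point_def first_point(2) T.proj_def prod.case q by simp
  show eq: "T.point first_point = T.point last_point"
    unfolding pf unfolding T.point_def last_point(2) T.proj_def prod.case q by simp
  show "snd (T.point first_point) = int N + 2 * int M" unfolding pf by simp
  show e: "earlier first_point last_point" using M by (simp add: first_point_def last_point_def)
  show "T.orient_at (T.point first_point) = 1"
    using T.orient_at_eq[OF first_point(1) last_point(1) eq e] first_point(3) last_point(3) by simp
qed

end

context winding_curve
begin

lemma Delta:
  assumes i: "i < 2 * M" and j: "j < N"
  shows "fst (T.loc (strand_point i j)) - fst (T.loc (row_point i j)) = (int N - int i - int j) * P"
    "snd (T.loc (strand_point i j)) - snd (T.loc (row_point i j)) = 0 * Q"
    "fst (T.loc last_point) - fst (T.loc first_point) = (int N - 2 * int M + 1) * P"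
    "snd (T.loc last_point) - snd (T.loc first_point) = 1 * Q"
    "cx r - cx 0 = (int N - 2 * int M) * P" "cy r - cy 0 = 1 * Q"
  using row_point[OF i j] strand_point[OF i j] first_point last_point
  by (simp_all add: algebra_simps Q_eq cx_def cy_def r_def)

text \<open>With \<alpha>_l = p_l X and \<beta>_l = \<gamma> - \<alpha>_l, all exponents between
  selected ordinary crossings in row l equal p_l and cancel against the diagonal. The last crossing
  has \<alpha> = \<gamma> + X and \<beta> = -X. It contributes 1 - t^p in its column and t^(p + 1) -
  t in its row, which add up to (t - 1)(t^p - 1) for every l.\<close>

lemma ex_realization:
  fixes i j :: "nat \<Rightarrow> nat" and \<epsilon> :: "nat \<Rightarrow> int" and m a :: nat
  assumes len: "\<And>l. l < m \<Longrightarrow> i l < 2 * M \<and> j l < N \<and> (\<epsilon> l = 1 \<longleftrightarrow> odd (i l)) \<and> (\<epsilon> l = 1 \<or> \<epsilon> l = -1)"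
    and inj: "inj_on i {..<m}" and m: "0 < m" and a: "a = 0 \<or> a = 1"
  shows "\<exists>w. curve_diagram T.S T.ds w \<and> w \<noteq> [] \<and> (\<forall>c\<in>set w. is_real c) \<and>
    G_word a w = (t_pow 1 - 1) * (\<Sum>l<m. of_int (\<epsilon> l) * (t_pow (int N - int (i l) - int (j l)) - 1))"
proof -
  define s1 s2 where "s1 l = (if l < m then row_point (i l) (j l) else first_point)"
    and "s2 l = (if l < m then strand_point (i l) (j l) else last_point)" for l
  define e where "e l = (if l < m then \<epsilon> l else 1)" for l
  define p q where "p l = (if l < m then int N - int (i l) - int (j l) else int N - 2 * int M + 1)"
    and "q l = (if l < m then 0 else 1 :: int)" for l
  have ij0: "i 0 < 2 * M" "j 0 < N" using len[OF m] by simp_all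
  note pts0 = points[OF ij0]
  have s: "T.valid (s1 l)" "T.valid (s2 l)" "T.point (s1 l) = T.point (s2 l)" "earlier (s1 l) (s2 l)"
    "T.orient_at (T.point (s1 l)) = e l" for l
    using len[of l] row_point(1)[of "i l" "j l"] strand_point(1)[of "i l" "j l"] points[of "i l" "j l"]
      first_point(1) last_point(1) pts0(4-6) by (auto simp: s1_def s2_def e_def)
  have D: "fst (T.loc (s2 l)) - fst (T.loc (s1 l)) = p l * P" "snd (T.loc (s2 l)) - snd (T.loc (s1 l)) = q l * Q" for l
    using Delta(1-4)[of "i l" "j l"] Delta(3,4)[OF ij0] len[of l] by (auto simp: s1_def s2_def p_def q_def)
  define C where "C = (\<lambda>l. T.point (s1 l)) ` {..m}"
  have pinj: "inj_on (\<lambda>l. T.point (s1 l)) {..m}"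
  proof (rule inj_onI)
    fix l l' assume l: "l \<in> {..m}" "l' \<in> {..m}" "T.point (s1 l) = T.point (s1 l')"
    have in_row: "T.point (s1 k) = (1 + int (i k), int (j k)) \<and> j k < N" if "k < m" for k
      using points(7)[of "i k" "j k"] len[OF that] that by (simp add: s1_def)
    have out_row: "snd (T.point (s1 m)) = int N + 2 * int M" using pts0(8) by (simp add: s1_def)
    show "l = l'"
    proof (cases "l < m")
      case True
      have "l' < m"
      proof (rule ccontr)
        assume "\<not> l' < m"
        then have "l' = m" using l(2) by simp
        then show False using in_row[OF True] out_row l(3) by simp
      qed
      then have "i l = i l'" using in_row[OF True] in_row[of l'] l(3) by simp
      then show ?thesis using inj True \<open>l' < m\<close> by (simp add: inj_on_eq_iff)
    next
      case False
      then have "l = m" using l(1) by simp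
      moreover have "\<not> l' < m" using in_row[of l'] out_row l(3) \<open>l = m\<close> by auto
      ultimately show ?thesis using l(2) by simp
    qed
  qed
  \<comment> \<open>Only the vertices in \<open>C\<close> receive type \<open>a\<close>; all others
    get the other type and do not occur in the sum. The sign is then chosen such that the
    orientation is the geometric one.\<close>
  define lab :: "int \<times> int \<Rightarrow> crossing" where
    "lab v = (to_nat v, Real (v \<in> C \<longleftrightarrow> a = 0) ((v \<in> C \<longleftrightarrow> a = 0) \<longleftrightarrow> T.orient_at v = 1))" for v
  have or1: "T.orient_at v = 1 \<or> T.orient_at v = -1" for v by (simp add: T.orient_at_def)
  have lab_inj: "lab v = lab v' \<longleftrightarrow> v = v'" for v v' by (auto simp: lab_def)
  have real: "is_real (lab v)" for v by (simp add: lab_def)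
  have ori: "orientation (lab v) = T.orient_at v" for v using or1[of v] by (auto simp: lab_def)
  have type: "crossing_type (lab v) = a \<longleftrightarrow> v \<in> C" for v using a by (auto simp: lab_def)
  \<comment> \<open>For \<open>a = 1\<close> all signs are reversed simultaneously, which leaves
    their products unchanged.\<close>
  have sign: "crossing_sign (lab (T.point (s1 l))) = (if a = 0 then 1 else -1) * e l" if "l \<le> m" for l
  proof -
    have "T.point (s1 l) \<in> C" using that by (auto simp: C_def)
    then show ?thesis using s(5)[of l] or1[of "T.point (s1 l)"] by (auto simp: lab_def)
  qed
  have diag: "curve_diagram T.S T.ds (T.word lab)"
    unfolding T.word_def by (rule T.curve_diagram_lab) (simp_all add: ori lab_inj inj_on_def)
  interpret G: diagram T.S T.ds "T.word lab" by unfold_locales (rule diag)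
  have mem: "lab (T.point (s1 l)) \<in> set (T.word lab)" for l
  proof -
    have "\<not> earlier b b" for b by (cases b) auto
    then have "s1 l \<noteq> s2 l" using s(4)[of l] by metis
    then have "T.is_crossing (s1 l)" unfolding T.is_crossing_def using s(2,3)[of l] by metis
    then show ?thesis unfolding T.word_def using s(1) T.set_curve_points by auto
  qed
  have ct: "crossings_of_type a (T.word lab) = (\<lambda>l. lab (T.point (s1 l))) ` {..m}"
  proof
    show "crossings_of_type a (T.word lab) \<subseteq> (\<lambda>l. lab (T.point (s1 l))) ` {..m}"
    proof
      fix c assume c: "c \<in> crossings_of_type a (T.word lab)"
      then have "c \<in> set (T.word lab)" by (simp add: crossings_of_type_def)
      then obtain v where v: "c = lab v" unfolding T.word_def set_map by blast
      then have "v \<in> C" using c type by (simp add: crossings_of_type_def)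
      then show "c \<in> (\<lambda>l. lab (T.point (s1 l))) ` {..m}" unfolding v C_def by blast
    qed
    show "(\<lambda>l. lab (T.point (s1 l))) ` {..m} \<subseteq> crossings_of_type a (T.word lab)"
    proof
      fix c assume "c \<in> (\<lambda>l. lab (T.point (s1 l))) ` {..m}"
      then obtain l where l: "l \<le> m" "c = lab (T.point (s1 l))" by blast
      then have "T.point (s1 l) \<in> C" by (auto simp: C_def)
      then show "c \<in> crossings_of_type a (T.word lab)"
        unfolding crossings_of_type_def l(2) using mem real type by blast
    qed
  qed
  have linj: "inj_on (\<lambda>l. lab (T.point (s1 l))) {..m}" using pinj by (auto simp: inj_on_def lab_inj)
  \<comment> \<open>\<open>(p, q)\<close> are the homology coordinates of the loops and
    \<open>(N - 2M, 1)\<close> those of the whole curve; the right-hand side is the determinant of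
    \<alpha> and \<gamma> - \<alpha>'.\<close>
  have J: "word_pairing (T.word lab) (lab (T.point (s1 l))) (lab (T.point (s1 l'))) div 4 =
      p l * (1 - q l') - q l * (int N - 2 * int M - p l')" for l l'
  proof -
    let ?I = "intersection_number T.S (alpha_cycle T.S T.ds (T.word lab) (lab (T.point (s1 l))))
        (beta_cycle T.S T.ds (T.word lab) (lab (T.point (s1 l'))))"
    have g: "cx r - cx 0 = (int N - 2 * int M) * P" "cy r - cy 0 = 1 * Q" using Delta(5,6)[OF ij0] .
    have "P * Q * ?I = P * Q * (p l * (1 - q l') - q l * (int N - 2 * int M - p l'))"
      unfolding T.intersection_loops[OF diag s(1-4)[of l] s(1-4)[of l']] D g by (simp add: algebra_simps)
    then have "?I = p l * (1 - q l') - q l * (int N - 2 * int M - p l')" using T.PQ_pos by simp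
    then show ?thesis by (simp flip: G.intersection_number_word[OF mem mem])
  qed
  define S1 where "S1 = (\<Sum>l<m. of_int (\<epsilon> l) * (t_pow (int N - int (i l) - int (j l)) - 1) :: laurent)"
  have "G_word a (T.word lab) = (\<Sum>l\<le>m. \<Sum>l'\<le>m. of_int (e l * e l') *
      (t_pow (p l * (1 - q l') - q l * (int N - 2 * int M - p l')) - t_pow (p l * (1 - q l) - q l * (int N - 2 * int M - p l))))"
    unfolding G_word_def G_sum_def ct sum.reindex[OF linj] comp_def J
    by (intro sum.cong refl) (simp add: sign)
  also have "\<dots> = (\<Sum>l<m. of_int (e l) * (1 - t_pow (p l))) + (\<Sum>l<m. of_int (e l) * (t_pow (p l + 1) - t_pow 1))"
  proof -
    have em: "e m = 1" "q m = 1" "p m = int N - 2 * int M + 1" by (simp_all add: e_def q_def p_def)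
    \<comment> \<open>In the row of an ordinary crossing every entry except that at \<open>m\<close>
      coincides with the diagonal one.\<close>
    have "(\<Sum>l'\<le>m. of_int (e l * e l') *
        (t_pow (p l * (1 - q l') - q l * (int N - 2 * int M - p l')) - t_pow (p l * (1 - q l) - q l * (int N - 2 * int M - p l)))) =
        of_int (e l) * (1 - t_pow (p l))" if "l < m" for l
      using that unfolding lessThan_Suc_atMost[symmetric] sum.lessThan_Suc em by (simp add: q_def)
    moreover have "(\<Sum>l'\<le>m. of_int (e m * e l') *
        (t_pow (p m * (1 - q l') - q m * (int N - 2 * int M - p l')) - t_pow (p m * (1 - q m) - q m * (int N - 2 * int M - p m)))) =
        (\<Sum>l<m. of_int (e l) * (t_pow (p l + 1) - t_pow 1))"
      unfolding lessThan_Suc_atMost[symmetric] sum.lessThan_Suc em by (simp add: q_def algebra_simps)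
    ultimately show ?thesis unfolding lessThan_Suc_atMost[symmetric] sum.lessThan_Suc by simp
  qed
  also have "\<dots> = (t_pow 1 - 1) * S1"
    unfolding S1_def sum_distrib_left sum.distrib[symmetric]
  proof (rule sum.cong[OF refl])
    fix l assume "l \<in> {..<m}"
    then have pe: "int N - int (i l) - int (j l) = p l" "\<epsilon> l = e l" by (simp_all add: p_def e_def)
    show "of_int (e l) * (1 - t_pow (p l)) + of_int (e l) * (t_pow (p l + 1) - t_pow 1) =
        (t_pow 1 - 1) * (of_int (\<epsilon> l) * (t_pow (int N - int (i l) - int (j l)) - 1))"
      unfolding pe t_pow_add by (simp add: algebra_simps)
  qed
  finally have G: "G_word a (T.word lab) = (t_pow 1 - 1) * S1" .
  have "\<forall>c\<in>set (T.word lab). is_real c" using real by (auto simp: T.word_def)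
  moreover have "T.word lab \<noteq> []" using mem[of 0] by auto
  ultimately show ?thesis using diag G unfolding S1_def by blast
qed

end

section \<open>Realizing all polynomials, and the equivalence\<close>

lemma signed_sum_nth: "signed_sum ps = (\<Sum>l<length ps. of_int (fst (ps ! l)) * (t_pow (snd (ps ! l)) - 1))"
  unfolding signed_sum_def sum_list_sum_nth by (simp add: case_prod_beta atLeast0LessThan)

text \<open>Each term of the signed sum gets a strand of its own, whose parity yields the sign, and
  then the row that yields the exponent. The Gauss word of the torus curve is the real part of some
  planar diagram, whose class is the required knot.\<close>

lemma double_root_laurent_realized:
  assumes f: "f \<in> double_root_laurents" and a: "a = 0 \<or> a = 1"
  shows "\<exists>K \<in> long_virtual_knots. G_poly a a K = f \<and> sg1 K \<le> 1"
proof -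
  obtain ps0 where ps0: "\<forall>p\<in>set ps0. fst p = 1 \<or> fst p = -1" "f = (t_pow 1 - 1) * signed_sum ps0"
    using f unfolding double_root_laurents_def by blast
  \<comment> \<open>The pair \<open>(1, 0)\<close> contributes t^0 - 1 = 0 and makes the list
    nonempty, as the torus construction needs at least one selected row crossing.\<close>
  define ps where "ps = (1, 0) # ps0"
  have ps: "\<forall>p\<in>set ps. fst p = 1 \<or> fst p = -1" "f = (t_pow 1 - 1) * signed_sum ps" "0 < length ps"
    using ps0 by (auto simp: ps_def signed_sum_def)
  define k where "k = 1 + (\<Sum>p\<leftarrow>ps. nat \<bar>snd p\<bar>)"
  have k: "\<bar>snd (ps ! l)\<bar> < int k" if "l < length ps" for l
  proof -
    have "nat \<bar>snd (ps ! l)\<bar> \<le> (\<Sum>p\<leftarrow>ps. nat \<bar>snd p\<bar>)"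
      by (rule member_le_sum_list) (use that in auto)
    then show ?thesis by (simp add: k_def)
  qed
  \<comment> \<open>\<open>k\<close> exceeds all exponents in absolute value. \<open>N\<close> is
    large enough to keep the rows \<open>j l\<close> nonnegative, and \<open>M\<close> provides all
    strands up to the largest \<open>i l\<close>.\<close>
  define N M where "N = 3 * k + 2 * length ps + 1" and "M = k + length ps"
  \<comment> \<open>Different terms get different strands, with the parity demanded by the sign.
    Beginning at \<open>2 * k\<close> keeps \<open>j l\<close> below \<open>N\<close> even for
    negative exponents.\<close>
  define i where "i l = 2 * (k + l) + of_bool (fst (ps ! l) = 1)" for l
  define j where "j l = nat (int N - snd (ps ! l) - int (i l))" for l
  interpret winding_curve N M "int N + 2 * int M + 3" "int N + 4 * int M"
    by unfold_locales (use ps(3) in \<open>simp_all add: M_def\<close>)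
  have eps: "fst (ps ! l) = 1 \<or> fst (ps ! l) = -1" if "l < length ps" for l
    using ps(1) that nth_mem by blast
  have i: "i l < 2 * M" "int (i l) \<le> 2 * int k + 2 * int l + 1" "2 * int k \<le> int (i l)" if "l < length ps" for l
    using that by (auto simp: i_def M_def)
  have jl: "int (j l) = int N - snd (ps ! l) - int (i l)" "j l < N" if "l < length ps" for l
  proof -
    show "int (j l) = int N - snd (ps ! l) - int (i l)"
      using i[OF that] k[OF that] that by (simp add: j_def N_def)
    then show "j l < N" using i[OF that] k[OF that] by linarith
  qed
  have "\<exists>w. curve_diagram T.S T.ds w \<and> w \<noteq> [] \<and> (\<forall>c\<in>set w. is_real c) \<and>
    G_word a w = (t_pow 1 - 1) * (\<Sum>l<length ps. of_int (fst (ps ! l)) * (t_pow (int N - int (i l) - int (j l)) - 1))"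
  proof (rule ex_realization)
    show "i l < 2 * M \<and> j l < N \<and> (fst (ps ! l) = 1 \<longleftrightarrow> odd (i l)) \<and> (fst (ps ! l) = 1 \<or> fst (ps ! l) = -1)"
      if "l < length ps" for l
      using i[OF that] jl[OF that] eps[OF that] by (auto simp: i_def)
    show "inj_on i {..<length ps}"
    proof (rule inj_onI)
      have half: "i l div 2 = k + l" for l
        unfolding i_def of_bool_def by (cases "fst (ps ! l) = 1") presburger+
      fix l l' assume "i l = i l'"
      from arg_cong[OF this, of "\<lambda>z. z div 2"] show "l = l'" unfolding half by (simp only: add_left_cancel)
    qed
  qed (use ps(3) a in auto)
  then obtain w where w: "curve_diagram T.S T.ds w" "w \<noteq> []" "\<And>c. c \<in> set w \<Longrightarrow> is_real c"
    "G_word a w = (t_pow 1 - 1) * (\<Sum>l<length ps. of_int (fst (ps ! l)) * (t_pow (int N - int (i l) - int (j l)) - 1))"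
    by blast
  have "(\<Sum>l<length ps. of_int (fst (ps ! l)) * (t_pow (int N - int (i l) - int (j l)) - 1)) = signed_sum ps"
    unfolding signed_sum_nth using jl(1) by simp
  then have G: "G_word a w = f" using w(4) ps(2) by simp
  have "gauss_word w" using w(1) by (simp add: curve_diagram_def)
  then obtain D where D: "long_diagram D" "filter is_real D = w"
    using gauss.ex_planar_diagram[OF gauss.intro _ w(3)] w(2) by blast
  define K where "K = diagram_equiv `` {D}"
  have K: "K \<in> long_virtual_knots" unfolding K_def long_virtual_knots_def using D(1) by (intro quotientI) simp
  have DK: "D \<in> K" using D(1) by (simp add: K_def diagram_equiv_def)
  \<comment> \<open>A realization concerns only the real letters of a diagram, so the torus curve
    itself realizes the class of \<open>D\<close>, which gives the genus bound.\<close>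
  have "knot_realization T.S T.ds w K"
    using DK w(1) D(2) unfolding knot_realization_def surface_realization_def by blast
  moreover have "has_genus T.S 1" by (rule T.has_genus_torus) simp
  ultimately have "enat 1 \<in> {enat g | g. \<exists>S ds w. has_genus S g \<and> knot_realization S ds w K}" by blast
  then have "sg1 K \<le> enat 1" unfolding sg1_def by (rule Inf_lower)
  then have "sg1 K \<le> 1" by (simp add: one_enat_def)
  moreover have "G_poly a a K = f" using G_poly_eq_G_word[OF K DK] D(2) G by simp
  ultimately show ?thesis using K by blast
qed

theorem theorem7p2:
  fixes f :: laurent and a :: nat
  assumes "a = 0 \<or> a = 1"
  shows "((\<exists>K \<in> long_virtual_knots. G_poly a a K = f) \<longleftrightarrow>
            (\<exists>K' \<in> long_virtual_knots. G_poly a a K' = f \<and> sg1 K' \<le> 1)) \<and>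
         ((\<exists>K' \<in> long_virtual_knots. G_poly a a K' = f \<and> sg1 K' \<le> 1) \<longleftrightarrow>
            laurent_eval f (1 :: rat) = 0 \<and> laurent_eval (laurent_deriv f) (1 :: rat) = 0)"
proof -
  let ?root = "laurent_eval f (1 :: rat) = 0 \<and> laurent_eval (laurent_deriv f) (1 :: rat) = 0"
  have necessary: "?root" if "K \<in> long_virtual_knots" "G_poly a a K = f" for K
    using G_poly_double_root[OF that(1), of a] unfolding that(2) by (rule conjI)
  have sufficient: "\<exists>K' \<in> long_virtual_knots. G_poly a a K' = f \<and> sg1 K' \<le> 1" if ?root
  proof (rule double_root_laurent_realized[OF double_root_laurentsI assms])
    show "laurent_pairing (\<lambda>_. 1) f = 0" using that laurent_eval_1[of f] by simp
    show "laurent_pairing (\<lambda>k. k) f = 0" using that laurent_eval_deriv_1[of f] by simp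
  qed
  show ?thesis
  proof (rule conjI; rule iffI)
    assume "\<exists>K \<in> long_virtual_knots. G_poly a a K = f"
    then show "\<exists>K' \<in> long_virtual_knots. G_poly a a K' = f \<and> sg1 K' \<le> 1" using necessary sufficient by metis
  next
    assume "\<exists>K' \<in> long_virtual_knots. G_poly a a K' = f \<and> sg1 K' \<le> 1"
    then show "\<exists>K \<in> long_virtual_knots. G_poly a a K = f" by metis
  next
    assume "\<exists>K' \<in> long_virtual_knots. G_poly a a K' = f \<and> sg1 K' \<le> 1"
    then show ?root using necessary by metis
  qed (rule sufficient)
qed

end
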